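(* Let $k$ be a positive integer and $N=2k$. For $p\ge 2$ define $$S_{p,k}:=\inf_{u\in C_c^\infty(\mathbb{H}^N),\ u\neq 0}\ \frac{\|u\|_{k,g}^2}{\left[\int_{\mathbb{H}^N}|u|^p\,dv_g\right]^{2/p}},\qquad \|u\|_{k,g}^2:=\int_{\mathbb{H}^N}(P_ku)\,u\,dv_g .$$ Then $$S_{p,k}=\frac{2\,\beta_0(k,N)\,e+o(1)}{p}\qquad\text{as } p\to\infty,$$ where $e$ is the base of the natural logarithm.
   Context: Functions are real-valued. $\mathbb{H}^N$ is the ball model of hyperbolic space: the open unit ball $\mathbb{B}^N\subset\mathbb{R}^N$ with the metric $g=\left(\frac{2}{1-|x|^2}\right)^2\sum_{i=1}^N dx_i^2$, volume element $dv_g=\left(\frac{2}{1-|x|^2}\right)^N dx$, and Laplace–Beltrami operator $\Delta_g$. GJMS operators on $\mathbb{H}^N$: $P_1=-\Delta_g-\frac{N(N-2)}{4}$ and $P_k=P_1(P_1+2)(P_1+6)\cdots(P_1+k(k-1))=\prod_{j=1}^k\bigl(P_1+j(j-1)\bigr)$. The constant $\beta_0(k,N)$: with $p_0=\frac Nk$, $p_0'=\frac{p_0}{p_0-1}$ and $\omega_{N-1}$ the $(N-1)$-dimensional measure of the unit sphere $S^{N-1}$, $$\beta_0(k,N)=\begin{cases}\dfrac{N}{\omega_{N-1}}\left[\dfrac{\pi^{N/2}2^k\Gamma\left(\frac{k+1}{2}\right)}{\Gamma\left(\frac{N-k+1}{2}\right)}\right]^{p_0'},& k\text{ odd},\\[3ex]\dfrac{N}{\omega_{N-1}}\left[\dfrac{\pi^{N/2}2^k\Gamma\left(\frac{k}{2}\right)}{\Gamma\left(\frac{N-k}{2}\right)}\right]^{p_0'},&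 k\text{ even}.\end{cases}$$ (Here $N=2k$, so $p_0=p_0'=2$.) *)

theory Defs
  imports "HOL-Analysis.Analysis" "HOL-Library.Landau_Symbols"
begin

definition partial_deriv :: "'n::finite \<Rightarrow> (real^'n \<Rightarrow> real) \<Rightarrow> real^'n \<Rightarrow> real" where
  "partial_deriv i f x = deriv (\<lambda>t. f (x + t *\<^sub>R axis i 1)) 0"

text \<open>The classes \<open>C\<^sup>m(S)\<close>; intended for open \<open>S\<close> only.\<close>

primrec Cm_on :: "nat \<Rightarrow> (real^'n::finite) set \<Rightarrow> (real^'n \<Rightarrow> real) \<Rightarrow> bool" where
  "Cm_on 0 S f \<longleftrightarrow> continuous_on S f"
| "Cm_on (Suc m) S f \<longleftrightarrow> f differentiable_on S \<and> (\<forall>i. Cm_on m S (partial_deriv i f))"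

definition smooth_on :: "(real^'n::finite) set \<Rightarrow> (real^'n \<Rightarrow> real) \<Rightarrow> bool" where
  "smooth_on S f \<longleftrightarrow> (\<forall>m. Cm_on m S f)"

text \<open>The Laplace--Beltrami operator of a Riemannian metric given in global coordinates by the
  matrix field \<open>g\<close>, namely
  \<open>\<Delta>\<^sub>g u = |g|\<^bsup>-1/2\<^esup> \<Sum>\<^bsub>i,j\<^esub> \<partial>\<^sub>i (|g|\<^bsup>1/2\<^esup> g\<^bsup>ij\<^esup> \<partial>\<^sub>j u)\<close>, where \<open>|g| = det g\<close>.\<close>

definition laplace_beltrami ::
    "(real^'n::finite \<Rightarrow> real^'n^'n) \<Rightarrow> (real^'n \<Rightarrow> real) \<Rightarrow> real^'n \<Rightarrow> real" where
  "laplace_beltrami g u x =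
     1 / sqrt (det (g x)) *
     (\<Sum>i\<in>UNIV. partial_deriv i
        (\<lambda>y. \<Sum>j\<in>UNIV. sqrt (det (g y)) * matrix_inv (g y) $ i $ j * partial_deriv j u y) x)"

text \<open>The ball model: the underlying set is \<open>ball 0 1\<close>, and the dimension is \<open>N = CARD('n)\<close>.\<close>

definition hyp_metric :: "real^'n::finite \<Rightarrow> real^'n^'n" where
  "hyp_metric x = mat ((2 / (1 - (norm x)\<^sup>2))\<^sup>2)"

definition hyp_vol :: "(real^'n::finite) measure" where
  "hyp_vol = density lborel
     (\<lambda>x. indicator (ball 0 1) x * ennreal ((2 / (1 - (norm x)\<^sup>2)) ^ CARD('n)))"

text \<open>\<open>C\<^sub>c\<^sup>\<infinity>\<close> of hyperbolic space; a function on the ball is represented by its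
  extension by zero, so that \<open>u \<noteq> 0\<close> on the ball is the same as \<open>u \<noteq> (\<lambda>_. 0)\<close>.\<close>

definition test_functions :: "(real^'n::finite \<Rightarrow> real) set" where
  "test_functions = {u. smooth_on (ball 0 1) u \<and>
     compact (closure {x. u x \<noteq> 0}) \<and> closure {x. u x \<noteq> 0} \<subseteq> ball 0 1}"

definition P1 :: "(real^'n::finite \<Rightarrow> real) \<Rightarrow> real^'n \<Rightarrow> real" where
  "P1 u x = - laplace_beltrami hyp_metric u x
            - real CARD('n) * (real CARD('n) - 2) / 4 * u x"

text \<open>\<open>gjms k = P\<^sub>1 \<circ> (P\<^sub>1 + 2) \<circ> \<dots> \<circ> (P\<^sub>1 + k (k - 1))\<close>.\<close>

primrec gjms :: "nat \<Rightarrow> (real^'n::finite \<Rightarrow> real) \<Rightarrow> real^'n \<Rightarrow> real" where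
  "gjms 0 u = u"
| "gjms (Suc k) u = gjms k (\<lambda>x. P1 u x + real (Suc k) * real k * u x)"

definition gjms_norm_sq :: "nat \<Rightarrow> (real^'n::finite \<Rightarrow> real) \<Rightarrow> real" where
  "gjms_norm_sq k u = (\<integral>x. gjms k u x * u x \<partial>hyp_vol)"

definition sobolev_const :: "'n::finite itself \<Rightarrow> real \<Rightarrow> nat \<Rightarrow> real" where
  "sobolev_const _ p k =
     (INF u \<in> (test_functions :: (real^'n \<Rightarrow> real) set) - {\<lambda>_. 0}.
        gjms_norm_sq k u / (\<integral>x. \<bar>u x\<bar> powr p \<partial>hyp_vol) powr (2 / p))"

text \<open>Surface measure on the unit sphere: the unique measure \<open>\<sigma>\<close> for which Lebesgue measure is
  \<open>r\<^bsup>N-1\<^esup> dr d\<sigma>\<close> in polar coordinates. It is \<open>N\<close> times the Lebesgue measure of the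
  cone \<open>{r y | 0 < r \<le> 1, y \<in> E}\<close> over \<open>E\<close>.\<close>

definition sphere_measure :: "(real^'n::finite) set \<Rightarrow> real" where
  "sphere_measure E = real CARD('n) * measure lebesgue {r *\<^sub>R y |r y. 0 < r \<and> r \<le> 1 \<and> y \<in> E}"

definition beta0 :: "'n::finite itself \<Rightarrow> nat \<Rightarrow> real" where
  "beta0 _ k =
     (let N = real CARD('n);
          p0 = N / real k;
          p0' = p0 / (p0 - 1);
          \<omega> = sphere_measure (sphere (0::real^'n) 1)
      in if odd k
         then N / \<omega> * (pi powr (N / 2) * 2 ^ k * Gamma ((real k + 1) / 2)
                         / Gamma ((N - real k + 1) / 2)) powr p0'
         else N / \<omega> * (pi powr (N / 2) * 2 ^ k * Gamma (real k / 2)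
                         / Gamma ((N - real k) / 2)) powr p0')"

end

theory Submission
  imports Defs "HOL-Real_Asymp.Real_Asymp"
begin

text \<open>The conformal factor \<open>1 / \<rho>\<close>, \<open>\<rho> = (1 - |x|\<^sup>2) / 2\<close>, intertwines the operators \<open>P\<^sub>k\<close> with the
  Euclidean \<open>(- \<Delta>)\<^sup>k\<close>; in the critical dimension \<open>N = 2k\<close> the weight is trivial and
  \<open>\<parallel>u\<parallel>\<^sup>2 = \<integral> (- \<Delta>)\<^sup>k u \<cdot> u dx\<close>. The kernel
  \<open>K(x, y) = ln (1 + 4 \<rho>(x) \<rho>(y) / |x - y|\<^sup>2)\<close> satisfies \<open>\<integral> K(x, y) (- \<Delta>)\<^sup>k u(y) dy = c u(x)\<close> with
  \<open>c = (4\<pi>)\<^sup>k (k - 1)! = \<beta>\<^sub>0 / k\<close> and is positive semidefinite, since it is the power series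
  \<open>2 artanh\<close> in the reciprocal of the hyperbolic cosine of the distance, itself a geometric
  series in the Klein model.

  Lower bound: by Cauchy--Schwarz \<open>c (\<integral> h u)\<^sup>2 \<le> \<parallel>u\<parallel>\<^sup>2 \<integral>\<integral> K h h\<close>. For \<open>h dx = |u|\<^bsup>p-1\<^esup> sgn u dv\<^sub>g\<close> the
  double integral is estimated by a pointwise Young inequality and Schur's test, so that
  \<open>c / S \<le> (sup\<^sub>x \<integral> K(x, y)\<^bsup>p/2\<^esup> dv\<^sub>g(y))\<^bsup>2/p\<^esup>\<close>, and the supremum grows like the moments of an exponential
  distribution of rate arbitrarily close to \<open>k\<close>, because \<open>K\<close> has a logarithmic singularity.

  Upper bound: test with smooth truncations of \<open>- ln (|x|\<^sup>2 + e)\<close>, whose energy is at most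
  \<open>c ln (1/e) + O(1)\<close>, and choose \<open>e = exp (- p / (2k))\<close>.\<close>

subsection \<open>Smooth functions of several variables\<close>

text \<open>The bounds meet because both optimise the same expression. At rate k the exponential
  moment of order p/2 is (p / (2 k exp 1))^(p/2), up to factors whose power 2/p tends to 1, so c/S
  is at most about p / (2 k exp 1). The truncated logarithms with L = ln (1/e) have quotient about c
  L / (L^2 exp (-2 k L / p)). This is minimal at L = p / (2k), which is the stated choice of e, and
  its value is 2 k c exp 1 / p. The obstacle in the lower bound is the density rho^(-2k) of dv_g,
  which has infinite mass. Of the p/2 factors of K, 2k are sacrificed: each is bounded so as to
  release one factor rho(y), and together these cancel the density. The shift from p/2 to p/2 - 2k
  is invisible in the limit. The price is a rate strictly below k, since the remaining singularity
  |x - y|^(-2 beta) must be integrable in dimension 2k; the rate is sent to k only after p.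
  Positivity of K is tested on functions supported in a ball of radius R < 1. There the Klein
  vectors have norms bounded by some m < 1, which dominates the geometric series. The logarithmic
  diagonal is reached by dominating the partial sums by K itself.\<close>

lemma has_derivative_partial:
  fixes f :: "real^'n::finite \<Rightarrow> real"
  assumes "(f has_derivative f') (at x)"
  shows "((\<lambda>t. f (x + t *\<^sub>R axis i 1)) has_real_derivative f' (axis i 1)) (at 0)"
proof -
  have "((\<lambda>t. x + t *\<^sub>R axis i 1) has_derivative (\<lambda>t. t *\<^sub>R axis i (1::real))) (at 0)"
    by (auto intro!: derivative_eq_intros)
  moreover have "(f has_derivative f') (at (x + 0 *\<^sub>R axis i 1))"
    using assms by simp
  ultimately have "((\<lambda>t. f (x + t *\<^sub>R axis i 1)) has_derivative (\<lambda>t. f' (t *\<^sub>R axis i 1))) (at 0)"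
    by (rule has_derivative_compose)
  moreover have "f' (t *\<^sub>R axis i 1) = f' (axis i 1) * t" for t
    using assms has_derivative_bounded_linear linear_simps(5)
    by (metis mult.commute real_scaleR_def)
  ultimately show ?thesis
    by (simp add: has_field_derivative_def)
qed

lemma partial_deriv_eq:
  fixes f :: "real^'n::finite \<Rightarrow> real"
  assumes "(f has_derivative f') (at x)"
  shows "partial_deriv i f x = f' (axis i 1)"
  unfolding partial_deriv_def using has_derivative_partial[OF assms] by (rule DERIV_imp_deriv)

lemma partial_deriv_DERIV:
  fixes f :: "real^'n::finite \<Rightarrow> real"
  assumes "f differentiable (at x)"
  shows "((\<lambda>t. f (x + t *\<^sub>R axis i 1)) has_real_derivative partial_deriv i f x) (at 0)"
  using assms has_derivative_partial partial_deriv_eq unfolding differentiable_def by metis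

lemma partial_deriv_cong_open:
  fixes f g :: "real^'n::finite \<Rightarrow> real"
  assumes "open S" "x \<in> S" "\<And>y. y \<in> S \<Longrightarrow> f y = g y"
  shows "partial_deriv i f x = partial_deriv i g x"
  unfolding partial_deriv_def
proof (rule deriv_cong_ev)
  have "((\<lambda>t. x + t *\<^sub>R axis i (1::real)) \<longlongrightarrow> x + 0 *\<^sub>R axis i 1) (nhds 0)"
    by (intro tendsto_intros filterlim_ident)
  then have "eventually (\<lambda>t. x + t *\<^sub>R axis i (1::real) \<in> S) (nhds 0)"
    using assms(1,2) topological_tendstoD by fastforce
  then show "eventually (\<lambda>t. f (x + t *\<^sub>R axis i 1) = g (x + t *\<^sub>R axis i 1)) (nhds 0)"
    by eventually_elim (use assms(3) in auto)
qed simp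

lemma Cm_on_cong:
  assumes "open S" "\<And>x. x \<in> S \<Longrightarrow> f x = g x"
  shows "Cm_on m S f = Cm_on m S g"
  using assms(2)
proof (induction m arbitrary: f g)
  case 0
  then show ?case by (simp cong: continuous_on_cong)
next
  case (Suc m)
  have "(f differentiable_on S) = (g differentiable_on S)"
    using Suc.prems unfolding differentiable_on_def
    by (metis differentiable_transform_within zero_less_one)
  moreover have "Cm_on m S (partial_deriv i f) = Cm_on m S (partial_deriv i g)" for i
    using Suc.prems by (intro Suc.IH partial_deriv_cong_open[OF assms(1)]) auto
  ultimately show ?case by simp
qed

lemma Cm_on_SucD: "Cm_on (Suc m) S f \<Longrightarrow> Cm_on m S f"
proof (induction m arbitrary: f)
  case 0
  then show ?case by (simp add: differentiable_imp_continuous_on)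
qed auto

lemma Cm_on_differentiable:
  assumes "Cm_on (Suc m) S f" "open S" "x \<in> S"
  shows "f differentiable (at x)"
  using assms by (auto simp: differentiable_on_eq_differentiable_at)

lemma Cm_on_subset: "Cm_on m S f \<Longrightarrow> T \<subseteq> S \<Longrightarrow> Cm_on m T f"
  by (induction m arbitrary: f) (auto intro: continuous_on_subset differentiable_on_subset)

lemma Cm_on_Un:
  assumes "open S" "open T" "Cm_on m S f" "Cm_on m T f"
  shows "Cm_on m (S \<union> T) f"
  using assms(3,4)
proof (induction m arbitrary: f)
  case 0
  then show ?case using assms(1,2) by (auto intro: continuous_on_open_Un)
next
  case (Suc m)
  then show ?case using assms(1,2)
    by (auto simp: differentiable_on_eq_differentiable_at open_Un)
qed

lemma partial_deriv_const [simp]: "partial_deriv i (\<lambda>_. c) x = 0"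
  by (simp add: partial_deriv_def)

lemma partial_deriv_const' [simp]: "partial_deriv i (\<lambda>_. c) = (\<lambda>_. 0)"
  by (simp add: fun_eq_iff)

lemma Cm_on_const: "Cm_on m S (\<lambda>_. c)"
  by (induction m arbitrary: c) auto

lemma partial_deriv_component: "partial_deriv i (\<lambda>x. x $ j) x = (if i = j then 1 else 0)"
  by (subst partial_deriv_eq[OF bounded_linear_imp_has_derivative[OF bounded_linear_vec_nth]])
    (simp add: axis_def)

lemma Cm_on_component:
  fixes S :: "(real^'n::finite) set"
  shows "Cm_on m S (\<lambda>x. x $ j)"
proof (cases m)
  case 0
  then show ?thesis by (auto intro!: continuous_intros)
next
  case (Suc m')
  have "partial_deriv i (\<lambda>x. x $ j) = (\<lambda>_. if i = j then 1 else 0)" for i :: 'n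
    by (simp add: fun_eq_iff partial_deriv_component)
  moreover have "(\<lambda>x. x $ j) differentiable_on S"
    by (intro linear_imp_differentiable_on bounded_linear.linear bounded_linear_vec_nth)
  ultimately show ?thesis by (simp add: Suc Cm_on_const)
qed

lemma partial_deriv_add:
  assumes "f differentiable (at x)" "g differentiable (at x)"
  shows "partial_deriv i (\<lambda>y. f y + g y) x = partial_deriv i f x + partial_deriv i g x"
  unfolding partial_deriv_def[of i "\<lambda>y. f y + g y"]
  by (rule DERIV_imp_deriv) (intro DERIV_add partial_deriv_DERIV assms)

lemma partial_deriv_mult:
  assumes "f differentiable (at x)" "g differentiable (at x)"
  shows "partial_deriv i (\<lambda>y. f y * g y) x = partial_deriv i f x * g x + f x * partial_deriv i g x"
  unfolding partial_deriv_def[of i "\<lambda>y. f y * g y"]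
  using DERIV_mult[OF partial_deriv_DERIV[OF assms(1), of i] partial_deriv_DERIV[OF assms(2), of i]]
  by (intro DERIV_imp_deriv) (simp add: mult.commute)

lemma partial_deriv_chain:
  assumes "f differentiable (at x)" "(\<phi> has_real_derivative d) (at (f x))"
  shows "partial_deriv i (\<lambda>y. \<phi> (f y)) x = d * partial_deriv i f x"
  unfolding partial_deriv_def[of i "\<lambda>y. \<phi> (f y)"]
  using DERIV_chain2[OF _ partial_deriv_DERIV[OF assms(1), of i], of \<phi> d] assms(2)
  by (intro DERIV_imp_deriv) simp

lemma Cm_on_add:
  assumes "open S" "Cm_on m S f" "Cm_on m S g"
  shows "Cm_on m S (\<lambda>x. f x + g x)"
  using assms(2,3)
proof (induction m arbitrary: f g)
  case 0
  then show ?case by (auto intro: continuous_on_add)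
next
  case (Suc m)
  have "Cm_on m S (partial_deriv i (\<lambda>x. f x + g x))" for i
    by (subst Cm_on_cong[OF assms(1), where g = "\<lambda>x. partial_deriv i f x + partial_deriv i g x"])
      (use Suc assms(1) in \<open>auto intro!: partial_deriv_add simp: differentiable_on_eq_differentiable_at\<close>)
  then show ?case using Suc.prems by (auto intro: differentiable_on_add)
qed

lemma Cm_on_mult:
  assumes "open S" "Cm_on m S f" "Cm_on m S g"
  shows "Cm_on m S (\<lambda>x. f x * g x)"
  using assms(2,3)
proof (induction m arbitrary: f g)
  case 0
  then show ?case by (auto intro: continuous_on_mult)
next
  case (Suc m)
  have "Cm_on m S (partial_deriv i (\<lambda>x. f x * g x))" for i
    by (subst Cm_on_cong[OF assms(1), where
          g = "\<lambda>x. partial_deriv i f x * g x + f x * partial_deriv i g x"])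
      (use Suc.IH Suc.prems Suc.prems[THEN Cm_on_SucD] assms(1) in
        \<open>auto intro!: partial_deriv_mult Cm_on_add simp: differentiable_on_eq_differentiable_at\<close>)
  then show ?case using Suc.prems by (auto intro: differentiable_on_mult)
qed

text \<open>An outer function is carried together with all its derivatives: a partial derivative of
  \<open>D n (f x)\<close> involves \<open>D (Suc n)\<close>, so the induction on the order of
  smoothness in \<open>Cm_on_compose\<close> has to run over all \<open>n\<close> at once.\<close>

definition deriv_seq :: "real set \<Rightarrow> (nat \<Rightarrow> real \<Rightarrow> real) \<Rightarrow> bool" where
  "deriv_seq S D \<longleftrightarrow> (\<forall>n. \<forall>x\<in>S. (D n has_real_derivative D (Suc n) x) (at x))"

lemma deriv_seqD: "deriv_seq S D \<Longrightarrow> x \<in> S \<Longrightarrow> (D n has_real_derivative D (Suc n) x) (at x)"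
  by (auto simp: deriv_seq_def)

lemma Cm_on_compose:
  assumes "open S" "Cm_on m S f" "deriv_seq T D" "f ` S \<subseteq> T"
  shows "Cm_on m S (\<lambda>x. D n (f x))"
  using assms(2)
proof (induction m arbitrary: n)
  case 0
  have "continuous_on T (D n)"
    by (intro continuous_at_imp_continuous_on ballI DERIV_isCont) (use deriv_seqD[OF assms(3)] in blast)
  then show ?case using 0 assms(4) by (auto intro: continuous_on_compose2)
next
  case (Suc m)
  have d: "f differentiable (at x)" if "x \<in> S" for x
    using Suc.prems assms(1) that Cm_on_differentiable by blast
  have D: "(D n has_real_derivative D (Suc n) (f x)) (at (f x))" if "x \<in> S" for x
    using deriv_seqD[OF assms(3)] assms(4) that by blast
  have "(\<lambda>x. D n (f x)) differentiable (at x)" if "x \<in> S" for x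
    using D[OF that] d[OF that]
    by (metis differentiableI differentiable_def has_derivative_compose has_field_derivative_def)
  then have "(\<lambda>x. D n (f x)) differentiable_on S"
    using assms(1) by (simp add: differentiable_on_eq_differentiable_at)
  moreover have "Cm_on m S (partial_deriv i (\<lambda>x. D n (f x)))" for i
  proof (subst Cm_on_cong[OF assms(1), where g = "\<lambda>x. D (Suc n) (f x) * partial_deriv i f x"])
    show "Cm_on m S (\<lambda>x. D (Suc n) (f x) * partial_deriv i f x)"
      using Suc Cm_on_SucD by (intro Cm_on_mult assms) auto
  qed (use partial_deriv_chain d D in blast)
  ultimately show ?case by simp
qed

section \<open>Closure properties of smooth functions\<close>

lemma smooth_on_Cm: "smooth_on S f \<Longrightarrow> Cm_on m S f"
  by (simp add: smooth_on_def)

lemma smooth_on_differentiable: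
  "smooth_on S f \<Longrightarrow> open S \<Longrightarrow> x \<in> S \<Longrightarrow> f differentiable (at x)"
  unfolding smooth_on_def using Cm_on_differentiable by blast

lemma smooth_on_continuous: "smooth_on S f \<Longrightarrow> continuous_on S f"
  using smooth_on_Cm[of S f 0] by simp

lemma smooth_on_cong:
  "open S \<Longrightarrow> (\<And>x. x \<in> S \<Longrightarrow> f x = g x) \<Longrightarrow> smooth_on S f = smooth_on S g"
  unfolding smooth_on_def using Cm_on_cong by blast

lemma smooth_on_subset: "smooth_on S f \<Longrightarrow> T \<subseteq> S \<Longrightarrow> smooth_on T f"
  unfolding smooth_on_def using Cm_on_subset by blast

lemma smooth_on_Un: "open S \<Longrightarrow> open T \<Longrightarrow> smooth_on S f \<Longrightarrow> smooth_on T f \<Longrightarrow> smooth_on (S \<union> T) f"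
  unfolding smooth_on_def using Cm_on_Un by blast

lemma smooth_on_partial_deriv: "smooth_on S f \<Longrightarrow> smooth_on S (partial_deriv i f)"
  unfolding smooth_on_def by (metis Cm_on.simps(2))

lemma smooth_on_const: "smooth_on S (\<lambda>_. c)"
  by (simp add: smooth_on_def Cm_on_const)

lemma smooth_on_component: "smooth_on S (\<lambda>x. x $ j)"
  by (simp add: smooth_on_def Cm_on_component)

lemma smooth_on_add:
  "open S \<Longrightarrow> smooth_on S f \<Longrightarrow> smooth_on S g \<Longrightarrow> smooth_on S (\<lambda>x. f x + g x)"
  by (simp add: smooth_on_def Cm_on_add)

lemma smooth_on_mult:
  "open S \<Longrightarrow> smooth_on S f \<Longrightarrow> smooth_on S g \<Longrightarrow> smooth_on S (\<lambda>x. f x * g x)"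
  by (simp add: smooth_on_def Cm_on_mult)

lemma smooth_on_minus: "open S \<Longrightarrow> smooth_on S f \<Longrightarrow> smooth_on S (\<lambda>x. - f x)"
  using smooth_on_mult[OF _ smooth_on_const[of S "-1"], of f] by simp

lemma smooth_on_diff:
  "open S \<Longrightarrow> smooth_on S f \<Longrightarrow> smooth_on S g \<Longrightarrow> smooth_on S (\<lambda>x. f x - g x)"
  using smooth_on_add[OF _ _ smooth_on_minus, of S f g] by simp

lemma smooth_on_power: "open S \<Longrightarrow> smooth_on S f \<Longrightarrow> smooth_on S (\<lambda>x. f x ^ n)"
  by (induction n) (auto intro: smooth_on_const smooth_on_mult)

lemma smooth_on_sum:
  assumes "open S" "\<And>i. i \<in> A \<Longrightarrow> smooth_on S (f i)"
  shows "smooth_on S (\<lambda>x. \<Sum>i\<in>A. f i x)"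
  using assms(2)
  by (induction A rule: infinite_finite_induct) (auto intro: smooth_on_const smooth_on_add assms(1))

lemma smooth_on_norm_sq:
  fixes a :: "real^'n::finite"
  assumes "open S" shows "smooth_on S (\<lambda>x. (norm (x - a))\<^sup>2)"
proof -
  have "(\<lambda>x. (norm (x - a))\<^sup>2) = (\<lambda>x. \<Sum>i\<in>UNIV. (x $ i - a $ i) ^ 2)"
    by (simp add: fun_eq_iff norm_vec_def L2_set_def sum_nonneg)
  then show ?thesis
    by (simp only:) (intro smooth_on_sum smooth_on_power smooth_on_diff smooth_on_component
      smooth_on_const assms)
qed

lemma smooth_on_compose:
  "open S \<Longrightarrow> smooth_on S f \<Longrightarrow> deriv_seq T D \<Longrightarrow> f ` S \<subseteq> T \<Longrightarrow> smooth_on S (\<lambda>x. D n (f x))"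
  by (simp add: smooth_on_def Cm_on_compose)

definition lap :: "(real^'n::finite \<Rightarrow> real) \<Rightarrow> real^'n \<Rightarrow> real" where
  "lap u x = (\<Sum>i\<in>UNIV. partial_deriv i (partial_deriv i u) x)"

text \<open>The Euler field x . grad. It enters because the gradient of the conformal factor
  \<open>rho\<close> is -x.\<close>

definition eul :: "(real^'n::finite \<Rightarrow> real) \<Rightarrow> real^'n \<Rightarrow> real" where
  "eul u x = (\<Sum>i\<in>UNIV. x $ i * partial_deriv i u x)"

lemma smooth_on_lap: "open S \<Longrightarrow> smooth_on S u \<Longrightarrow> smooth_on S (lap u)"
  unfolding lap_def by (intro smooth_on_sum smooth_on_partial_deriv) auto

lemma smooth_on_lap_pow: "open S \<Longrightarrow> smooth_on S u \<Longrightarrow> smooth_on S ((lap ^^ j) u)"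
  by (induction j) (auto intro: smooth_on_lap)

lemma smooth_on_eul: "open S \<Longrightarrow> smooth_on S u \<Longrightarrow> smooth_on S (eul u)"
  unfolding eul_def
  by (intro smooth_on_sum smooth_on_mult smooth_on_component smooth_on_partial_deriv) auto

lemma lap_cong:
  assumes "open S" "x \<in> S" "\<And>y. y \<in> S \<Longrightarrow> f y = g y"
  shows "lap f x = lap g x"
  unfolding lap_def
  by (intro sum.cong refl partial_deriv_cong_open[OF assms(1,2)] partial_deriv_cong_open[OF assms(1)] assms(3))

lemma lap_pow_cong:
  assumes "open S" "x \<in> S" "\<And>y. y \<in> S \<Longrightarrow> f y = g y"
  shows "(lap ^^ j) f x = (lap ^^ j) g x"
  using assms(2)
proof (induction j arbitrary: x)
  case (Suc j)
  have "lap ((lap ^^ j) f) x = lap ((lap ^^ j) g) x"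
    using Suc by (intro lap_cong[OF assms(1)]) auto
  then show ?case by simp
qed (use assms(3) in auto)

subsection \<open>The Laplacian\<close>

lemma line_has_real_derivative:
  fixes u :: "real^'n::finite \<Rightarrow> real"
  assumes "u differentiable (at (y + s *\<^sub>R axis i 1))"
  shows "((\<lambda>s. u (y + s *\<^sub>R axis i 1)) has_real_derivative partial_deriv i u (y + s *\<^sub>R axis i 1)) (at s)"
proof -
  have "((\<lambda>t. u ((y + s *\<^sub>R axis i 1) + t *\<^sub>R axis i 1)) has_real_derivative
      partial_deriv i u (y + s *\<^sub>R axis i 1)) (at (s - s))"
    using partial_deriv_DERIV[OF assms] by simp
  then have "((\<lambda>t. u ((y + s *\<^sub>R axis i 1) + (t - s) *\<^sub>R axis i 1)) has_real_derivative
      partial_deriv i u (y + s *\<^sub>R axis i 1)) (at s)"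
    using DERIV_shift[of "\<lambda>t. u ((y + s *\<^sub>R axis i 1) + t *\<^sub>R axis i 1)" _ s "-s"] by simp
  then show ?thesis by (simp add: algebra_simps)
qed

text \<open>The mean value theorem is used twice: in direction \<open>i\<close> for the increment of
  \<open>u\<close> in direction \<open>j\<close>, then in direction \<open>j\<close> for the partial
  derivative so obtained. Both offsets are at most \<open>h\<close>, hence the radius
  \<open>2 * h\<close>.\<close>

lemma second_difference_mvt:
  fixes u :: "real^'n::finite \<Rightarrow> real"
  assumes "smooth_on S u" "open S" "0 < h" "cball x (2 * h) \<subseteq> S"
  shows "\<exists>\<xi>\<in>cball x (2 * h). u (x + h *\<^sub>R axis i 1 + h *\<^sub>R axis j 1) - u (x + h *\<^sub>R axis i 1)
           - u (x + h *\<^sub>R axis j 1) + u x = h\<^sup>2 * partial_deriv j (partial_deriv i u) \<xi>"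
proof -
  have near: "x + s *\<^sub>R axis i 1 + t *\<^sub>R axis j 1 \<in> cball x (2 * h)"
    if "0 \<le> s" "s \<le> h" "0 \<le> t" "t \<le> h" for s t
  proof -
    let ?v = "s *\<^sub>R axis i (1::real) + t *\<^sub>R axis j 1 :: real^'n"
    have "norm ?v \<le> s + t"
      using that norm_triangle_ineq[of "s *\<^sub>R axis i (1::real)" "t *\<^sub>R axis j 1 :: real^'n"] by simp
    moreover have "dist x (x + v) = norm v" for v by (simp add: dist_norm)
    ultimately show ?thesis using that by (simp only: mem_cball add.assoc)
  qed
  have du: "u differentiable (at y)" "partial_deriv i u differentiable (at y)" if "y \<in> cball x (2*h)" for y
    using that assms(4) smooth_on_differentiable[OF assms(1,2)]
      smooth_on_differentiable[OF smooth_on_partial_deriv[OF assms(1)] assms(2)] by auto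
  define G where "G s = u (x + h *\<^sub>R axis j 1 + s *\<^sub>R axis i 1) - u (x + s *\<^sub>R axis i 1)" for s
  have G': "(G has_real_derivative partial_deriv i u (x + h *\<^sub>R axis j 1 + s *\<^sub>R axis i 1)
      - partial_deriv i u (x + s *\<^sub>R axis i 1)) (at s)" if "0 \<le> s" "s \<le> h" for s
    unfolding G_def
    using near[OF that, of h] near[OF that, of 0] assms(3)
    by (intro DERIV_diff line_has_real_derivative du) (simp_all add: add_ac)
  obtain s where s: "0 < s" "s < h" "G h - G 0 = (h - 0) *
      (partial_deriv i u (x + h *\<^sub>R axis j 1 + s *\<^sub>R axis i 1) - partial_deriv i u (x + s *\<^sub>R axis i 1))"
    using MVT2[OF assms(3) G'] by auto
  have H': "((\<lambda>t. partial_deriv i u (x + s *\<^sub>R axis i 1 + t *\<^sub>R axis j 1)) has_real_derivative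
      partial_deriv j (partial_deriv i u) (x + s *\<^sub>R axis i 1 + t *\<^sub>R axis j 1)) (at t)"
    if "0 \<le> t" "t \<le> h" for t
    using near[OF _ _ that, of s] s by (intro line_has_real_derivative du) simp
  obtain t where t: "0 < t" "t < h" "partial_deriv i u (x + s *\<^sub>R axis i 1 + h *\<^sub>R axis j 1)
      - partial_deriv i u (x + s *\<^sub>R axis i 1 + 0 *\<^sub>R axis j 1)
      = (h - 0) * partial_deriv j (partial_deriv i u) (x + s *\<^sub>R axis i 1 + t *\<^sub>R axis j 1)"
    using MVT2[OF assms(3) H'] by auto
  show ?thesis
  proof (rule bexI)
    show "x + s *\<^sub>R axis i 1 + t *\<^sub>R axis j 1 \<in> cball x (2 * h)" using near s t by simp
    show "u (x + h *\<^sub>R axis i 1 + h *\<^sub>R axis j 1) - u (x + h *\<^sub>R axis i 1)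
           - u (x + h *\<^sub>R axis j 1) + u x = h\<^sup>2 * partial_deriv j (partial_deriv i u) (x + s *\<^sub>R axis i 1 + t *\<^sub>R axis j 1)"
      using s(3) t(3) by (simp add: G_def power2_eq_square add_ac)
  qed
qed

text \<open>The second difference is symmetric in \<open>i\<close> and \<open>j\<close>, so the two
  mixed derivatives agree at suitable points arbitrarily close to x. Continuity rules out a gap at x
  itself.\<close>

lemma partial_deriv_commute:
  fixes u :: "real^'n::finite \<Rightarrow> real"
  assumes "smooth_on S u" "open S" "x \<in> S"
  shows "partial_deriv i (partial_deriv j u) x = partial_deriv j (partial_deriv i u) x"
proof (rule ccontr)
  define d where "d a b y = partial_deriv a (partial_deriv b u) y" for a b y
  assume "\<not> ?thesis"
  then have e: "0 < \<bar>d i j x - d j i x\<bar> / 2" (is "0 < ?e") by (simp add: d_def)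
  have "isCont (d a b) x" for a b
    using assms smooth_on_partial_deriv smooth_on_continuous continuous_on_eq_continuous_at
    unfolding d_def by (metis (no_types, lifting) ext)
  then obtain r1 r2 where r: "r1 > 0" "r2 > 0"
    "\<And>y. dist y x < r1 \<Longrightarrow> dist (d i j y) (d i j x) < ?e" "\<And>y. dist y x < r2 \<Longrightarrow> dist (d j i y) (d j i x) < ?e"
    using e unfolding continuous_at_eps_delta by meson
  obtain r3 where r3: "r3 > 0" "cball x r3 \<subseteq> S"
    using assms open_contains_cball by meson
  define h where "h = min r3 (min (r1/2) (r2/2)) / 2"
  have h: "0 < h" "2 * h \<le> r3" "2 * h < r1" "2 * h < r2" using r r3 by (auto simp: h_def)
  then have sub: "cball x (2 * h) \<subseteq> S" using r3 by auto
  obtain \<xi> \<eta> where "\<xi> \<in> cball x (2*h)" "\<eta> \<in> cball x (2*h)" and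
    1: "u (x + h *\<^sub>R axis i 1 + h *\<^sub>R axis j 1) - u (x + h *\<^sub>R axis i 1) - u (x + h *\<^sub>R axis j 1) + u x
      = h\<^sup>2 * d j i \<xi>" and
    2: "u (x + h *\<^sub>R axis j 1 + h *\<^sub>R axis i 1) - u (x + h *\<^sub>R axis j 1) - u (x + h *\<^sub>R axis i 1) + u x
      = h\<^sup>2 * d i j \<eta>"
    using second_difference_mvt[OF assms(1,2) h(1) sub, of i j] second_difference_mvt[OF assms(1,2) h(1) sub, of j i]
    unfolding d_def by blast
  have "x + h *\<^sub>R axis j 1 + h *\<^sub>R axis i 1 = x + h *\<^sub>R axis i 1 + h *\<^sub>R axis j (1::real)"
    by (simp add: add_ac)
  with 1 2 have "h\<^sup>2 * d j i \<xi> = h\<^sup>2 * d i j \<eta>" by (simp only:)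
  with h have "d j i \<xi> = d i j \<eta>" by simp
  moreover have "dist (d i j \<eta>) (d i j x) < ?e" "dist (d j i \<xi>) (d j i x) < ?e"
    using r h \<open>\<xi> \<in> _\<close> \<open>\<eta> \<in> _\<close> by (auto simp: dist_commute)
  ultimately show False unfolding dist_real_def by (smt (verit) field_sum_of_halves)
qed

lemma partial_deriv_sum:
  assumes "\<And>i. i \<in> A \<Longrightarrow> f i differentiable (at x)"
  shows "partial_deriv j (\<lambda>y. \<Sum>i\<in>A. f i y) x = (\<Sum>i\<in>A. partial_deriv j (f i) x)"
proof -
  have "((\<lambda>t. \<Sum>i\<in>A. f i (x + t *\<^sub>R axis j 1)) has_real_derivative (\<Sum>i\<in>A. partial_deriv j (f i) x)) (at 0)"
    by (intro DERIV_sum partial_deriv_DERIV assms)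
  then show ?thesis unfolding partial_deriv_def[of j "\<lambda>y. \<Sum>i\<in>A. f i y"] by (rule DERIV_imp_deriv)
qed

lemma partial_deriv_cmult:
  assumes "f differentiable (at x)"
  shows "partial_deriv i (\<lambda>y. c * f y) x = c * partial_deriv i f x"
  using partial_deriv_mult[OF differentiable_const assms, of i c] by simp

context
  fixes S :: "(real^'n::finite) set"
  assumes S: "open S"
begin

lemma lap_add:
  assumes "smooth_on S f" "smooth_on S g" "x \<in> S"
  shows "lap (\<lambda>y. f y + g y) x = lap f x + lap g x"
  unfolding lap_def sum.distrib[symmetric]
proof (intro sum.cong refl)
  fix i
  have "partial_deriv i (partial_deriv i (\<lambda>y. f y + g y)) x
      = partial_deriv i (\<lambda>y. partial_deriv i f y + partial_deriv i g y) x"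
    using assms by (intro partial_deriv_cong_open[OF S assms(3)] partial_deriv_add smooth_on_differentiable[OF _ S])
  also have "\<dots> = partial_deriv i (partial_deriv i f) x + partial_deriv i (partial_deriv i g) x"
    using assms by (intro partial_deriv_add smooth_on_differentiable[OF _ S] smooth_on_partial_deriv)
  finally show "partial_deriv i (partial_deriv i (\<lambda>y. f y + g y)) x = \<dots>" .
qed

lemma lap_mult:
  assumes "smooth_on S f" "smooth_on S g" "x \<in> S"
  shows "lap (\<lambda>y. f y * g y) x
    = lap f x * g x + 2 * (\<Sum>i\<in>UNIV. partial_deriv i f x * partial_deriv i g x) + f x * lap g x"
proof -
  have "partial_deriv i (partial_deriv i (\<lambda>y. f y * g y)) x
      = partial_deriv i (partial_deriv i f) x * g x + 2 * (partial_deriv i f x * partial_deriv i g x)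
        + f x * partial_deriv i (partial_deriv i g) x" for i
  proof -
    have "partial_deriv i (partial_deriv i (\<lambda>y. f y * g y)) x
        = partial_deriv i (\<lambda>y. partial_deriv i f y * g y + f y * partial_deriv i g y) x"
      using assms by (intro partial_deriv_cong_open[OF S assms(3)] partial_deriv_mult smooth_on_differentiable[OF _ S])
    also have "\<dots> = partial_deriv i (\<lambda>y. partial_deriv i f y * g y) x + partial_deriv i (\<lambda>y. f y * partial_deriv i g y) x"
      using assms by (intro partial_deriv_add smooth_on_differentiable[OF _ S] smooth_on_mult S smooth_on_partial_deriv)
    also have "partial_deriv i (\<lambda>y. partial_deriv i f y * g y) x
        = partial_deriv i (partial_deriv i f) x * g x + partial_deriv i f x * partial_deriv i g x"
      using assms by (intro partial_deriv_mult smooth_on_differentiable[OF _ S] smooth_on_partial_deriv)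
    also have "partial_deriv i (\<lambda>y. f y * partial_deriv i g y) x
        = partial_deriv i f x * partial_deriv i g x + f x * partial_deriv i (partial_deriv i g) x"
      using assms by (intro partial_deriv_mult smooth_on_differentiable[OF _ S] smooth_on_partial_deriv)
    finally show ?thesis by (simp add: algebra_simps)
  qed
  then show ?thesis by (simp add: lap_def sum.distrib sum_distrib_left sum_distrib_right)
qed

lemma lap_const [simp]: "lap (\<lambda>_. c) x = 0"
  by (simp add: lap_def)

lemma lap_cmult:
  assumes "smooth_on S f" "x \<in> S"
  shows "lap (\<lambda>y. c * f y) x = c * lap f x"
  using lap_mult[OF smooth_on_const assms, of c] by simp

lemma lap_component [simp]: "lap (\<lambda>y. y $ j) (x :: real^'n) = 0"
proof -
  have "partial_deriv i (\<lambda>y :: real^'n. y $ j) = (\<lambda>_. if i = j then 1 else 0)" for i :: 'n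
    by (simp add: fun_eq_iff partial_deriv_component)
  then show ?thesis by (simp add: lap_def)
qed

lemma lap_sum:
  assumes "\<And>i. i \<in> A \<Longrightarrow> smooth_on S (f i)" "x \<in> S"
  shows "lap (\<lambda>y. \<Sum>i\<in>A. f i y) x = (\<Sum>i\<in>A. lap (f i) x)"
  using assms(1)
proof (induction A rule: infinite_finite_induct)
  case (insert a A)
  then show ?case using lap_add[OF _ smooth_on_sum[OF S], of "f a" A f x] assms(2) by simp
qed auto

lemma lap_partial_deriv:
  assumes "smooth_on S g" "x \<in> S"
  shows "lap (partial_deriv j g) x = partial_deriv j (lap g) x"
proof -
  have "partial_deriv i (partial_deriv i (partial_deriv j g)) x = partial_deriv j (partial_deriv i (partial_deriv i g)) x" for i
  proof -
    have "partial_deriv i (partial_deriv i (partial_deriv j g)) x = partial_deriv i (partial_deriv j (partial_deriv i g)) x"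
      using assms by (intro partial_deriv_cong_open[OF S assms(2)] partial_deriv_commute[OF _ S])
    also have "\<dots> = partial_deriv j (partial_deriv i (partial_deriv i g)) x"
      using assms by (intro partial_deriv_commute[OF _ S] smooth_on_partial_deriv)
    finally show ?thesis .
  qed
  then show ?thesis using assms unfolding lap_def
    by (subst partial_deriv_sum) (auto intro!: smooth_on_differentiable[OF _ S] smooth_on_partial_deriv)
qed

lemma eul_mult:
  assumes "smooth_on S f" "smooth_on S g" "x \<in> S"
  shows "eul (\<lambda>y. f y * g y) x = eul f x * g x + f x * eul g x"
  using assms unfolding eul_def
  by (subst partial_deriv_mult)
    (auto intro!: smooth_on_differentiable[OF _ S] simp: algebra_simps sum.distrib sum_distrib_left)

text \<open>The commutator of the Laplacian with the Euler field is twice the Laplacian: partial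
  derivatives commute with \<open>lap\<close>, and the cross term of the product rule with the
  coordinate \<open>j\<close> contributes 2 times the second derivative.\<close>

lemma lap_eul:
  assumes g: "smooth_on S g" "x \<in> S"
  shows "lap (eul g) x = eul (lap g) x + 2 * lap g x"
proof -
  have "lap (eul g) x = (\<Sum>j\<in>UNIV. lap (\<lambda>y. y $ j * partial_deriv j g y) x)"
    unfolding eul_def using assms
    by (intro lap_sum smooth_on_mult S smooth_on_component smooth_on_partial_deriv)
  also have "\<dots> = (\<Sum>j\<in>UNIV. 2 * partial_deriv j (partial_deriv j g) x + x $ j * partial_deriv j (lap g) x)"
    using assms
    by (subst lap_mult) (auto intro!: sum.cong smooth_on_component smooth_on_partial_deriv
        simp: partial_deriv_component lap_partial_deriv if_distrib sum.delta if_distribR cong: if_cong)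
  finally show ?thesis by (simp add: sum.distrib sum_distrib_left eul_def lap_def)
qed

end

section \<open>Commutators with the conformal factor\<close>

definition rho :: "real^'n::finite \<Rightarrow> real" where
  "rho x = (1 - (norm x)\<^sup>2) / 2"

lemma smooth_on_rho: "open S \<Longrightarrow> smooth_on S rho"
  using smooth_on_mult[OF _ smooth_on_const[of S "1/2"] smooth_on_diff[OF _ smooth_on_const[of S 1] smooth_on_norm_sq[of S 0]]]
  by (simp add: rho_def[abs_def])

lemma has_derivative_norm_sq:
  fixes a :: "real^'n::finite"
  shows "((\<lambda>x. (norm (x - a))\<^sup>2) has_derivative (\<lambda>h. 2 * ((x - a) \<bullet> h))) (at x)"
  unfolding power2_norm_eq_inner
  by (auto intro!: derivative_eq_intros simp: inner_commute)

lemma partial_deriv_norm_sq: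
  "partial_deriv i (\<lambda>x. (norm (x - a))\<^sup>2) x = 2 * (x $ i - a $ i)"
  by (subst partial_deriv_eq[OF has_derivative_norm_sq]) (simp add: inner_axis)

lemma partial_deriv_rho: "partial_deriv i rho x = - (x $ i)"
proof -
  have "(rho has_derivative (\<lambda>h. - (x \<bullet> h))) (at x)"
    unfolding rho_def[abs_def] using has_derivative_norm_sq[of 0 x]
    by (auto intro!: derivative_eq_intros simp: field_simps)
  from partial_deriv_eq[OF this] show ?thesis by (simp add: inner_axis)
qed

lemma lap_rho: "lap rho (x :: real^'n::finite) = - real CARD('n)"
proof -
  have "partial_deriv i rho = (\<lambda>x::real^'n. - 1 * x $ i)" for i
    by (simp add: fun_eq_iff partial_deriv_rho)
  moreover have "partial_deriv i (\<lambda>x::real^'n. - 1 * x $ i) x = -1" for i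
    by (subst partial_deriv_cmult)
      (auto simp: partial_deriv_component intro: smooth_on_differentiable[OF smooth_on_component open_UNIV UNIV_I])
  ultimately show ?thesis by (simp add: lap_def)
qed

lemma eul_rho: "eul rho x = - (norm x)\<^sup>2"
  by (simp add: eul_def partial_deriv_rho norm_vec_def L2_set_def sum_nonneg sum_negf power2_eq_square[symmetric])

context
  fixes S :: "(real^'n::finite) set"
  assumes S: "open S"
begin

lemma lap_rho_mult:
  assumes "smooth_on S g" "x \<in> S"
  shows "lap (\<lambda>y. rho y * g y) x = rho x * lap g x - 2 * eul g x - real CARD('n) * g x"
  using lap_mult[OF S smooth_on_rho[OF S] assms]
  by (simp add: lap_rho partial_deriv_rho eul_def sum_negf)

lemma lap_pow_eul:
  assumes "smooth_on S g" "x \<in> S"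
  shows "(lap ^^ j) (eul g) x = eul ((lap ^^ j) g) x + 2 * real j * (lap ^^ j) g x"
  using assms(2)
proof (induction j arbitrary: x)
  case (Suc j)
  have "lap ((lap ^^ j) (eul g)) x = lap (\<lambda>y. eul ((lap ^^ j) g) y + 2 * real j * (lap ^^ j) g y) x"
    by (intro lap_cong[OF S Suc.prems] Suc.IH)
  also have "\<dots> = lap (eul ((lap ^^ j) g)) x + lap (\<lambda>y. 2 * real j * (lap ^^ j) g y) x"
    using assms Suc.prems
    by (intro lap_add[OF S] smooth_on_mult S smooth_on_const smooth_on_eul smooth_on_lap_pow)
  also have "\<dots> = (eul (lap ((lap ^^ j) g)) x + 2 * lap ((lap ^^ j) g) x) + 2 * real j * lap ((lap ^^ j) g) x"
    using Suc.prems assms by (simp only: lap_cmult[OF S] lap_eul[OF S] smooth_on_lap_pow[OF S])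
  finally show ?case by (simp add: algebra_simps)
qed simp

text \<open>Since \<open>rho\<close> is quadratic with gradient -x and constant Laplacian, commuting
  it with one Laplacian leaves only the Euler field and a constant. By \<open>lap_eul\<close> this
  form survives each further Laplacian.\<close>

lemma lap_pow_rho_mult:
  assumes "smooth_on S g" "x \<in> S"
  shows "(lap ^^ Suc j) (\<lambda>y. rho y * g y) x = rho x * (lap ^^ Suc j) g x
    - (real j + 1) * (2 * eul ((lap ^^ j) g) x + (2 * real j + real CARD('n)) * (lap ^^ j) g x)"
  using assms(2)
proof (induction j arbitrary: x)
  case 0
  then show ?case using assms by (simp add: lap_rho_mult)
next
  case (Suc j)
  let ?g = "(lap ^^ j) g"
  have sm: "smooth_on S ?g" "smooth_on S (lap ?g)" using assms S by (auto intro: smooth_on_lap smooth_on_lap_pow)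
  have "(lap ^^ Suc (Suc j)) (\<lambda>y. rho y * g y) x = lap (\<lambda>y. rho y * lap ?g y
    + (- (2 * (real j + 1)) * eul ?g y + - (real j + 1) * (2 * real j + real CARD('n)) * ?g y)) x"
    unfolding funpow.simps(2)[of "Suc j"] comp_def
    by (rule lap_cong[OF S Suc.prems]) (simp add: Suc.IH[simplified] algebra_simps)
  also have "\<dots> = lap (\<lambda>y. rho y * lap ?g y) x
      + (lap (\<lambda>y. - (2 * (real j + 1)) * eul ?g y) x + lap (\<lambda>y. - (real j + 1) * (2 * real j + real CARD('n)) * ?g y) x)"
    using sm Suc.prems S
    by (simp only: lap_add[OF S] smooth_on_add smooth_on_mult smooth_on_const smooth_on_eul smooth_on_rho)
  also have "\<dots> = rho x * lap (lap ?g) x - 2 * eul (lap ?g) x - real CARD('n) * lap ?g x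
      + (- (2 * (real j + 1)) * (eul (lap ?g) x + 2 * lap ?g x) + - (real j + 1) * (2 * real j + real CARD('n)) * lap ?g x)"
    using sm Suc.prems S
    by (simp only: lap_cmult[OF S] smooth_on_eul lap_rho_mult lap_eul[OF S])
  finally show ?case by (simp add: algebra_simps)
qed

end

subsection \<open>Conformal covariance of the GJMS operators\<close>

lemma rho_pos: "x \<in> ball 0 1 \<Longrightarrow> 0 < rho x"
  by (simp add: rho_def power_less_one_iff)

lemma norm_sq_rho: "(norm x)\<^sup>2 = 1 - 2 * rho x"
  by (simp add: rho_def field_simps)

lemma det_mat: "det (mat c :: real^'n::finite^'n) = c ^ CARD('n)"
  by (subst det_diagonal) (auto simp: mat_def)

text \<open>\<open>matrix_inv\<close> is a choice among two-sided inverses, so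
  \<open>mat (1 / c)\<close> serves as witness that one exists; multiplying by it identifies the
  chosen one.\<close>

lemma matrix_inv_mat:
  fixes c :: real
  assumes "c \<noteq> 0"
  shows "matrix_inv (mat c :: real^'n::finite^'n) = mat (1 / c)"
proof -
  have "(\<Sum>l\<in>UNIV. (if i = l then a else 0) * (if l = j then b else 0)) = (if i = j then a * b else 0)"
    for a b :: real and i j :: 'n
  proof -
    have "(\<Sum>l\<in>UNIV. (if i = l then a else 0) * (if l = j then b else 0))
        = (\<Sum>l\<in>UNIV. if l = i then (if i = j then a * b else 0) else 0)"
      by (intro sum.cong) auto
    then show ?thesis by simp
  qed
  then have *: "mat a ** mat b = (mat (a * b) :: real^'n^'n)" for a b :: real
    by (simp add: vec_eq_iff matrix_matrix_mult_def mat_def)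
  let ?I = "matrix_inv (mat c :: real^'n^'n)"
  have "mat c ** ?I = mat 1 \<and> ?I ** mat c = mat 1"
    unfolding matrix_inv_def using *[of c "1 / c"] *[of "1 / c" c] assms
    by (intro someI[of "\<lambda>A. mat c ** A = mat 1 \<and> A ** mat c = mat 1" "mat (1 / c)"]) simp
  then have "mat (1 / c) ** (mat c ** ?I) = mat (1 / c)"
    by (simp only: matrix_mul_rid)
  then show ?thesis
    using assms by (simp only: matrix_mul_assoc *) simp
qed

text \<open>Both identities are multiplied through by \<open>rho\<close> or its square, so that the
  exponents m - 1 and m - 2 produced by differentiation do not appear for small
  \<open>m\<close>.\<close>

lemma rho_power_mult:
  fixes w :: "real^'n::finite \<Rightarrow> real"
  assumes "open S" "smooth_on S w" "x \<in> S"
  shows "rho x * eul (\<lambda>y. rho y ^ m * w y) x = rho x ^ m * (rho x * eul w x - real m * (norm x)\<^sup>2 * w x)"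
    and "(rho x)\<^sup>2 * lap (\<lambda>y. rho y ^ m * w y) x = rho x ^ m * ((rho x)\<^sup>2 * lap w x - 2 * real m * rho x * eul w x
      - real m * real CARD('n) * rho x * w x + real m * (real m - 1) * (norm x)\<^sup>2 * w x)"
proof (induction m)
  case (Suc m)
  have sm: "smooth_on S (\<lambda>y. rho y ^ m * w y)"
    using assms by (intro smooth_on_mult smooth_on_power smooth_on_rho)
  have eq: "(\<lambda>y. rho y ^ Suc m * w y) = (\<lambda>y. rho y * (rho y ^ m * w y))"
    by (simp add: fun_eq_iff)
  let ?g = "\<lambda>y. rho y ^ m * w y"
  have e: "eul (\<lambda>y. rho y ^ Suc m * w y) x = rho x * eul ?g x - (norm x)\<^sup>2 * ?g x"
    unfolding eq using eul_mult[OF assms(1) smooth_on_rho[OF assms(1)] sm assms(3)] by (simp add: eul_rho)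
  show 1: "rho x * eul (\<lambda>y. rho y ^ Suc m * w y) x
      = rho x ^ Suc m * (rho x * eul w x - real (Suc m) * (norm x)\<^sup>2 * w x)"
  proof -
    have "rho x * eul (\<lambda>y. rho y ^ Suc m * w y) x = rho x * (rho x * eul ?g x) - rho x * (norm x)\<^sup>2 * ?g x"
      unfolding e by (simp add: algebra_simps)
    then show ?thesis unfolding Suc.IH(1) by (simp add: algebra_simps)
  qed
  have l: "lap (\<lambda>y. rho y ^ Suc m * w y) x = rho x * lap ?g x - 2 * eul ?g x - real CARD('n) * ?g x"
    unfolding eq using lap_rho_mult[OF assms(1) sm assms(3)] by simp
  have "(rho x)\<^sup>2 * lap (\<lambda>y. rho y ^ Suc m * w y) x
      = rho x * ((rho x)\<^sup>2 * lap ?g x) - 2 * rho x * (rho x * eul ?g x) - real CARD('n) * (rho x)\<^sup>2 * ?g x"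
    unfolding l by (simp add: algebra_simps power2_eq_square)
  also have "\<dots> = rho x ^ Suc m * ((rho x)\<^sup>2 * lap w x - 2 * real (Suc m) * rho x * eul w x
      - real (Suc m) * real CARD('n) * rho x * w x + real (Suc m) * (real (Suc m) - 1) * (norm x)\<^sup>2 * w x)"
    unfolding Suc.IH by (simp add: algebra_simps power2_eq_square)
  finally show "(rho x)\<^sup>2 * lap (\<lambda>y. rho y ^ Suc m * w y) x = \<dots>" .
qed auto

text \<open>The metric is rho^(-2) times the Euclidean one, so sqrt |g| g^ij equals rho^(2-N) times
  the identity. Differentiating this weight gives the Euler term with coefficient N - 2.\<close>

lemma laplace_beltrami_ball:
  fixes u :: "real^'n::finite \<Rightarrow> real"
  assumes u: "smooth_on (ball 0 1) u" and x: "x \<in> ball 0 1" and N: "2 \<le> CARD('n)"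
  shows "laplace_beltrami hyp_metric u x = (rho x)\<^sup>2 * lap u x + (real CARD('n) - 2) * rho x * eul u x"
proof -
  let ?B = "ball 0 1 :: (real^'n) set"
  define m where "m = CARD('n) - 2"
  have Nm: "CARD('n) = m + 2" using N by (simp add: m_def)
  have g: "hyp_metric y = (mat ((1 / rho y)\<^sup>2) :: real^'n^'n)" for y
    by (simp add: hyp_metric_def rho_def)
  have sq: "sqrt (det (hyp_metric y :: real^'n^'n)) = (1 / rho y) ^ CARD('n)" if "y \<in> ?B" for y
  proof -
    have "det (hyp_metric y :: real^'n^'n) = ((1 / rho y) ^ CARD('n))\<^sup>2"
      by (simp only: g det_mat power_mult[symmetric] mult.commute)
    then show ?thesis using rho_pos[OF that] by simp
  qed
  have inner: "(\<Sum>j\<in>UNIV. sqrt (det (hyp_metric y)) * matrix_inv (hyp_metric y) $ i $ j * partial_deriv j u y)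
      = (1 / rho y) ^ m * partial_deriv i u y" if "y \<in> ?B" for y and i :: 'n
  proof -
    have "matrix_inv (hyp_metric y) = (mat ((rho y)\<^sup>2) :: real^'n^'n)"
      using rho_pos[OF that] unfolding g by (subst matrix_inv_mat) (auto simp: power_divide)
    then have "(\<Sum>j\<in>UNIV. sqrt (det (hyp_metric y)) * matrix_inv (hyp_metric y) $ i $ j * partial_deriv j u y)
      = (\<Sum>j\<in>UNIV. if j = i then (1 / rho y) ^ CARD('n) * (rho y)\<^sup>2 * partial_deriv i u y else 0)"
      by (intro sum.cong) (auto simp: sq[OF that] mat_def)
    also have "\<dots> = (1 / rho y) ^ CARD('n) * (rho y)\<^sup>2 * partial_deriv i u y"
      by simp
    also have "(1 / rho y) ^ CARD('n) * (rho y)\<^sup>2 = (1 / rho y) ^ m"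
      using rho_pos[OF that] by (simp add: Nm power_divide power_add power2_eq_square)
    finally show ?thesis .
  qed
  have d: "u differentiable (at x)" "partial_deriv i u differentiable (at x)" "rho differentiable (at x)" for i
    using smooth_on_differentiable[OF u open_ball x] smooth_on_differentiable[OF smooth_on_partial_deriv[OF u] open_ball x]
      smooth_on_differentiable[OF smooth_on_rho[OF open_ball] open_ball x] by auto
  have "partial_deriv i (\<lambda>y. \<Sum>j\<in>UNIV. sqrt (det (hyp_metric y)) * matrix_inv (hyp_metric y) $ i $ j * partial_deriv j u y) x
      = real m * (1 / rho x) ^ (m + 1) * (x $ i * partial_deriv i u x)
        + (1 / rho x) ^ m * partial_deriv i (partial_deriv i u) x" for i
  proof -
    have "((\<lambda>t. (1 / t) ^ m) has_real_derivative - real m * (1 / rho x) ^ (m + 1)) (at (rho x))"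
      using rho_pos[OF x]
      by (auto intro!: derivative_eq_intros simp: field_simps power_divide) (cases m; simp add: field_simps)
    then have "partial_deriv i (\<lambda>y. (1 / rho y) ^ m) x = real m * (1 / rho x) ^ (m + 1) * x $ i"
      by (subst partial_deriv_chain[OF d(3)]) (auto simp: partial_deriv_rho)
    moreover have "(\<lambda>y. (1 / rho y) ^ m) differentiable (at x)"
      using d(3) rho_pos[OF x] by (intro differentiable_power differentiable_divide) auto
    ultimately have "partial_deriv i (\<lambda>y. (1 / rho y) ^ m * partial_deriv i u y) x
      = real m * (1 / rho x) ^ (m + 1) * (x $ i * partial_deriv i u x)
        + (1 / rho x) ^ m * partial_deriv i (partial_deriv i u) x"
      by (subst partial_deriv_mult) (auto simp: d)
    moreover have "partial_deriv i (\<lambda>y. \<Sum>j\<in>UNIV. sqrt (det (hyp_metric y)) * matrix_inv (hyp_metric y) $ i $ j * partial_deriv j u y) x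
      = partial_deriv i (\<lambda>y. (1 / rho y) ^ m * partial_deriv i u y) x"
      by (rule partial_deriv_cong_open[OF open_ball x inner])
    ultimately show ?thesis by (simp only:)
  qed
  then have "laplace_beltrami hyp_metric u x = rho x ^ (m + 2) *
     (real m * (1 / rho x) ^ (m + 1) * eul u x + (1 / rho x) ^ m * lap u x)"
    using rho_pos[OF x] unfolding laplace_beltrami_def sq[OF x]
    by (simp add: sum.distrib sum_distrib_left eul_def lap_def Nm power_divide)
  also have "\<dots> = (rho x)\<^sup>2 * lap u x + real m * rho x * eul u x"
    using rho_pos[OF x] by (simp add: field_simps power2_eq_square power_add)
  finally show ?thesis by (simp add: Nm)
qed

text \<open>What remains of the factor P1 + j (j + 1) after it is conjugated by powers of
  \<open>rho\<close>: with k = m + j + 1 it sends rho^m w to rho^(m+1) times this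
  expression.\<close>

definition conf_step :: "nat \<Rightarrow> nat \<Rightarrow> (real^'n::finite \<Rightarrow> real) \<Rightarrow> real^'n \<Rightarrow> real" where
  "conf_step k j w x = - (rho x * lap w x) - 2 * real j * eul w x + 2 * real j * (real j + 1 - real k) * w x"

lemma smooth_on_conf_step:
  assumes "open S" "smooth_on S w"
  shows "smooth_on S (conf_step k j w)"
  unfolding conf_step_def[abs_def] using assms
  by (intro smooth_on_add smooth_on_diff smooth_on_minus smooth_on_mult smooth_on_const smooth_on_rho smooth_on_lap smooth_on_eul)

text \<open>Replacing |x|^2 by 1 - 2 rho leaves terms carrying rho^m with no further factor
  \<open>rho\<close>. Their coefficient is -m (m - 1) + 2 m (k - 1) - k (k - 1) + j (j + 1), which
  vanishes for k = m + j + 1; this is what the constants of the GJMS factors are made for.\<close>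

lemma P1_rho_power_mult:
  fixes w :: "real^'n::finite \<Rightarrow> real"
  assumes N: "CARD('n) = 2 * k" and w: "smooth_on (ball 0 1) w" and x: "x \<in> ball 0 1" and k: "k = m + j + 1"
  shows "P1 (\<lambda>y. rho y ^ m * w y) x + real (Suc j) * real j * (rho x ^ m * w x)
    = rho x ^ (m + 1) * conf_step k j w x"
proof -
  have sm: "smooth_on (ball 0 1) (\<lambda>y. rho y ^ m * w y)"
    using w by (intro smooth_on_mult smooth_on_power smooth_on_rho) auto
  have "2 \<le> CARD('n)" using N k by simp
  note lb = laplace_beltrami_ball[OF sm x this]
  have "P1 (\<lambda>y. rho y ^ m * w y) x = - ((rho x)\<^sup>2 * lap (\<lambda>y. rho y ^ m * w y) x)
      - (2 * real k - 2) * (rho x * eul (\<lambda>y. rho y ^ m * w y) x)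
      - real k * (real k - 1) * (rho x ^ m * w x)"
  proof -
    have c: "real CARD('n) * (real CARD('n) - 2) / 4 = real k * (real k - 1)"
      by (simp add: N field_simps)
    show ?thesis unfolding P1_def c lb by (simp add: N algebra_simps)
  qed
  also have "\<dots> + real (Suc j) * real j * (rho x ^ m * w x) = rho x ^ (m + 1) * conf_step k j w x"
    unfolding rho_power_mult[OF open_ball w x] norm_sq_rho N k conf_step_def
    by (simp add: algebra_simps power2_eq_square)
  finally show ?thesis .
qed

lemma gjms_cong:
  assumes "\<And>y. y \<in> ball 0 1 \<Longrightarrow> f y = g y" "x \<in> ball 0 1"
  shows "gjms j f x = gjms j g x"
  using assms
proof (induction j arbitrary: f g x)
  case (Suc j)
  have "P1 f y = P1 g y" if "y \<in> ball 0 1" for y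
  proof -
    have "partial_deriv i f z = partial_deriv i g z" if "z \<in> ball 0 1" for i z
      using Suc.prems(1) by (rule partial_deriv_cong_open[OF open_ball that])
    then have "laplace_beltrami hyp_metric f y = laplace_beltrami hyp_metric g y"
      unfolding laplace_beltrami_def
      by (intro arg_cong2[where f="(*)"] refl sum.cong partial_deriv_cong_open[OF open_ball that]) auto
    then show ?thesis using Suc.prems(1)[OF that] by (simp add: P1_def)
  qed
  then show ?case using Suc.prems by (simp, intro Suc.IH) auto
qed auto

text \<open>The lower-order terms of \<open>conf_step\<close> are exactly those created when
  \<open>lap ^^ j\<close> is commuted past \<open>rho\<close> and past the Euler field. For N = 2k
  the Euler terms cancel, and so do the multiples of \<open>(lap ^^ j) w\<close>.\<close>

lemma lap_pow_conf_step:
  fixes w :: "real^'n::finite \<Rightarrow> real"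
  assumes N: "CARD('n) = 2 * k" and S: "open S" and w: "smooth_on S w" and x: "x \<in> S"
  shows "(lap ^^ j) (conf_step k j w) x = - (rho x * (lap ^^ Suc j) w x)"
proof (cases j)
  case 0
  then show ?thesis by (simp add: conf_step_def)
next
  case (Suc i)
  have lin: "(lap ^^ j) (\<lambda>y. a * f y + (b * g y + c * h y)) x = a * (lap ^^ j) f x + (b * (lap ^^ j) g x + c * (lap ^^ j) h x)"
    if "smooth_on S f" "smooth_on S g" "smooth_on S h" for a b c f g h
    using x
  proof (induction j arbitrary: x)
    case (Suc j)
    let ?L = "lap ^^ j"
    have sm: "smooth_on S (?L f)" "smooth_on S (?L g)" "smooth_on S (?L h)"
      using that S by (auto intro: smooth_on_lap_pow)
    have "lap (?L (\<lambda>y. a * f y + (b * g y + c * h y))) x = lap (\<lambda>y. a * ?L f y + (b * ?L g y + c * ?L h y)) x"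
      by (rule lap_cong[OF S Suc.prems]) (rule Suc.IH)
    also have "\<dots> = lap (\<lambda>y. a * ?L f y) x + (lap (\<lambda>y. b * ?L g y) x + lap (\<lambda>y. c * ?L h y) x)"
      using sm S Suc.prems by (simp only: lap_add[OF S] smooth_on_add smooth_on_mult smooth_on_const)
    finally show ?case using sm Suc.prems by (simp add: lap_cmult[OF S])
  qed simp
  have eq: "conf_step k j w = (\<lambda>y. -1 * (rho y * lap w y) + (- (2 * real j) * eul w y + 2 * real j * (real j + 1 - real k) * w y))"
    by (simp add: fun_eq_iff conf_step_def)
  have sm: "smooth_on S (lap w)" "smooth_on S (\<lambda>y. rho y * lap w y)" "smooth_on S (eul w)"
    using w S by (auto intro: smooth_on_lap smooth_on_eul smooth_on_mult smooth_on_rho)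
  have r: "(lap ^^ j) (\<lambda>y. rho y * lap w y) x = rho x * (lap ^^ Suc j) w x
      - real j * (2 * eul ((lap ^^ j) w) x + (2 * real j - 2 + 2 * real k) * (lap ^^ j) w x)"
    using lap_pow_rho_mult[OF S sm(1) x, of i] by (simp add: Suc N funpow_swap1 algebra_simps)
  show ?thesis
    unfolding eq lin[OF sm(2,3) w] r lap_pow_eul[OF S w x] by (simp add: algebra_simps)
qed

text \<open>\<open>gjms (Suc j)\<close> applies its factor of largest constant before the others.
  That factor raises the exponent k - j - 1 to k - j and produces \<open>conf_step\<close>;
  \<open>lap_pow_conf_step\<close> then supplies one more \<open>rho\<close> and one more Laplacian.
  At j = k the weight on the left is 1.\<close>

theorem gjms_rho_power_mult:
  fixes w :: "real^'n::finite \<Rightarrow> real"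
  assumes N: "CARD('n) = 2 * k" and "j \<le> k" and "smooth_on (ball 0 1) w" "x \<in> ball 0 1"
  shows "gjms j (\<lambda>y. rho y ^ (k - j) * w y) x = rho x ^ (k + j) * (- 1) ^ j * (lap ^^ j) w x"
  using assms(2-)
proof (induction j arbitrary: w)
  case (Suc j)
  define m where "m = k - Suc j"
  have k: "k = m + j + 1" using Suc.prems by (simp add: m_def)
  have "gjms (Suc j) (\<lambda>y. rho y ^ m * w y) x = gjms j (\<lambda>y. rho y ^ (k - j) * conf_step k j w y) x"
    unfolding gjms.simps
    by (rule gjms_cong) (use P1_rho_power_mult[OF N Suc.prems(2) _ k] Suc.prems in \<open>auto simp: k\<close>)
  also have "\<dots> = rho x ^ (k + j) * (- 1) ^ j * (lap ^^ j) (conf_step k j w) x"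
    using Suc.prems by (intro Suc.IH) (auto intro: smooth_on_conf_step)
  also have "\<dots> = rho x ^ (k + Suc j) * (- 1) ^ Suc j * (lap ^^ Suc j) w x"
    unfolding lap_pow_conf_step[OF N open_ball Suc.prems(2,3)] by simp
  finally show ?case by (simp add: m_def)
qed simp

corollary gjms_eq_lap_pow:
  fixes u :: "real^'n::finite \<Rightarrow> real"
  assumes "CARD('n) = 2 * k" "smooth_on (ball 0 1) u" "x \<in> ball 0 1"
  shows "gjms k u x = rho x ^ (2 * k) * (- 1) ^ k * (lap ^^ k) u x"
  using gjms_rho_power_mult[OF assms(1) order_refl assms(2,3)] by (simp add: mult_2)

subsection \<open>Integration by parts\<close>

lemma test_functions_smooth_on_ball: "u \<in> test_functions \<Longrightarrow> smooth_on (ball 0 1) u"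
  by (simp add: test_functions_def)

lemma test_functions_support:
  "u \<in> test_functions \<Longrightarrow> closure {x. u x \<noteq> 0} \<subseteq> ball 0 1"
  by (simp add: test_functions_def)

lemma test_functions_eq_0:
  assumes "u \<in> test_functions" "x \<notin> ball 0 1"
  shows "u x = 0"
  using assms test_functions_support closure_subset[of "{x. u x \<noteq> 0}"] by blast

lemma test_functions_smooth:
  assumes "u \<in> test_functions"
  shows "smooth_on UNIV u"
proof -
  let ?T = "- closure {x. u x \<noteq> 0}"
  have T: "open ?T" by (simp add: open_Compl)
  have "u x = 0" if "x \<in> ?T" for x using that closure_subset[of "{x. u x \<noteq> 0}"] by blast
  then have "smooth_on ?T u"
    by (rule iffD2[OF smooth_on_cong[OF T] smooth_on_const])
  then have "smooth_on (ball 0 1 \<union> ?T) u"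
    using assms by (intro smooth_on_Un test_functions_smooth_on_ball open_ball T)
  moreover have "ball 0 1 \<union> ?T = UNIV" using test_functions_support[OF assms] by blast
  ultimately show ?thesis by simp
qed

lemma test_functionsI:
  assumes "smooth_on (ball 0 1) v" "u \<in> test_functions" "\<And>x. v x \<noteq> 0 \<Longrightarrow> x \<in> closure {x. u x \<noteq> 0}"
  shows "v \<in> test_functions"
proof -
  let ?U = "closure {x. u x \<noteq> 0}" and ?V = "closure {x. v x \<noteq> 0}"
  have *: "?V \<subseteq> ?U"
    using assms(3) by (intro closure_minimal) auto
  have U: "compact ?U" "?U \<subseteq> ball 0 1"
    using assms(2) unfolding test_functions_def by blast+
  have "compact (?V \<inter> ?U)"
    by (rule closed_Int_compact[OF closed_closure U(1)])
  then have "compact ?V" by (simp only: Int_absorb2[OF *])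
  moreover have "?V \<subseteq> ball 0 1" using * U(2) by (rule subset_trans)
  ultimately show ?thesis
    using assms(1) unfolding test_functions_def by blast
qed

lemma test_functions_mult:
  assumes "u \<in> test_functions" "smooth_on (ball 0 1) v"
  shows "(\<lambda>x. u x * v x) \<in> test_functions"
proof (rule test_functionsI[OF _ assms(1)])
  show "smooth_on (ball 0 1) (\<lambda>x. u x * v x)"
    by (rule smooth_on_mult[OF open_ball test_functions_smooth_on_ball[OF assms(1)] assms(2)])
  show "x \<in> closure {x. u x \<noteq> 0}" if "u x * v x \<noteq> 0" for x
    using that closure_subset[of "{x. u x \<noteq> 0}"] by auto
qed

lemma test_functions_partial_deriv:
  assumes "u \<in> test_functions"
  shows "partial_deriv i u \<in> test_functions"
proof (rule test_functionsI[OF _ assms])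
  show "smooth_on (ball 0 1) (partial_deriv i u)"
    by (intro smooth_on_partial_deriv test_functions_smooth_on_ball assms)
  show "x \<in> closure {x. u x \<noteq> 0}" if "partial_deriv i u x \<noteq> 0" for x
  proof (rule ccontr)
    let ?T = "- closure {x. u x \<noteq> 0}"
    assume "x \<notin> closure {x. u x \<noteq> 0}"
    then have x: "x \<in> ?T" by blast
    have T: "open ?T" by (simp add: open_Compl)
    have "u y = 0" if "y \<in> ?T" for y using that closure_subset[of "{x. u x \<noteq> 0}"] by blast
    then have "partial_deriv i u x = partial_deriv i (\<lambda>_. 0) x"
      by (rule partial_deriv_cong_open[OF T x])
    with that show False by simp
  qed
qed

lemma zero_test_functions: "(\<lambda>_. 0) \<in> test_functions"
  by (simp add: test_functions_def smooth_on_const)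

lemma test_functions_add:
  assumes "u \<in> test_functions" "v \<in> test_functions"
  shows "(\<lambda>x. u x + v x) \<in> test_functions"
proof -
  let ?K = "closure {x. u x \<noteq> 0} \<union> closure {x. v x \<noteq> 0}" and ?V = "closure {x. u x + v x \<noteq> 0}"
  have K: "compact ?K" "?K \<subseteq> ball 0 1" using assms by (auto simp: test_functions_def)
  have "{x. u x + v x \<noteq> 0} \<subseteq> ?K"
  proof
    fix x assume "x \<in> {x. u x + v x \<noteq> 0}"
    then have "x \<in> {x. u x \<noteq> 0} \<or> x \<in> {x. v x \<noteq> 0}" by auto
    then show "x \<in> ?K"
      using subsetD[OF closure_subset[of "{x. u x \<noteq> 0}"], of x] subsetD[OF closure_subset[of "{x. v x \<noteq> 0}"], of x]
      by (elim disjE) (simp_all only: Un_iff simp_thms)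
  qed
  then have *: "?V \<subseteq> ?K"
    by (intro closure_minimal) auto
  have "compact (?V \<inter> ?K)"
    by (rule closed_Int_compact[OF closed_closure K(1)])
  then have "compact ?V" by (simp only: Int_absorb2[OF *])
  moreover have "?V \<subseteq> ball 0 1" using * K(2) by (rule subset_trans)
  moreover have "smooth_on (ball 0 1) (\<lambda>x. u x + v x)"
    using assms by (intro smooth_on_add test_functions_smooth_on_ball) auto
  ultimately show ?thesis
    unfolding test_functions_def by blast
qed

lemma test_functions_sum:
  "(\<And>i. i \<in> A \<Longrightarrow> f i \<in> test_functions) \<Longrightarrow> (\<lambda>x. \<Sum>i\<in>A. f i x) \<in> test_functions"
  by (induction A rule: infinite_finite_induct) (auto intro: zero_test_functions test_functions_add)

lemma test_functions_diff:
  assumes "u \<in> test_functions" "v \<in> test_functions"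
  shows "(\<lambda>x. u x - v x) \<in> test_functions"
  using test_functions_add[OF assms(1) test_functions_mult[OF assms(2) smooth_on_const[of _ "-1"]]] by simp

lemma test_functions_lap: "u \<in> test_functions \<Longrightarrow> lap u \<in> test_functions"
  unfolding lap_def by (intro test_functions_sum test_functions_partial_deriv)

lemma test_functions_lap_pow: "u \<in> test_functions \<Longrightarrow> (lap ^^ j) u \<in> test_functions"
  by (induction j) (auto intro: test_functions_lap)

lemma test_functions_continuous: "u \<in> test_functions \<Longrightarrow> continuous_on UNIV u"
  by (intro smooth_on_continuous test_functions_smooth)

lemma test_functions_measurable: "u \<in> test_functions \<Longrightarrow> u \<in> borel_measurable borel"
  by (intro borel_measurable_continuous_onI test_functions_continuous)

lemma test_functions_integrable:
  assumes "u \<in> test_functions" shows "integrable lborel u"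
proof -
  have "integrable lborel (\<lambda>x. indicator (cball 0 1) x *\<^sub>R u x)"
    using continuous_on_subset[OF test_functions_continuous[OF assms]] by (intro borel_integrable_compact) auto
  moreover have "indicator (cball 0 1) x *\<^sub>R u x = u x" for x
    using test_functions_eq_0[OF assms, of x] by (cases "x \<in> ball 0 1") (auto simp: indicator_def)
  ultimately show ?thesis by (simp only:)
qed

lemma test_functions_bounded:
  assumes "u \<in> test_functions" obtains M where "0 < M" "\<And>x. \<bar>u x\<bar> \<le> M"
proof -
  have "compact (u ` cball 0 1)"
    using continuous_on_subset[OF test_functions_continuous[OF assms]]
    by (intro compact_continuous_image) auto
  then obtain M where M: "0 < M" "\<forall>y\<in>u ` cball 0 1. \<bar>y\<bar> \<le> M"
    using compact_imp_bounded[THEN bounded_pos[THEN iffD1]] by (metis real_norm_def)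
  have "\<bar>u x\<bar> \<le> M" for x
    using M test_functions_eq_0[OF assms, of x] by (cases "x \<in> ball 0 1") auto
  with M that show ?thesis by blast
qed

text \<open>By translation invariance of Lebesgue measure every difference quotient of
  \<open>w\<close> has integral 0. The mean value theorem bounds the quotients uniformly, and
  dominated convergence passes to the derivative.\<close>

lemma integral_partial_deriv_eq_0:
  fixes w :: "real^'n::finite \<Rightarrow> real"
  assumes w: "w \<in> test_functions"
  shows "(\<integral>x. partial_deriv i w x \<partial>lborel) = 0"
proof -
  let ?e = "axis i (1::real) :: real^'n"
  \<comment> \<open>Steps of length at most 1 keep all difference quotients supported in
    \<open>cball 0 2\<close>, which gives one integrable majorant.\<close>
  define h where "h n = inverse (real (Suc n))" for n
  have h: "0 < h n" "h n \<le> 1" for n by (auto simp: h_def field_simps)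
  define D where "D n x = (w (h n *\<^sub>R ?e + x) - w x) / h n" for n x
  note [measurable] = test_functions_measurable[OF w] test_functions_measurable[OF test_functions_partial_deriv[OF w]]
  obtain M where M: "0 < M" "\<And>x. \<bar>partial_deriv i w x\<bar> \<le> M"
    using test_functions_bounded[OF test_functions_partial_deriv[OF w]] by blast
  have dw: "w differentiable (at y)" for y
    using smooth_on_differentiable[OF test_functions_smooth[OF w]] by simp
  have trans: "(\<integral>x. w (c + x) \<partial>lborel) = (\<integral>x. w x \<partial>lborel)" "integrable lborel (\<lambda>x. w (c + x))" for c
  proof -
    have "integrable (distr lborel borel ((+) c)) w"
      by (subst lborel_distr_plus) (rule test_functions_integrable[OF w])
    then show "integrable lborel (\<lambda>x. w (c + x))" by (subst (asm) integrable_distr_eq) auto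
    show "(\<integral>x. w (c + x) \<partial>lborel) = (\<integral>x. w x \<partial>lborel)"
      by (subst (2) lborel_distr_plus[of c, symmetric]) (simp add: integral_distr)
  qed
  have "(\<integral>x. D n x \<partial>lborel) = 0" for n
    unfolding D_def using trans test_functions_integrable[OF w] by simp
  moreover have "(\<lambda>n. \<integral>x. D n x \<partial>lborel) \<longlonglongrightarrow> (\<integral>x. partial_deriv i w x \<partial>lborel)"
  proof (rule integral_dominated_convergence[where w = "\<lambda>x :: real^'n. M * indicator (cball 0 2) x"])
    show "integrable lborel (\<lambda>x :: real^'n. M * indicator (cball 0 2) x)"
      using emeasure_lborel_cball_finite[of "0 :: real^'n" 2]
      by (intro integrable_mult_right integrable_real_indicator) auto
    have "(\<lambda>n. D n x) \<longlonglongrightarrow> partial_deriv i w x" for x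
    proof -
      have "((\<lambda>t. (w (x + (0 + t) *\<^sub>R ?e) - w (x + 0 *\<^sub>R ?e)) / t) \<longlongrightarrow> partial_deriv i w x) (at 0)"
        using partial_deriv_DERIV[OF dw] unfolding DERIV_def by blast
      moreover have "filterlim h (at 0) sequentially"
        unfolding filterlim_at using LIMSEQ_inverse_real_of_nat by (auto simp: h_def[abs_def])
      ultimately show ?thesis
        using filterlim_compose[of "\<lambda>t. (w (x + (0 + t) *\<^sub>R ?e) - w (x + 0 *\<^sub>R ?e)) / t" "nhds (partial_deriv i w x)" "at 0" h sequentially]
        by (simp add: D_def[abs_def] add_ac)
    qed
    then show "AE x in lborel. (\<lambda>n. D n x) \<longlonglongrightarrow> partial_deriv i w x" by simp
    have "\<bar>D n x\<bar> \<le> M * indicator (cball 0 2) x" for n x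
    proof (cases "x \<in> cball 0 2")
      case True
      have "((\<lambda>s. w (x + s *\<^sub>R ?e)) has_real_derivative partial_deriv i w (x + s *\<^sub>R ?e)) (at s)" for s
        by (rule line_has_real_derivative[OF dw])
      then obtain s where "w (x + h n *\<^sub>R ?e) - w (x + 0 *\<^sub>R ?e) = (h n - 0) * partial_deriv i w (x + s *\<^sub>R ?e)"
        using MVT2[OF h(1)[of n], of "\<lambda>s. w (x + s *\<^sub>R ?e)" "\<lambda>s. partial_deriv i w (x + s *\<^sub>R ?e)"] by auto
      then have "D n x = partial_deriv i w (x + s *\<^sub>R ?e)"
        using h(1)[of n] by (simp add: D_def add.commute)
      then show ?thesis using M(2) True by simp
    next
      case False
      then have "2 < norm x" by simp
      moreover have "norm x \<le> norm (h n *\<^sub>R ?e + x) + norm (h n *\<^sub>R ?e)"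
        using norm_triangle_ineq4[of "h n *\<^sub>R ?e + x" "h n *\<^sub>R ?e"] by simp
      moreover have "norm (h n *\<^sub>R ?e) \<le> 1" using h[of n] by simp
      ultimately have "w (h n *\<^sub>R ?e + x) = 0" "w x = 0"
        using test_functions_eq_0[OF w] by auto
      then show ?thesis using False by (simp add: D_def)
    qed
    then show "AE x in lborel. norm (D n x) \<le> M * indicator (cball 0 2) x" for n by simp
  qed (simp_all add: D_def[abs_def])
  ultimately have "(\<lambda>n. 0) \<longlonglongrightarrow> (\<integral>x. partial_deriv i w x \<partial>lborel)"
    by (simp only:)
  then show ?thesis by (simp only: LIMSEQ_const_iff)
qed

text \<open>The difference of the integrands is the divergence of a field whose components
  \<open>F i\<close> are test functions. The compact support of \<open>u\<close> lets
  \<open>v\<close> be any smooth function on the open ball, such as the logarithms that make up the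
  kernel.\<close>

lemma integral_lap_mult:
  fixes u v :: "real^'n::finite \<Rightarrow> real"
  assumes u: "u \<in> test_functions" and v: "smooth_on (ball 0 1) v"
  shows "(\<integral>x. lap u x * v x \<partial>lborel) = (\<integral>x. u x * lap v x \<partial>lborel)"
proof -
  define F where "F i x = partial_deriv i u x * v x - u x * partial_deriv i v x" for i x
  have Ft: "F i \<in> test_functions" for i
    unfolding F_def[abs_def]
    by (intro test_functions_diff test_functions_mult test_functions_partial_deriv smooth_on_partial_deriv u v)
  have t: "(\<lambda>x. lap u x * v x) \<in> test_functions" "(\<lambda>x. u x * lap v x) \<in> test_functions"
    by (auto intro!: test_functions_mult test_functions_lap smooth_on_lap u v)
  have "lap u x * v x - u x * lap v x = (\<Sum>i\<in>UNIV. partial_deriv i (F i) x)" for x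
  proof (cases "x \<in> ball 0 1")
    case True
    note d = smooth_on_differentiable[OF _ open_ball True]
    note su = test_functions_smooth_on_ball[OF u]
    have "partial_deriv i (F i) x = partial_deriv i (partial_deriv i u) x * v x - u x * partial_deriv i (partial_deriv i v) x" for i
    proof -
      have "F i = (\<lambda>x. partial_deriv i u x * v x + - 1 * (u x * partial_deriv i v x))"
        by (simp add: F_def fun_eq_iff)
      then have "partial_deriv i (F i) x = partial_deriv i (\<lambda>x. partial_deriv i u x * v x) x
          + - 1 * partial_deriv i (\<lambda>x. u x * partial_deriv i v x) x"
        using su v
        by (simp only: partial_deriv_add partial_deriv_cmult d smooth_on_mult smooth_on_const smooth_on_partial_deriv open_ball)
      then show ?thesis using su v by (simp add: partial_deriv_mult d smooth_on_partial_deriv)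
    qed
    then show ?thesis by (simp add: lap_def sum_subtractf sum_distrib_left sum_distrib_right)
  next
    case False
    show ?thesis
      by (simp only: t[THEN test_functions_eq_0, OF False] test_functions_eq_0[OF test_functions_partial_deriv[OF Ft] False]) simp
  qed
  then have "(\<integral>x. lap u x * v x - u x * lap v x \<partial>lborel) = (\<integral>x. (\<Sum>i\<in>UNIV. partial_deriv i (F i) x) \<partial>lborel)"
    by simp
  also have "\<dots> = (\<Sum>i\<in>UNIV. \<integral>x. partial_deriv i (F i) x \<partial>lborel)"
    by (intro Bochner_Integration.integral_sum test_functions_integrable test_functions_partial_deriv Ft)
  also have "\<dots> = 0" using Ft by (simp add: integral_partial_deriv_eq_0)
  finally show ?thesis using t[THEN test_functions_integrable] by simp
qed

lemma integral_lap_pow_mult: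
  assumes "u \<in> test_functions" "smooth_on (ball 0 1) v"
  shows "(\<integral>x. (lap ^^ j) u x * v x \<partial>lborel) = (\<integral>x. u x * (lap ^^ j) v x \<partial>lborel)"
  using assms
proof (induction j arbitrary: u)
  case (Suc j)
  have "(\<integral>x. (lap ^^ j) (lap u) x * v x \<partial>lborel) = (\<integral>x. lap u x * (lap ^^ j) v x \<partial>lborel)"
    using Suc by (intro Suc.IH test_functions_lap)
  also have "\<dots> = (\<integral>x. u x * lap ((lap ^^ j) v) x \<partial>lborel)"
    using Suc.prems by (intro integral_lap_mult smooth_on_lap_pow) auto
  finally show ?case by (simp add: funpow_swap1)
qed simp

section \<open>Hyperbolic volume and the energy as a Euclidean integral\<close>

definition hyp_density :: "real^'n::finite \<Rightarrow> real" where
  "hyp_density x = indicator (ball 0 1) x * (1 / rho x) ^ CARD('n)"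

lemma hyp_density_nonneg: "0 \<le> hyp_density x"
  using rho_pos[of x] by (auto simp: hyp_density_def indicator_def intro!: zero_le_power less_imp_le)

lemma rho_measurable [measurable]: "(rho :: real^'n::finite \<Rightarrow> real) \<in> borel_measurable borel"
  unfolding rho_def[abs_def] by (intro borel_measurable_continuous_onI continuous_intros) auto

lemma hyp_density_measurable [measurable]:
  "(hyp_density :: real^'n::finite \<Rightarrow> real) \<in> borel_measurable borel"
  unfolding hyp_density_def[abs_def]
  by (intro borel_measurable_times borel_measurable_power borel_measurable_divide borel_measurable_indicator)
    auto

lemma hyp_vol_eq: "hyp_vol = density lborel (\<lambda>x::real^'n::finite. ennreal (hyp_density x))"
  unfolding hyp_vol_def hyp_density_def rho_def
  by (intro arg_cong2[where f=density] refl ext) (auto simp: indicator_def)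

lemma integral_hyp_vol:
  fixes g :: "real^'n::finite \<Rightarrow> real"
  assumes "g \<in> borel_measurable borel"
  shows "(\<integral>x. g x \<partial>hyp_vol) = (\<integral>x. hyp_density x * g x \<partial>lborel)"
  unfolding hyp_vol_eq using assms by (subst integral_density) (auto simp: hyp_density_nonneg)

theorem gjms_norm_sq_eq:
  fixes u :: "real^'n::finite \<Rightarrow> real"
  assumes N: "CARD('n) = 2 * k" and u: "u \<in> test_functions"
  shows "gjms_norm_sq k u = (\<integral>x. (- 1) ^ k * (lap ^^ k) u x * u x \<partial>lborel)"
proof -
  have eq: "gjms k u x * u x = rho x ^ (2 * k) * (- 1) ^ k * (lap ^^ k) u x * u x" for x
    using gjms_eq_lap_pow[OF N test_functions_smooth_on_ball[OF u], of x] test_functions_eq_0[OF u, of x]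
    by (cases "x \<in> ball 0 1") auto
  note m = test_functions_measurable[OF u] test_functions_measurable[OF test_functions_lap_pow[OF u]]
  have "gjms_norm_sq k u = (\<integral>x. hyp_density x * (rho x ^ (2 * k) * (- 1) ^ k * (lap ^^ k) u x * u x) \<partial>lborel)"
    unfolding gjms_norm_sq_def eq by (intro integral_hyp_vol borel_measurable_times borel_measurable_power
      rho_measurable borel_measurable_const m)
  moreover have "hyp_density x * (rho x ^ (2 * k) * (- 1) ^ k * (lap ^^ k) u x * u x) = (- 1) ^ k * (lap ^^ k) u x * u x" for x
    using test_functions_eq_0[OF u, of x] rho_pos[of x]
    by (cases "x \<in> ball 0 1") (auto simp: hyp_density_def N power_divide)
  ultimately show ?thesis by (simp only:)
qed

subsection \<open>Iterated Laplacians of logarithms\<close>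

lemma lap_pow_lin:
  assumes S: "open S" and f: "smooth_on S f" "smooth_on S g" and x: "x \<in> S"
  shows "(lap ^^ j) (\<lambda>y. a * f y + b * g y) x = a * (lap ^^ j) f x + b * (lap ^^ j) g x"
  using x
proof (induction j arbitrary: x)
  case (Suc j)
  let ?L = "lap ^^ j"
  have sm: "smooth_on S (?L f)" "smooth_on S (?L g)"
    using f S by (auto intro: smooth_on_lap_pow)
  have "lap (?L (\<lambda>y. a * f y + b * g y)) x = lap (\<lambda>y. a * ?L f y + b * ?L g y) x"
    by (rule lap_cong[OF S Suc.prems]) (rule Suc.IH)
  also have "\<dots> = lap (\<lambda>y. a * ?L f y) x + lap (\<lambda>y. b * ?L g y) x"
    using sm S Suc.prems by (simp only: lap_add[OF S] smooth_on_mult smooth_on_const)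
  finally show ?case using sm Suc.prems by (simp add: lap_cmult[OF S])
qed simp

lemma lap_compose:
  assumes S: "open S" and f: "smooth_on S f" and D: "deriv_seq T D" "f ` S \<subseteq> T" and x: "x \<in> S"
  shows "lap (\<lambda>y. D n (f y)) x
    = D (Suc (Suc n)) (f x) * (\<Sum>i\<in>UNIV. (partial_deriv i f x)\<^sup>2) + D (Suc n) (f x) * lap f x"
proof -
  have fT: "f y \<in> T" if "y \<in> S" for y using D(2) that by blast
  have pd: "partial_deriv i (\<lambda>y. D m (f y)) y = D (Suc m) (f y) * partial_deriv i f y" if "y \<in> S" for m i y
    by (rule partial_deriv_chain[OF smooth_on_differentiable[OF f S that] deriv_seqD[OF D(1) fT[OF that]]])
  have sm: "smooth_on S (\<lambda>y. D m (f y))" for m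
    by (rule smooth_on_compose[OF S f D])
  have "partial_deriv i (partial_deriv i (\<lambda>y. D n (f y))) x
      = D (Suc (Suc n)) (f x) * (partial_deriv i f x)\<^sup>2 + D (Suc n) (f x) * partial_deriv i (partial_deriv i f) x" for i
  proof -
    have "partial_deriv i (partial_deriv i (\<lambda>y. D n (f y))) x = partial_deriv i (\<lambda>y. D (Suc n) (f y) * partial_deriv i f y) x"
      by (rule partial_deriv_cong_open[OF S x pd])
    also have "\<dots> = partial_deriv i (\<lambda>y. D (Suc n) (f y)) x * partial_deriv i f x + D (Suc n) (f x) * partial_deriv i (partial_deriv i f) x"
      by (rule partial_deriv_mult[OF smooth_on_differentiable[OF sm S x] smooth_on_differentiable[OF smooth_on_partial_deriv[OF f] S x]])
    finally show ?thesis by (simp add: pd[OF x] power2_eq_square)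
  qed
  then show ?thesis by (simp add: lap_def sum.distrib sum_distrib_left)
qed

lemma partial_deriv_add_const: "partial_deriv i (\<lambda>y. f y + c) = partial_deriv i f"
proof -
  have "((\<lambda>t. g t + c) has_real_derivative d) (at 0) \<longleftrightarrow> (g has_real_derivative d) (at 0)" for g :: "real \<Rightarrow> real" and d
    using DERIV_add[OF _ DERIV_const, of g d 0 UNIV c] DERIV_add[OF _ DERIV_const, of "\<lambda>t. g t + c" d 0 UNIV "- c"] by auto
  then show ?thesis by (simp add: fun_eq_iff partial_deriv_def deriv_def)
qed

lemma lap_norm_sq: "lap (\<lambda>y. (norm (y - a))\<^sup>2 + c) (x :: real^'n::finite) = 2 * real CARD('n)"
proof -
  have "partial_deriv i (\<lambda>y. (norm (y - a))\<^sup>2 + c) = (\<lambda>y. 2 * y $ i + (- 2 * a $ i))" for i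
    by (simp add: fun_eq_iff partial_deriv_add_const partial_deriv_norm_sq)
  then have "partial_deriv i (partial_deriv i (\<lambda>y. (norm (y - a))\<^sup>2 + c)) x = 2" for i
    using partial_deriv_cmult[OF smooth_on_differentiable[OF smooth_on_component open_UNIV UNIV_I], of i 2 i x]
    by (simp only: partial_deriv_add_const) (simp add: partial_deriv_component)
  then show ?thesis by (simp add: lap_def)
qed

lemma sum_power2_component: "(\<Sum>i\<in>UNIV. (x $ i)\<^sup>2) = (norm (x :: real^'n::finite))\<^sup>2"
  by (simp add: norm_vec_def L2_set_def sum_nonneg)

lemma lap_radial:
  fixes a x :: "real^'n::finite"
  assumes S: "open S" and D: "deriv_seq T D" "(\<lambda>y. (norm (y - a))\<^sup>2 + c) ` S \<subseteq> T" and x: "x \<in> S"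
  shows "lap (\<lambda>y. D n ((norm (y - a))\<^sup>2 + c)) x
    = 4 * (norm (x - a))\<^sup>2 * D (Suc (Suc n)) ((norm (x - a))\<^sup>2 + c) + 2 * real CARD('n) * D (Suc n) ((norm (x - a))\<^sup>2 + c)"
proof -
  have "smooth_on S (\<lambda>y. (norm (y - a))\<^sup>2 + c)"
    by (intro smooth_on_add smooth_on_norm_sq smooth_on_const S)
  moreover have "(\<Sum>i\<in>UNIV. (partial_deriv i (\<lambda>y. (norm (y - a))\<^sup>2 + c) x)\<^sup>2) = 4 * (norm (x - a))\<^sup>2"
    by (simp add: partial_deriv_add_const partial_deriv_norm_sq power_mult_distrib
        sum_power2_component[of "x - a", symmetric] sum_distrib_left del: right_diff_distrib_numeral)
  ultimately show ?thesis using lap_compose[OF S _ D x, of n] by (simp add: lap_norm_sq)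
qed

definition ln_deriv :: "nat \<Rightarrow> real \<Rightarrow> real" where
  "ln_deriv n t = (if n = 0 then ln t else (- 1) ^ (n - 1) * fact (n - 1) / t ^ n)"

lemma ln_deriv_0 [simp]: "ln_deriv 0 t = ln t"
  by (simp add: ln_deriv_def)

lemma deriv_seq_ln: "deriv_seq {0<..} ln_deriv"
  unfolding deriv_seq_def
proof (intro allI ballI)
  fix n and x :: real assume x: "x \<in> {0<..}"
  show "(ln_deriv n has_real_derivative ln_deriv (Suc n) x) (at x)"
  proof (cases n)
    case 0
    have "ln_deriv 0 = ln" by (simp add: fun_eq_iff)
    then show ?thesis using x 0 by (auto intro!: derivative_eq_intros simp: ln_deriv_def)
  next
    case (Suc m)
    have "ln_deriv n = (\<lambda>t. (- 1) ^ m * fact m / t ^ Suc m)"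
      by (simp add: fun_eq_iff ln_deriv_def Suc)
    moreover have "((\<lambda>t. (- 1) ^ m * fact m / t ^ Suc m) has_real_derivative
        (- 1) ^ Suc m * fact (Suc m) / x ^ Suc (Suc m)) (at x)"
      using x by (auto intro!: derivative_eq_intros simp: field_simps) (cases m; simp add: field_simps)
    ultimately show ?thesis by (simp add: Suc ln_deriv_def)
  qed
qed

lemma mult_ln_deriv: "0 < t \<Longrightarrow> t * ln_deriv (Suc (Suc n)) t = - real (Suc n) * ln_deriv (Suc n) t"
  by (simp add: ln_deriv_def field_simps)

text \<open>In s = |x - a|^2 + e the radial Laplacian is 4 (s - e) f'' + 4 k f'. Multiplication by s
  lowers the order of a derivative of the logarithm by one, so only two pure derivatives remain. The
  coefficient of the lower one vanishes at n = k - 1.\<close>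

lemma lap_ln_deriv_norm_sq:
  fixes a x :: "real^'n::finite"
  assumes N: "CARD('n) = 2 * k" and e: "0 < e"
  shows "lap (\<lambda>y. ln_deriv n ((norm (y - a))\<^sup>2 + e)) x
    = 4 * (real k - 1 - real n) * ln_deriv (Suc n) ((norm (x - a))\<^sup>2 + e)
      + (- 4 * e) * ln_deriv (Suc (Suc n)) ((norm (x - a))\<^sup>2 + e)"
proof -
  let ?s = "(norm (x - a))\<^sup>2 + e"
  have pos: "0 < (norm (y - a))\<^sup>2 + e" for y using e by (simp add: add_nonneg_pos)
  have "lap (\<lambda>y. ln_deriv n ((norm (y - a))\<^sup>2 + e)) x
      = 4 * (?s - e) * ln_deriv (Suc (Suc n)) ?s + 4 * real k * ln_deriv (Suc n) ?s"
    by (subst lap_radial[OF open_UNIV deriv_seq_ln]) (use pos in \<open>auto simp: N\<close>)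
  also have "\<dots> = 4 * (?s * ln_deriv (Suc (Suc n)) ?s) - 4 * e * ln_deriv (Suc (Suc n)) ?s + 4 * real k * ln_deriv (Suc n) ?s"
    by (simp add: algebra_simps)
  finally show ?thesis unfolding mult_ln_deriv[OF pos] by (simp add: algebra_simps)
qed

lemma smooth_on_ln_deriv_norm_sq:
  fixes a :: "real^'n::finite"
  assumes "0 < e" "open S"
  shows "smooth_on S (\<lambda>y. ln_deriv n ((norm (y - a))\<^sup>2 + e))"
proof (rule smooth_on_compose[OF assms(2) _ deriv_seq_ln])
  show "smooth_on S (\<lambda>y. (norm (y - a))\<^sup>2 + e)"
    by (intro smooth_on_add smooth_on_norm_sq smooth_on_const assms)
qed (use assms in \<open>auto simp: add_nonneg_pos\<close>)

text \<open>The two-step induction works because for \<open>n = k - j\<close> the intermediate powers cancel.\<close>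

lemma lap_pow_ln_deriv:
  fixes a x :: "real^'n::finite"
  assumes N: "CARD('n) = 2 * k" and e: "0 < e" and "j \<le> k"
  shows "(lap ^^ j) (\<lambda>y. ln_deriv (k - j) ((norm (y - a))\<^sup>2 + e)) x = (- 4 * e) ^ j * ln_deriv (k + j) ((norm (x - a))\<^sup>2 + e)"
  using assms(3)
proof (induction j arbitrary: x rule: less_induct)
  case (less j)
  let ?E = "\<lambda>n y. ln_deriv n ((norm (y - a))\<^sup>2 + e)"
  note L = lap_ln_deriv_norm_sq[OF N e, of _ a]
  have sm: "smooth_on UNIV (?E n)" for n by (rule smooth_on_ln_deriv_norm_sq[OF e open_UNIV])
  consider "j = 0" | "j = 1" | i where "j = Suc (Suc i)" by (metis One_nat_def not0_implies_Suc)
  then show ?case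
  proof cases
    case 2
    then have k1: "Suc (k - j) = k" "real k - 1 - real (k - j) = 0" "Suc k = k + j"
      using less.prems by (auto simp: of_nat_diff)
    have "(lap ^^ j) (?E (k - j)) x = lap (?E (k - j)) x"
      by (simp only: 2 One_nat_def funpow.simps o_apply id_apply)
    also have "\<dots> = (- 4 * e) * ?E (k + j) x"
      unfolding L k1 by simp
    finally show ?thesis by (simp only: 2 power_one_right)
  next
    case 3
    define n where "n = k - j"
    have k: "k = n + i + 2" using less.prems 3 by (simp add: n_def)
    have i1: "(lap ^^ Suc i) (?E (Suc n)) y = (- 4 * e) ^ Suc i * ?E (k + Suc i) y" for y
      using less.IH[of "Suc i" y] 3 less.prems by (simp add: k del: funpow.simps)
    have i0: "(lap ^^ i) (?E (Suc (Suc n))) y = (- 4 * e) ^ i * ?E (k + i) y" for y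
      using less.IH[of i y] 3 less.prems by (simp add: k)
    have "(lap ^^ j) (?E n) x = (lap ^^ Suc i) (lap (?E n)) x"
      by (simp only: 3 funpow_Suc_right o_apply)
    also have "lap (?E n) = (\<lambda>y. 4 * (real k - 1 - real n) * ?E (Suc n) y + (- 4 * e) * ?E (Suc (Suc n)) y)"
      by (rule ext) (rule L)
    also have "(lap ^^ Suc i) \<dots> x = 4 * (real k - 1 - real n) * (lap ^^ Suc i) (?E (Suc n)) x
        + (- 4 * e) * (lap ^^ Suc i) (?E (Suc (Suc n))) x"
      by (rule lap_pow_lin[OF open_UNIV sm sm UNIV_I])
    also have "(lap ^^ Suc i) (?E (Suc (Suc n))) x = (- 4 * e) ^ i * lap (?E (k + i)) x"
    proof -
      have "(lap ^^ Suc i) (?E (Suc (Suc n))) x = lap (\<lambda>y. (- 4 * e) ^ i * ?E (k + i) y) x"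
        unfolding funpow.simps o_apply by (rule lap_cong[OF open_UNIV UNIV_I]) (rule i0)
      then show ?thesis by (simp only: lap_cmult[OF open_UNIV sm UNIV_I])
    qed
    \<comment> \<open>Since k = n + i + 2, the coefficient k - 1 - (k + i) is -(i + 1) = -(k - 1 -
      n). This makes the \<open>?E (k + Suc i)\<close> term cancel against the one coming from
      \<open>i1\<close>.\<close>
    also have "lap (?E (k + i)) x = - 4 * (real k - 1 - real n) * ?E (k + Suc i) x + (- 4 * e) * ?E (k + j) x"
      unfolding L using k by (simp add: 3 algebra_simps)
    finally have "(lap ^^ j) (?E n) x = (- 4 * e) ^ j * ?E (k + j) x"
      unfolding i1 by (simp add: 3 algebra_simps)
    then show ?thesis by (simp only: n_def)
  qed auto
qed

text \<open>Up to sign the right-hand side is the bubble of width sqrt e, whose total mass does not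
  depend on e; as e tends to 0 it concentrates at \<open>a\<close>. The minus sign is that of the
  derivative of even order 2k of the logarithm.\<close>

corollary lap_pow_ln_norm_sq:
  fixes a x :: "real^'n::finite"
  assumes N: "CARD('n) = 2 * k" and e: "0 < e" and k: "0 < k"
  shows "(- 1) ^ k * (lap ^^ k) (\<lambda>y. ln ((norm (y - a))\<^sup>2 + e)) x
    = - ((4 * e) ^ k * fact (2 * k - 1) / ((norm (x - a))\<^sup>2 + e) ^ (2 * k))"
proof -
  let ?s = "(norm (x - a))\<^sup>2 + e"
  have "odd (2 * k - 1)" using k by simp
  then have D: "ln_deriv (k + k) ?s = - (fact (2 * k - 1) / ?s ^ (2 * k))"
    using k by (simp only: ln_deriv_def mult_2[symmetric] power_minus_odd power_one) simp
  have e1: "(- 4 * e) ^ k = (- 1) ^ k * (4 * e) ^ k"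
    by (simp only: power_mult_distrib[symmetric]) simp
  have e2: "(- 1) ^ k * (- 1) ^ k = (1::real)" by (simp only: power_mult_distrib[symmetric]) simp
  have "(- 1) ^ k * (lap ^^ k) (\<lambda>y. ln ((norm (y - a))\<^sup>2 + e)) x = (- 1) ^ k * ((- 4 * e) ^ k * ln_deriv (k + k) ?s)"
    using lap_pow_ln_deriv[OF N e order_refl, of a x] by (simp only: diff_self_eq_0 ln_deriv_0)
  also have "\<dots> = ((- 1) ^ k * (- 1) ^ k) * ((4 * e) ^ k * ln_deriv (k + k) ?s)"
    unfolding e1 by (simp only: mult_ac)
  finally show ?thesis unfolding e2 D by simp
qed

text \<open>\<open>kern_den x y = |x - y|\<^sup>2 + (1 - |x|\<^sup>2) (1 - |y|\<^sup>2)\<close> is \<open>|x|\<^sup>2\<close> times the squared distance from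
  \<open>y\<close> to the reflection of \<open>x\<close> in the unit sphere; hence its logarithm is polyharmonic.\<close>

definition kern_den :: "real^'n::finite \<Rightarrow> real^'n \<Rightarrow> real" where
  "kern_den x y = (norm (y - x))\<^sup>2 + 4 * rho x * rho y"

lemma kern_den_pos: "x \<in> ball 0 1 \<Longrightarrow> y \<in> ball 0 1 \<Longrightarrow> 0 < kern_den x y"
  unfolding kern_den_def using rho_pos[of x] rho_pos[of y] by (simp add: add_nonneg_pos)

lemma smooth_on_kern_den: "open S \<Longrightarrow> smooth_on S (kern_den x)"
  unfolding kern_den_def[abs_def]
  by (intro smooth_on_add smooth_on_norm_sq smooth_on_mult smooth_on_const smooth_on_rho)

lemma partial_deriv_kern_den:
  "partial_deriv i (kern_den x) y = 2 * (norm x)\<^sup>2 * y $ i - 2 * x $ i"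
proof -
  note d = smooth_on_differentiable[OF _ open_UNIV UNIV_I]
  have "kern_den x = (\<lambda>y. (norm (y - x))\<^sup>2 + 4 * rho x * rho y)" by (simp add: fun_eq_iff kern_den_def)
  then have "partial_deriv i (kern_den x) y = 2 * (y $ i - x $ i) + 4 * rho x * (- (y $ i))"
    by (simp only: partial_deriv_add partial_deriv_cmult d smooth_on_norm_sq smooth_on_mult smooth_on_const
        smooth_on_rho open_UNIV partial_deriv_norm_sq partial_deriv_rho)
  then show ?thesis by (simp add: rho_def field_simps)
qed

text \<open>For x different from 0, with x* = x / |x|^2, the denominator is |x|^2 |y - x*|^2, and a
  squared distance q satisfies |grad q|^2 = 4 q. The polynomial form covers x = 0 as well.\<close>

lemma sum_partial_deriv_kern_den:
  "(\<Sum>i\<in>UNIV. (partial_deriv i (kern_den x) y)\<^sup>2) = 4 * (norm x)\<^sup>2 * kern_den x y"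
proof -
  let ?c = "(norm x)\<^sup>2"
  have "(\<Sum>i\<in>UNIV. (partial_deriv i (kern_den x) y)\<^sup>2) = 4 * (\<Sum>i\<in>UNIV. ((?c *\<^sub>R y - x) $ i)\<^sup>2)"
    unfolding sum_distrib_left
    by (intro sum.cong refl) (simp add: partial_deriv_kern_den power2_eq_square algebra_simps)
  also have "\<dots> = 4 * (norm (?c *\<^sub>R y - x))\<^sup>2"
    by (simp only: sum_power2_component)
  also have "(norm (c *\<^sub>R y - x))\<^sup>2 = c\<^sup>2 * (norm y)\<^sup>2 - 2 * c * (x \<bullet> y) + (norm x)\<^sup>2" for c
    by (simp add: power2_norm_eq_inner inner_diff_left inner_diff_right inner_commute power2_eq_square[of c] algebra_simps)
  also have "4 * (?c\<^sup>2 * (norm y)\<^sup>2 - 2 * ?c * (x \<bullet> y) + ?c) = 4 * ?c * ((norm y)\<^sup>2 - 2 * (x \<bullet> y) + ?c + (1 - ?c) * (1 - (norm y)\<^sup>2))"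
    by (simp add: algebra_simps power2_eq_square)
  also have "(norm y)\<^sup>2 - 2 * (x \<bullet> y) + ?c = (norm (y - x))\<^sup>2"
    by (simp add: power2_norm_eq_inner inner_diff_left inner_diff_right inner_commute)
  also have "(norm (y - x))\<^sup>2 + (1 - ?c) * (1 - (norm y)\<^sup>2) = kern_den x y"
    by (simp add: kern_den_def rho_def field_simps)
  finally show ?thesis .
qed

lemma lap_kern_den: "lap (kern_den x) (y :: real^'n::finite) = 2 * real CARD('n) * (norm x)\<^sup>2"
proof -
  note d = smooth_on_differentiable[OF _ open_UNIV UNIV_I]
  have "partial_deriv i (kern_den x) = (\<lambda>y. 2 * (norm x)\<^sup>2 * y $ i + (- 2 * x $ i))" for i
    by (simp add: fun_eq_iff partial_deriv_kern_den)
  then have "partial_deriv i (partial_deriv i (kern_den x)) y = 2 * (norm x)\<^sup>2" for i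
    by (simp only: partial_deriv_add_const partial_deriv_cmult d smooth_on_component) (simp add: partial_deriv_component)
  then show ?thesis by (simp add: lap_def)
qed

text \<open>By the two preceding identities a Laplacian turns the n-th derivative of the logarithm,
  evaluated at \<open>kern_den\<close>, into 4 |x|^2 (k - 1 - n) times the next one. Among the k
  factors collected, the one with n = k - 1 is zero.\<close>

lemma lap_pow_ln_kern_den:
  fixes x y :: "real^'n::finite"
  assumes N: "CARD('n) = 2 * k" and k: "0 < k" and x: "x \<in> ball 0 1" and y: "y \<in> ball 0 1"
  shows "(lap ^^ k) (\<lambda>y. ln (kern_den x y)) y = 0"
proof -
  let ?B = "ball 0 1 :: (real^'n) set"
  have im: "kern_den x ` ?B \<subseteq> {0<..}" using kern_den_pos[OF x] by auto
  have sm: "smooth_on ?B (\<lambda>y. ln_deriv n (kern_den x y))" for n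
    by (rule smooth_on_compose[OF open_ball smooth_on_kern_den[OF open_ball] deriv_seq_ln im])
  have lap1: "lap (\<lambda>y. ln_deriv n (kern_den x y)) y
      = 4 * (norm x)\<^sup>2 * (real k - 1 - real n) * ln_deriv (Suc n) (kern_den x y)" if y: "y \<in> ?B" for n y
  proof -
    have "lap (\<lambda>y. ln_deriv n (kern_den x y)) y = 4 * (norm x)\<^sup>2 * (kern_den x y * ln_deriv (Suc (Suc n)) (kern_den x y))
        + 4 * real k * (norm x)\<^sup>2 * ln_deriv (Suc n) (kern_den x y)"
      unfolding lap_compose[OF open_ball smooth_on_kern_den[OF open_ball] deriv_seq_ln im y]
        sum_partial_deriv_kern_den lap_kern_den N by simp
    then show ?thesis unfolding mult_ln_deriv[OF kern_den_pos[OF x y]] by (simp add: algebra_simps)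
  qed
  have "(lap ^^ j) (\<lambda>y. ln_deriv 0 (kern_den x y)) y
      = (\<Prod>l<j. 4 * (norm x)\<^sup>2 * (real k - 1 - real l)) * ln_deriv j (kern_den x y)" if "y \<in> ?B" for j y
    using that
  proof (induction j arbitrary: y)
    case (Suc j)
    have "(lap ^^ Suc j) (\<lambda>y. ln_deriv 0 (kern_den x y)) y
        = lap (\<lambda>y. (\<Prod>l<j. 4 * (norm x)\<^sup>2 * (real k - 1 - real l)) * ln_deriv j (kern_den x y)) y"
      unfolding funpow.simps o_apply by (rule lap_cong[OF open_ball Suc.prems]) (rule Suc.IH)
    then show ?case using lap1[OF Suc.prems, of j] by (simp add: lap_cmult[OF open_ball sm Suc.prems])
  qed simp
  from this[OF y, of k] have "(lap ^^ k) (\<lambda>y. ln (kern_den x y)) y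
      = (\<Prod>l<k. 4 * (norm x)\<^sup>2 * (real k - 1 - real l)) * ln_deriv k (kern_den x y)"
    by simp
  moreover have "(\<Prod>l<k. 4 * (norm x)\<^sup>2 * (real k - 1 - real l)) = 0"
    by (rule prod_zero) (use k in \<open>auto intro!: bexI[of _ "k - 1"] simp: of_nat_diff\<close>)
  ultimately show ?thesis by simp
qed

subsection \<open>Radial integrals\<close>

lemma emeasure_norm_sq_less:
  fixes R :: real
  assumes N: "CARD('n::finite) = 2 * k" and R: "0 \<le> R"
  shows "emeasure lborel {z :: real^'n. (norm z)\<^sup>2 < R} = ennreal (unit_ball_vol (2 * k) * R ^ k)"
proof -
  have "{z :: real^'n. (norm z)\<^sup>2 < R} = ball 0 (sqrt R)"
    using R by (auto simp: real_less_rsqrt real_sqrt_less_iff intro: real_less_rsqrt)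
      (metis norm_ge_zero real_sqrt_less_mono real_sqrt_pow2 power_strict_mono real_sqrt_ge_zero zero_less_numeral)
  then show ?thesis
    using R by (simp add: emeasure_ball N power_mult)
qed

text \<open>Layer-cake formula: exchanging the integrals turns a radial integral into a
  one-dimensional one against volumes of balls, which replaces polar coordinates. \<open>R t\<close>
  is the squared radius of the layer at level t.\<close>

lemma nn_integral_layers:
  fixes G :: "real \<Rightarrow> ennreal" and R :: "real \<Rightarrow> real"
  assumes N: "CARD('n::finite) = 2 * k"
    and [measurable]: "G \<in> borel_measurable borel" "R \<in> borel_measurable borel"
    and R: "\<And>t. G t \<noteq> 0 \<Longrightarrow> 0 \<le> R t"
  shows "(\<integral>\<^sup>+z. (\<integral>\<^sup>+t. G t * indicator {t. (norm (z :: real^'n))\<^sup>2 < R t} t \<partial>lborel) \<partial>lborel)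
    = (\<integral>\<^sup>+t. G t * ennreal (unit_ball_vol (2 * k) * R t ^ k) \<partial>lborel)"
proof -
  have [measurable]: "(\<lambda>z :: real^'n. norm z) \<in> borel_measurable borel" by simp
  have "(\<integral>\<^sup>+z. (\<integral>\<^sup>+t. G t * indicator {t. (norm (z :: real^'n))\<^sup>2 < R t} t \<partial>lborel) \<partial>lborel)
      = (\<integral>\<^sup>+t. (\<integral>\<^sup>+z. G t * indicator {t. (norm (z :: real^'n))\<^sup>2 < R t} t \<partial>lborel) \<partial>lborel)"
  proof (rule lborel_pair.Fubini')
    have "(\<lambda>(t, z :: real^'n). G t * indicator {p. (norm (snd p))\<^sup>2 < R (fst p)} (t, z))
        \<in> borel_measurable (lborel \<Otimes>\<^sub>M lborel)"
      by measurable
    also have "(\<lambda>(t, z :: real^'n). G t * indicator {p. (norm (snd p))\<^sup>2 < R (fst p)} (t, z))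
        = (\<lambda>(t, z). G t * indicator {t. (norm z)\<^sup>2 < R t} t)"
      by (auto simp: fun_eq_iff indicator_def)
    finally show "(\<lambda>(t, z :: real^'n). G t * indicator {t. (norm z)\<^sup>2 < R t} t)
        \<in> borel_measurable (lborel \<Otimes>\<^sub>M lborel)" .
  qed
  also have "\<dots> = (\<integral>\<^sup>+t. G t * ennreal (unit_ball_vol (2 * k) * R t ^ k) \<partial>lborel)"
  proof (rule nn_integral_cong)
    fix t
    have "(\<integral>\<^sup>+z. G t * indicator {t. (norm (z :: real^'n))\<^sup>2 < R t} t \<partial>lborel)
        = (\<integral>\<^sup>+z. G t * indicator {z :: real^'n. (norm z)\<^sup>2 < R t} z \<partial>lborel)"
      by (simp add: indicator_def)
    also have "\<dots> = G t * emeasure lborel {z :: real^'n. (norm z)\<^sup>2 < R t}"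
      by (subst nn_integral_cmult_indicator) auto
    finally show "(\<integral>\<^sup>+z. G t * indicator {t. (norm (z :: real^'n))\<^sup>2 < R t} t \<partial>lborel)
        = G t * ennreal (unit_ball_vol (2 * k) * R t ^ k)"
      using R[of t] emeasure_norm_sq_less[OF N, of "R t"] by (cases "G t = 0") simp_all
  qed
  finally show ?thesis .
qed

lemma nn_integral_power_layer:
  fixes b :: real
  assumes "0 \<le> b" "b \<le> 1" "0 < m"
  shows "(\<integral>\<^sup>+t. ennreal (real m * t ^ (m - 1)) * indicator {0<..<b} t \<partial>lborel) = ennreal (b ^ m)"
proof -
  have "(\<integral>\<^sup>+t. ennreal (real m * t ^ (m - 1)) * indicator {0<..<b} t \<partial>lborel)
      = (\<integral>\<^sup>+t. ennreal (real m * t ^ (m - 1)) * indicator {0..b} t \<partial>lborel)"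
  proof (rule nn_integral_cong_AE)
    have "AE t in lborel. t \<noteq> 0 \<and> t \<noteq> b" using AE_lborel_singleton[of 0] AE_lborel_singleton[of b] by eventually_elim simp
    then show "AE t in lborel. ennreal (real m * t ^ (m - 1)) * indicator {0<..<b} t = ennreal (real m * t ^ (m - 1)) * indicator {0..b} t"
      by eventually_elim (auto simp: indicator_def)
  qed
  also have "\<dots> = ennreal (b ^ m - 0 ^ m)"
    by (rule nn_integral_FTC_Icc[where F = "\<lambda>t. t ^ m"])
      (use assms in \<open>auto intro!: derivative_eq_intros simp: has_real_derivative_iff_has_vector_derivative[symmetric]\<close>)
  finally show ?thesis using assms by simp
qed

text \<open>The power 2k of 1 / (1 + |z|^2) is sliced at levels t of the base; the superlevel set is
  the ball of squared radius (1 - t) / t. What results is a multiple of the Beta integral with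
  parameters k and k + 1.\<close>

lemma nn_integral_bubble:
  assumes N: "CARD('n::finite) = 2 * k" and k: "0 < k"
  shows "(\<integral>\<^sup>+(z :: real^'n). ennreal (1 / (1 + (norm z)\<^sup>2) ^ (2 * k)) \<partial>lborel)
    = ennreal (pi ^ k * fact (k - 1) / fact (2 * k - 1))"
proof -
  define G where "G t = ennreal (real (2 * k) * t ^ (2 * k - 1)) * indicator {0<..<1} t" for t :: real
  have pos: "0 < 1 + (norm z)\<^sup>2" for z :: "real^'n" by (simp add: add_pos_nonneg)
  have "ennreal (1 / (1 + (norm z)\<^sup>2) ^ (2 * k))
      = (\<integral>\<^sup>+t. G t * indicator {t. (norm z)\<^sup>2 < (1 - t) / t} t \<partial>lborel)" for z :: "real^'n"
  proof -
    have "ennreal (1 / (1 + (norm z)\<^sup>2) ^ (2 * k)) = ennreal ((1 / (1 + (norm z)\<^sup>2)) ^ (2 * k))"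
      by (simp add: power_one_over)
    also have "\<dots> = (\<integral>\<^sup>+t. ennreal (real (2 * k) * t ^ (2 * k - 1)) * indicator {0<..<1 / (1 + (norm z)\<^sup>2)} t \<partial>lborel)"
      by (rule nn_integral_power_layer[symmetric]) (use k pos[of z] in \<open>auto simp: divide_le_eq\<close>)
    also have "\<dots> = (\<integral>\<^sup>+t. G t * indicator {t. (norm z)\<^sup>2 < (1 - t) / t} t \<partial>lborel)"
    proof (rule nn_integral_cong)
      fix t :: real
      have "t < 1 / (1 + (norm z)\<^sup>2) \<longleftrightarrow> t < 1 \<and> (norm z)\<^sup>2 < (1 - t) / t" if "0 < t"
      proof -
        have "t < 1 / (1 + (norm z)\<^sup>2) \<longleftrightarrow> t * (1 + (norm z)\<^sup>2) < 1" using pos[of z] by (simp add: less_divide_eq)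
        also have "\<dots> \<longleftrightarrow> (norm z)\<^sup>2 < (1 - t) / t" using that by (simp add: less_divide_eq algebra_simps)
        also have "\<dots> \<longleftrightarrow> t < 1 \<and> (norm z)\<^sup>2 < (1 - t) / t"
          using that by (auto simp: less_divide_eq) (smt (verit) mult_nonneg_nonneg zero_le_power2)
        finally show ?thesis .
      qed
      then show "ennreal (real (2 * k) * t ^ (2 * k - 1)) * indicator {0<..<1 / (1 + (norm z)\<^sup>2)} t
          = G t * indicator {t. (norm z)\<^sup>2 < (1 - t) / t} t"
        by (auto simp: G_def indicator_def)
    qed
    finally show ?thesis .
  qed
  then have "(\<integral>\<^sup>+(z :: real^'n). ennreal (1 / (1 + (norm z)\<^sup>2) ^ (2 * k)) \<partial>lborel)
      = (\<integral>\<^sup>+(z :: real^'n). (\<integral>\<^sup>+t. G t * indicator {t. (norm z)\<^sup>2 < (1 - t) / t} t \<partial>lborel) \<partial>lborel)"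
    by (simp only:)
  also have "\<dots> = (\<integral>\<^sup>+t. G t * ennreal (unit_ball_vol (2 * k) * ((1 - t) / t) ^ k) \<partial>lborel)"
    unfolding G_def by (rule nn_integral_layers[OF N]) (auto simp: indicator_def split: if_splits)
  also have "\<dots> = (\<integral>\<^sup>+t. ennreal (unit_ball_vol (2 * k) * real (2 * k) * (t ^ (k - 1) * (1 - t) ^ k)) * indicator {0..1} t \<partial>lborel)"
  proof (rule nn_integral_cong_AE)
    have "AE t in lborel. t \<noteq> (0::real) \<and> t \<noteq> 1" using AE_lborel_singleton[of 0] AE_lborel_singleton[of 1] by eventually_elim simp
    then show "AE t in lborel. G t * ennreal (unit_ball_vol (2 * k) * ((1 - t) / t) ^ k)
        = ennreal (unit_ball_vol (2 * k) * real (2 * k) * (t ^ (k - 1) * (1 - t) ^ k)) * indicator {0..1} t"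
    proof eventually_elim
      fix t :: real assume t: "t \<noteq> 0 \<and> t \<noteq> 1"
      show "G t * ennreal (unit_ball_vol (2 * k) * ((1 - t) / t) ^ k)
        = ennreal (unit_ball_vol (2 * k) * real (2 * k) * (t ^ (k - 1) * (1 - t) ^ k)) * indicator {0..1} t"
      proof (cases "0 < t \<and> t < 1")
        case True
        have "2 * k - 1 = (k - 1) + k" using k by simp
        then have "t ^ (2 * k - 1) = t ^ (k - 1) * t ^ k" by (simp only: power_add)
        then have "real (2 * k) * t ^ (2 * k - 1) * (unit_ball_vol (2 * k) * ((1 - t) / t) ^ k)
            = unit_ball_vol (2 * k) * real (2 * k) * (t ^ (k - 1) * (1 - t) ^ k)"
          using True by (simp add: power_divide)
        then show ?thesis using True by (simp add: G_def flip: ennreal_mult')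
      qed (use t in \<open>auto simp: G_def indicator_def\<close>)
    qed
  qed
  also have "\<dots> = ennreal (unit_ball_vol (2 * k) * real (2 * k) * Beta (real k) (real k + 1))"
  proof (rule nn_integral_has_integral_lebesgue')
    have "((\<lambda>t. t powr (real k - 1) * (1 - t) powr (real k + 1 - 1)) has_integral Beta (real k) (real k + 1)) {0..1}"
      using k by (intro has_integral_Beta_real) auto
    then have "((\<lambda>t. t powr (real k - 1) * (1 - t) powr (real k + 1 - 1)) has_integral Beta (real k) (real k + 1)) {0<..<1}"
      by (simp add: has_integral_Icc_iff_Ioo)
    also have "?this \<longleftrightarrow> ((\<lambda>t. t ^ (k - 1) * (1 - t) ^ k) has_integral Beta (real k) (real k + 1)) {0<..<1}"
    proof (rule has_integral_cong)
      fix t :: real assume "t \<in> {0<..<1}"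
      then show "t powr (real k - 1) * (1 - t) powr (real k + 1 - 1) = t ^ (k - 1) * (1 - t) ^ k"
        using k by (simp add: powr_realpow[symmetric] of_nat_diff)
    qed
    finally have "((\<lambda>t. t ^ (k - 1) * (1 - t) ^ k) has_integral Beta (real k) (real k + 1)) {0..1}"
      by (simp add: has_integral_Icc_iff_Ioo)
    then show "((\<lambda>t. unit_ball_vol (2 * k) * real (2 * k) * (t ^ (k - 1) * (1 - t) ^ k)) has_integral
        unit_ball_vol (2 * k) * real (2 * k) * Beta (real k) (real k + 1)) {0..1}"
      by (rule has_integral_mult_right)
  qed auto
  also have "unit_ball_vol (2 * k) * real (2 * k) * Beta (real k) (real k + 1) = pi ^ k * fact (k - 1) / fact (2 * k - 1)"
  proof -
    have f: "fact (2 * k) = real (2 * k) * fact (2 * k - 1)" using k fact_reduce[of "2 * k", where 'a = real] by simp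
    have "Gamma (real k) = fact (k - 1)" "Gamma (real k + 1) = fact k" "Gamma (real k + (real k + 1)) = fact (2 * k)"
    proof -
      have "1 + real (k - 1) = real k" "1 + real k = real k + 1" "1 + real (2 * k) = real k + (real k + 1)"
        using k by auto
      then show "Gamma (real k) = fact (k - 1)" "Gamma (real k + 1) = fact k" "Gamma (real k + (real k + 1)) = fact (2 * k)"
        using Gamma_fact[of "k - 1", where 'a = real] Gamma_fact[of k, where 'a = real] Gamma_fact[of "2 * k", where 'a = real]
        by (simp_all only:)
    qed
    then have B: "Beta (real k) (real k + 1) = fact (k - 1) * fact k / fact (2 * k)"
      by (simp add: Beta_def)
    have V: "unit_ball_vol (2 * k) = pi ^ k / fact k"
      using unit_ball_vol_even[of k] by simp
    have "fact k * real (2 * k) \<noteq> 0" using k by simp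
    then show ?thesis unfolding B V f by (simp add: divide_simps)
  qed
  finally show ?thesis .
qed

lemma nn_integral_affine:
  fixes f :: "real^'n::finite \<Rightarrow> ennreal"
  assumes [measurable]: "f \<in> borel_measurable borel" and c: "0 < c"
  shows "(\<integral>\<^sup>+y. f y \<partial>lborel) = (\<integral>\<^sup>+z. ennreal (c ^ CARD('n)) * f (x + c *\<^sub>R z) \<partial>lborel)"
proof -
  have "(\<integral>\<^sup>+y. f y \<partial>lborel) = (\<integral>\<^sup>+y. f y \<partial>density (distr lborel borel (\<lambda>z. x + c *\<^sub>R z)) (\<lambda>_. ennreal (\<bar>c\<bar> ^ DIM(real^'n))))"
    using lborel_affine[of c x] c by simp
  also have "\<dots> = (\<integral>\<^sup>+z. ennreal (c ^ CARD('n)) * f (x + c *\<^sub>R z) \<partial>lborel)"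
    using c by (simp add: nn_integral_density nn_integral_distr)
  finally show ?thesis .
qed

subsection \<open>The logarithmic kernel\<close>

text \<open>In terms of the hyperbolic distance d this is 2 ln (coth (d / 2)), because |y - x|^2 /
  (4 rho(x) rho(y)) is the square of sinh (d / 2). On the diagonal, division by zero gives the value
  0 instead of infinity.\<close>

definition kern :: "real^'n::finite \<Rightarrow> real^'n \<Rightarrow> real" where
  "kern x y = ln (1 + 4 * rho x * rho y / (norm (y - x))\<^sup>2)"

lemma kern_eq:
  assumes "x \<in> ball 0 1" "y \<in> ball 0 1" "x \<noteq> y"
  shows "kern x y = ln (kern_den x y) - ln ((norm (y - x))\<^sup>2)"
proof -
  have "1 + 4 * rho x * rho y / (norm (y - x))\<^sup>2 = kern_den x y / (norm (y - x))\<^sup>2"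
    using assms(3) by (simp add: kern_den_def field_simps)
  then show ?thesis using assms kern_den_pos[OF assms(1,2)] by (simp add: kern_def ln_div)
qed

lemma kern_nonneg:
  assumes "x \<in> ball 0 1" "y \<in> ball 0 1"
  shows "0 \<le> kern x y"
  using rho_pos[OF assms(1)] rho_pos[OF assms(2)] by (simp add: kern_def)

lemma kern_commute: "kern x y = kern y x"
  by (simp add: kern_def norm_minus_commute mult_ac)

lemma kern_measurable [measurable]:
  "(\<lambda>p. kern (fst p) (snd p :: real^'n::finite)) \<in> borel_measurable (borel \<Otimes>\<^sub>M borel)"
  unfolding kern_def by measurable

lemma kern_measurable' [measurable]: "kern (x :: real^'n::finite) \<in> borel_measurable borel"
  unfolding kern_def[abs_def] by measurable

lemma abs_rho_diff_le:
  assumes "x \<in> ball 0 1" "y \<in> ball 0 1"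
  shows "\<bar>rho x - rho y\<bar> \<le> norm (y - x)"
proof -
  have "rho x - rho y = (norm y - norm x) * ((norm y + norm x) / 2)"
    by (simp add: rho_def field_simps power2_eq_square)
  then have "\<bar>rho x - rho y\<bar> = \<bar>norm y - norm x\<bar> * ((norm y + norm x) / 2)"
    by (simp only: abs_mult) simp
  also have "\<dots> \<le> norm (y - x) * 1"
    using assms norm_triangle_ineq3[of y x] by (intro mult_mono) auto
  finally show ?thesis by simp
qed

text \<open>Either |y - x| is at least rho(x) / 2, and then |y - x|^2 controls rho(x)^2 with loss 1
  + 4 = 5; or y is so near that rho(y) >= rho(x) / 2 and the product term controls rho(x)^2.\<close>

lemma kern_den_lower:
  assumes "x \<in> ball 0 1" "y \<in> ball 0 1"
  shows "((rho x)\<^sup>2 + (norm (y - x))\<^sup>2) / 5 \<le> kern_den x y"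
proof (cases "rho x / 2 \<le> norm (y - x)")
  case True
  then have "(rho x / 2)\<^sup>2 \<le> (norm (y - x))\<^sup>2"
    using rho_pos[OF assms(1)] by (intro power_mono) auto
  then have "((rho x)\<^sup>2 + (norm (y - x))\<^sup>2) / 5 \<le> (norm (y - x))\<^sup>2"
    by (simp add: power_divide)
  moreover have "0 \<le> 4 * rho x * rho y" using rho_pos[OF assms(1)] rho_pos[OF assms(2)] by simp
  ultimately show ?thesis unfolding kern_den_def by (rule add_increasing2[rotated])
next
  case False
  then have "rho x / 2 \<le> rho y" using abs_rho_diff_le[OF assms] by linarith
  then have "4 * rho x * (rho x / 2) \<le> 4 * rho x * rho y"
    using rho_pos[OF assms(1)] by (intro mult_left_mono) auto
  then have "2 * (rho x)\<^sup>2 \<le> 4 * rho x * rho y" by (simp add: power2_eq_square)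
  have *: "(a + b) / 5 \<le> b + c" if "2 * a \<le> c" "0 \<le> a" "0 \<le> b" for a b c :: real
    using that by simp
  show ?thesis unfolding kern_den_def by (rule *) (use \<open>2 * _ \<le> _\<close> in simp_all)
qed

text \<open>One bound for two regimes: linear in \<open>a\<close> when \<open>a\<close> is small, a
  small power of 1 + a when \<open>a\<close> is large. The explicit factor \<open>a\<close> contains
  rho(y), and its 2k-th power is what cancels the hyperbolic density.\<close>

lemma ln_one_plus_le_powr:
  fixes a :: real
  assumes "0 < \<eta>" "\<eta> \<le> 1" "0 \<le> a"
  shows "ln (1 + a) \<le> 2 / \<eta> * (a * (1 + a) powr (\<eta> - 1))"
proof (cases "a \<le> 1")
  case True
  have "1 / 2 \<le> (1 + a) powr (- 1)" using assms True by (simp add: powr_minus field_simps)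
  also have "\<dots> \<le> (1 + a) powr (\<eta> - 1)" using assms by (intro powr_mono) auto
  finally have "a * (1 / 2) \<le> a * (1 + a) powr (\<eta> - 1)" using assms by (intro mult_left_mono) auto
  then have "a \<le> 2 * (a * (1 + a) powr (\<eta> - 1))" by simp
  also have "\<dots> \<le> 2 / \<eta> * (a * (1 + a) powr (\<eta> - 1))"
    using assms by (intro mult_right_mono) (auto simp: field_simps)
  finally have "a \<le> 2 / \<eta> * (a * (1 + a) powr (\<eta> - 1))" .
  moreover have "ln (1 + a) \<le> a" using assms by (intro ln_add_one_self_le_self) auto
  ultimately show ?thesis by simp
next
  case False
  have "ln (1 + a) \<le> (1 + a) powr \<eta> / \<eta>" using assms by (intro ln_powr_bound) auto
  also have "(1 + a) powr \<eta> = (1 + a) * (1 + a) powr (\<eta> - 1)"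
    using assms by (simp add: powr_diff)
  also have "\<dots> \<le> (2 * a) * (1 + a) powr (\<eta> - 1)" using False by (intro mult_right_mono) auto
  finally show ?thesis using assms by (simp add: divide_right_mono mult_ac)
qed

text \<open>The maximum of t^s exp (-\<alpha> t), attained at t = s / \<alpha>. The base s / (exp 1
  * \<alpha>) is the origin of Euler's number in the asymptotics.\<close>

lemma powr_le_exp:
  fixes t :: real
  assumes "0 \<le> t" "0 < s" "0 < \<alpha>"
  shows "t powr s \<le> (s / (exp 1 * \<alpha>)) powr s * exp (\<alpha> * t)"
proof (cases "t = 0")
  case False
  then have t: "0 < t" using assms by simp
  have "ln (\<alpha> * t / s) \<le> \<alpha> * t / s - 1" using t assms by (intro ln_le_minus_one) auto
  then have "s * ln (\<alpha> * t / s) \<le> s * (\<alpha> * t / s - 1)" using assms by (intro mult_left_mono) auto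
  then have "s * ln t \<le> s * (ln s - (1 + ln \<alpha>)) + \<alpha> * t"
    using t assms by (simp add: ln_mult ln_div algebra_simps)
  then have "exp (s * ln t) \<le> exp (s * (ln s - (1 + ln \<alpha>)) + \<alpha> * t)" by simp
  then show ?thesis using t assms by (simp add: powr_def ln_div ln_mult exp_add)
qed (use assms in auto)

context
  fixes k :: nat
  assumes N: "CARD('n::finite) = 2 * k" and k: "0 < k"
begin

text \<open>The exponent is split as 2k + s. The 2k factors go through
  \<open>ln_one_plus_le_powr\<close> and absorb the density; the s factors go through
  \<open>powr_le_exp\<close> and leave (1 + a)^\<alpha>. Altogether (1 + a) carries the exponent
  \<beta> - 2k, and writing 1 + a as \<open>kern_den\<close> over |y - x|^2 leaves the singularity
  |y - x|^(-2 \<beta>).\<close>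

lemma kern_powr_density_le:
  fixes x y :: "real^'n"
  assumes xy: "x \<in> ball 0 1" "y \<in> ball 0 1" "x \<noteq> y"
    and p: "0 < \<alpha>" "0 < \<eta>" "\<eta> \<le> 1" "0 < s" and \<beta>: "\<beta> = \<alpha> + 2 * real k * \<eta>" "\<beta> < 2 * real k"
  shows "kern x y powr (2 * real k + s) * hyp_density y \<le> (s / (exp 1 * \<alpha>)) powr s
    * ((8 / \<eta>) ^ (2 * k) * 5 powr (2 * real k - \<beta>)
       * (rho x ^ (2 * k) * ((norm (y - x))\<^sup>2) powr (- \<beta>) * ((rho x)\<^sup>2 + (norm (y - x))\<^sup>2) powr (\<beta> - 2 * real k)))"
proof -
  define r where "r = rho x"
  define r' where "r' = rho y"
  define D where "D = (norm (y - x))\<^sup>2"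
  define Q where "Q = kern_den x y"
  define a where "a = 4 * r * r' / D"
  have pos: "0 < r" "0 < r'" "0 < D" "0 < Q"
    using rho_pos xy kern_den_pos[of x y] by (auto simp: r_def r'_def D_def Q_def)
  then have a: "0 < a" by (simp add: a_def)
  have Q: "1 + a = Q / D" using pos by (simp add: a_def Q_def D_def r_def r'_def kern_den_def field_simps)
  have L: "kern x y = ln (1 + a)" by (simp add: kern_def a_def r_def r'_def D_def)
  have Lpos: "0 < ln (1 + a)" using a by simp
  have Lexp: "exp (\<alpha> * ln (1 + a)) = (1 + a) powr \<alpha>" using a by (simp add: powr_def)
  have "kern x y powr (2 * real k + s) = ln (1 + a) ^ (2 * k) * ln (1 + a) powr s"
    using Lpos powr_realpow[OF Lpos, of "2 * k"] by (simp add: L powr_add)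
  also have "\<dots> \<le> (2 / \<eta> * (a * (1 + a) powr (\<eta> - 1))) ^ (2 * k) * ((s / (exp 1 * \<alpha>)) powr s * (1 + a) powr \<alpha>)"
    using Lpos a p ln_one_plus_le_powr[of \<eta> a] powr_le_exp[of "ln (1 + a)" s \<alpha>] unfolding Lexp
    by (intro mult_mono power_mono) auto
  also have "\<dots> = (s / (exp 1 * \<alpha>)) powr s * ((2 / \<eta>) ^ (2 * k) * (a ^ (2 * k) * (((1 + a) powr (\<eta> - 1)) ^ (2 * k) * (1 + a) powr \<alpha>)))"
    by (simp only: power_mult_distrib mult_ac)
  also have "((1 + a) powr (\<eta> - 1)) ^ (2 * k) * (1 + a) powr \<alpha> = (1 + a) powr (\<beta> - 2 * real k)"
    using a by (simp add: \<beta> powr_realpow[symmetric] powr_powr powr_add[symmetric] algebra_simps)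
  also have "\<dots> = Q powr (\<beta> - 2 * real k) * D powr (2 * real k - \<beta>)"
    using pos powr_minus_divide[of D "\<beta> - 2 * real k"] unfolding Q by (simp add: powr_divide)
  finally have 1: "kern x y powr (2 * real k + s) \<le> (s / (exp 1 * \<alpha>)) powr s *
     ((2 / \<eta>) ^ (2 * k) * (a ^ (2 * k) * (Q powr (\<beta> - 2 * real k) * D powr (2 * real k - \<beta>))))" .
  have "hyp_density y = (1 / r') ^ (2 * k)"
    using xy by (simp add: hyp_density_def r'_def N)
  then have "kern x y powr (2 * real k + s) * hyp_density y \<le> (s / (exp 1 * \<alpha>)) powr s *
     ((2 / \<eta>) ^ (2 * k) * (a ^ (2 * k) * (Q powr (\<beta> - 2 * real k) * D powr (2 * real k - \<beta>)))) * (1 / r') ^ (2 * k)"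
    using mult_right_mono[OF 1, of "(1 / r') ^ (2 * k)"] pos by simp
  also have "\<dots> = (s / (exp 1 * \<alpha>)) powr s * ((8 / \<eta>) ^ (2 * k) * r ^ (2 * k) * D powr (- \<beta>) * Q powr (\<beta> - 2 * real k))"
  proof -
    have "a ^ (2 * k) * (1 / r') ^ (2 * k) = (a / r') ^ (2 * k)" by (simp add: power_divide)
    also have "a / r' = 4 * r / D" using pos by (simp add: a_def)
    also have "(4 * r / D) ^ (2 * k) = 4 ^ (2 * k) * r ^ (2 * k) * D powr (- 2 * real k)"
      using pos powr_realpow[of D "2 * k"] by (simp add: power_divide power_mult_distrib powr_minus divide_inverse power_inverse)
    finally have M1: "a ^ (2 * k) * (1 / r') ^ (2 * k) * D powr (2 * real k - \<beta>) = 4 ^ (2 * k) * r ^ (2 * k) * D powr (- \<beta>)"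
      using pos by (simp add: powr_add[symmetric])
    have M2: "(8 / \<eta>) ^ (2 * k) = (2 / \<eta>) ^ (2 * k) * 4 ^ (2 * k)"
      by (simp flip: power_mult_distrib)
    have M: "E * (P * (A * (X * Y))) * Z = E * (P * (A * Z * Y) * X)" for E P A X Y Z :: real
      by (simp only: mult_ac)
    show ?thesis unfolding M M1 M2 by (simp only: mult.assoc)
  qed
  also have "\<dots> \<le> (s / (exp 1 * \<alpha>)) powr s * ((8 / \<eta>) ^ (2 * k) * r ^ (2 * k) * D powr (- \<beta>) * (5 powr (2 * real k - \<beta>) * (r\<^sup>2 + D) powr (\<beta> - 2 * real k)))"
  proof -
    have "0 < r\<^sup>2 + D" using pos by (simp add: add_pos_pos)
    then have "Q powr (\<beta> - 2 * real k) \<le> ((r\<^sup>2 + D) / 5) powr (\<beta> - 2 * real k)"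
      using kern_den_lower[OF xy(1,2)] \<beta>(2) by (intro powr_mono2') (auto simp: Q_def r_def D_def)
    also have "\<dots> = 5 powr (2 * real k - \<beta>) * (r\<^sup>2 + D) powr (\<beta> - 2 * real k)"
      using pos powr_minus_divide[of 5 "\<beta> - 2 * real k"] by (simp add: powr_divide)
    finally show ?thesis using pos p by (intro mult_left_mono) auto
  qed
  finally show ?thesis by (simp only: r_def D_def mult_ac)
qed

text \<open>For 0 < w < 1 the power w^(-\<beta>) is 1 plus the integral of \<beta> r^(-\<beta> - 1)
  over r from w to 1. The layer formula then reduces the claim to integrability of r^(k - \<beta> -
  1) at 0, that is to \<beta> < k.\<close>

lemma nn_integral_powr_near_0:
  fixes \<beta> :: real
  assumes \<beta>: "0 < \<beta>" "\<beta> < real k"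
  shows "(\<integral>\<^sup>+z. ennreal (((norm (z :: real^'n))\<^sup>2) powr (- \<beta>)) * indicator {z. (norm z)\<^sup>2 < 1} z \<partial>lborel) < \<infinity>"
proof -
  define G where "G r = ennreal (\<beta> * r powr (- \<beta> - 1)) * indicator {0<..<1} r" for r :: real
  have [measurable]: "G \<in> borel_measurable borel" unfolding G_def by measurable
  have le: "ennreal (((norm z)\<^sup>2) powr (- \<beta>)) * indicator {z. (norm z)\<^sup>2 < 1} z
      \<le> indicator {z. (norm z)\<^sup>2 < 1} z + (\<integral>\<^sup>+r. G r * indicator {r. (norm z)\<^sup>2 < r} r \<partial>lborel)" for z :: "real^'n"
  proof (cases "0 < (norm z)\<^sup>2 \<and> (norm z)\<^sup>2 < 1")
    case True
    define w where "w = (norm z)\<^sup>2"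
    have w: "0 < w" "w < 1" using True by (auto simp: w_def)
    have "(\<integral>\<^sup>+r. ennreal (\<beta> * r powr (- \<beta> - 1)) * indicator {w..1} r \<partial>lborel) = ennreal (- (1 powr (- \<beta>)) - (- (w powr (- \<beta>))))"
      by (rule nn_integral_FTC_Icc[where F = "\<lambda>r. - (r powr (- \<beta>))"])
        (use w \<beta> in \<open>auto intro!: derivative_eq_intros simp: has_real_derivative_iff_has_vector_derivative[symmetric]\<close>)
    also have "(\<integral>\<^sup>+r. ennreal (\<beta> * r powr (- \<beta> - 1)) * indicator {w..1} r \<partial>lborel)
        = (\<integral>\<^sup>+r. G r * indicator {r. w < r} r \<partial>lborel)"
    proof (rule nn_integral_cong_AE)
      have "AE r in lborel. r \<noteq> w \<and> r \<noteq> (1::real)" using AE_lborel_singleton[of w] AE_lborel_singleton[of 1] by eventually_elim simp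
      then show "AE r in lborel. ennreal (\<beta> * r powr (- \<beta> - 1)) * indicator {w..1} r = G r * indicator {r. w < r} r"
        by eventually_elim (use w in \<open>auto simp: G_def indicator_def\<close>)
    qed
    finally have "(\<integral>\<^sup>+r. G r * indicator {r. w < r} r \<partial>lborel) = ennreal (w powr (- \<beta>) - 1)" by simp
    moreover have "1 \<le> w powr (- \<beta>)" using w \<beta> by (simp add: powr_minus one_le_inverse_iff powr_le1)
    then have "ennreal (w powr (- \<beta>)) = 1 + ennreal (w powr (- \<beta>) - 1)"
      by (subst ennreal_1[symmetric], subst ennreal_plus[symmetric]) auto
    ultimately show ?thesis using w by (simp add: w_def[symmetric])
  qed auto
  have "(\<integral>\<^sup>+z. ennreal (((norm (z :: real^'n))\<^sup>2) powr (- \<beta>)) * indicator {z. (norm z)\<^sup>2 < 1} z \<partial>lborel)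
      \<le> (\<integral>\<^sup>+z. indicator {z. (norm (z :: real^'n))\<^sup>2 < 1} z + (\<integral>\<^sup>+r. G r * indicator {r. (norm z)\<^sup>2 < r} r \<partial>lborel) \<partial>lborel)"
    by (intro nn_integral_mono le)
  also have "\<dots> = (\<integral>\<^sup>+z. indicator {z. (norm (z :: real^'n))\<^sup>2 < 1} z \<partial>lborel)
      + (\<integral>\<^sup>+z. (\<integral>\<^sup>+r. G r * indicator {r. (norm (z :: real^'n))\<^sup>2 < r} r \<partial>lborel) \<partial>lborel)"
  proof (rule nn_integral_add)
    have "(\<lambda>(z :: real^'n, r). G r * indicator {p. (norm (fst p))\<^sup>2 < snd p} (z, r)) \<in> borel_measurable (lborel \<Otimes>\<^sub>M lborel)"
      by measurable
    also have "(\<lambda>(z :: real^'n, r). G r * indicator {p. (norm (fst p))\<^sup>2 < snd p} (z, r)) = (\<lambda>(z, r). G r * indicator {r. (norm z)\<^sup>2 < r} r)"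
      by (auto simp: fun_eq_iff indicator_def)
    finally show "(\<lambda>z :: real^'n. \<integral>\<^sup>+r. G r * indicator {r. (norm z)\<^sup>2 < r} r \<partial>lborel) \<in> borel_measurable lborel"
      by (rule lborel.borel_measurable_nn_integral)
  qed simp
  also have "(\<integral>\<^sup>+z. indicator {z. (norm (z :: real^'n))\<^sup>2 < 1} z \<partial>lborel) = emeasure lborel {z :: real^'n. (norm z)\<^sup>2 < 1}"
    by (rule nn_integral_indicator) simp
  also have "\<dots> = ennreal (unit_ball_vol (2 * k) * 1 ^ k)"
    by (rule emeasure_norm_sq_less[OF N]) simp
  also have "(\<integral>\<^sup>+z. (\<integral>\<^sup>+r. G r * indicator {r. (norm (z :: real^'n))\<^sup>2 < r} r \<partial>lborel) \<partial>lborel)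
      = (\<integral>\<^sup>+r. G r * ennreal (unit_ball_vol (2 * k) * r ^ k) \<partial>lborel)"
    by (rule nn_integral_layers[OF N]) (auto simp: G_def indicator_def split: if_splits)
  also have "\<dots> \<le> (\<integral>\<^sup>+r. ennreal (unit_ball_vol (2 * k) * \<beta> * r powr (real k - \<beta> - 1)) * indicator {0..1} r \<partial>lborel)"
  proof (rule nn_integral_mono)
    fix r :: real
    show "G r * ennreal (unit_ball_vol (2 * k) * r ^ k)
        \<le> ennreal (unit_ball_vol (2 * k) * \<beta> * r powr (real k - \<beta> - 1)) * indicator {0..1} r"
    proof (cases "0 < r \<and> r < 1")
      case True
      have "\<beta> * r powr (- \<beta> - 1) * (unit_ball_vol (2 * k) * r ^ k) = unit_ball_vol (2 * k) * \<beta> * r powr (real k - \<beta> - 1)"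
      proof -
        have "r powr (- \<beta> - 1) * r ^ k = r powr (real k - \<beta> - 1)"
          using True by (simp add: powr_realpow[symmetric] powr_add[symmetric] algebra_simps)
        then show ?thesis by (simp add: mult_ac)
      qed
      moreover have "G r * ennreal (unit_ball_vol (2 * k) * r ^ k) = ennreal (\<beta> * r powr (- \<beta> - 1) * (unit_ball_vol (2 * k) * r ^ k))"
        using True \<beta> by (subst ennreal_mult) (auto simp: G_def)
      ultimately show ?thesis using True by (simp only:) simp
    qed (auto simp: G_def indicator_def)
  qed
  also have "\<dots> = ennreal (unit_ball_vol (2 * k) * \<beta> * (1 powr (real k - \<beta> - 1 + 1) / (real k - \<beta> - 1 + 1)))"
  proof (rule nn_integral_has_integral_lebesgue')
    have "((\<lambda>r. r powr (real k - \<beta> - 1)) has_integral (1 powr (real k - \<beta> - 1 + 1) / (real k - \<beta> - 1 + 1))) {0..1}"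
      using \<beta> by (intro has_integral_powr_from_0) auto
    then show "((\<lambda>r. unit_ball_vol (2 * k) * \<beta> * r powr (real k - \<beta> - 1)) has_integral
        unit_ball_vol (2 * k) * \<beta> * (1 powr (real k - \<beta> - 1 + 1) / (real k - \<beta> - 1 + 1))) {0..1}"
      by (rule has_integral_mult_right)
  qed (use \<beta> in auto)
  finally have "(\<integral>\<^sup>+z. ennreal (((norm (z :: real^'n))\<^sup>2) powr (- \<beta>)) * indicator {z. (norm z)\<^sup>2 < 1} z \<partial>lborel)
      \<le> ennreal (unit_ball_vol (2 * k) * 1 ^ k) + ennreal (unit_ball_vol (2 * k) * \<beta> * (1 powr (real k - \<beta> - 1 + 1) / (real k - \<beta> - 1 + 1)))"
    by (simp add: add_left_mono)
  also have "\<dots> < \<infinity>" by simp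
  finally show ?thesis .
qed

text \<open>The integral is homogeneous of degree 0: under y = x + r z the Jacobian and the
  prefactor give r^(4k), the other two powers give r^(-4k). Hence a single constant serves all r and
  x. The rescaled integrand is singular only at 0 and decays like the bubble.\<close>

lemma nn_integral_scaled_kernel:
  fixes \<beta> :: real
  assumes \<beta>: "0 < \<beta>" "\<beta> < real k"
  obtains C where "0 < C" "\<And>r x. 0 < r \<Longrightarrow>
    (\<integral>\<^sup>+y. ennreal (r ^ (2 * k) * ((norm (y - x :: real^'n))\<^sup>2) powr (- \<beta>) * (r\<^sup>2 + (norm (y - x))\<^sup>2) powr (\<beta> - 2 * real k)) \<partial>lborel)
     \<le> ennreal C"
proof -
  define H where "H z = ((norm (z :: real^'n))\<^sup>2) powr (- \<beta>) * (1 + (norm z)\<^sup>2) powr (\<beta> - 2 * real k)" for z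
  let ?I = "\<integral>\<^sup>+z. ennreal (H z) \<partial>lborel"
  have le: "ennreal (H z) \<le> ennreal (((norm z)\<^sup>2) powr (- \<beta>)) * indicator {z. (norm z)\<^sup>2 < 1} z
      + ennreal (2 powr \<beta>) * ennreal (1 / (1 + (norm z)\<^sup>2) ^ (2 * k))" for z
  proof (cases "(norm z)\<^sup>2 < 1")
    case True
    have "(1 + (norm z)\<^sup>2) powr (\<beta> - 2 * real k) \<le> (1 + (norm z)\<^sup>2) powr 0"
      using \<beta> by (intro powr_mono) auto
    then have "H z \<le> ((norm z)\<^sup>2) powr (- \<beta>) * 1"
      unfolding H_def by (intro mult_left_mono) (auto simp: add_nonneg_eq_0_iff split: if_splits)
    then show ?thesis using True by (simp add: add_increasing2 ennreal_leI)
  next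
    case False
    define w where "w = (norm z)\<^sup>2"
    have w: "1 \<le> w" using False by (simp add: w_def)
    \<comment> \<open>For w >= 1, replacing w by (1 + w) / 2 costs a constant and lets the two
      powers combine to the bubble exponent -2k.\<close>
    have "w powr (- \<beta>) \<le> ((1 + w) / 2) powr (- \<beta>)" using w \<beta> by (intro powr_mono2') auto
    also have "\<dots> = 2 powr \<beta> * (1 + w) powr (- \<beta>)" using w by (simp add: powr_divide powr_minus field_simps)
    finally have "H z \<le> 2 powr \<beta> * (1 + w) powr (- \<beta>) * (1 + w) powr (\<beta> - 2 * real k)"
      unfolding H_def w_def[symmetric] by (intro mult_right_mono) auto
    also have "\<dots> = 2 powr \<beta> * (1 / (1 + w) ^ (2 * k))"
    proof -
      have "(1 + w) powr (- \<beta>) * (1 + w) powr (\<beta> - 2 * real k) = (1 + w) powr (- (2 * real k))"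
        by (simp add: powr_add[symmetric])
      then show ?thesis using w powr_realpow[of "1 + w" "2 * k"] by (simp add: mult.assoc powr_minus divide_inverse)
    qed
    finally show ?thesis using False by (simp add: w_def ennreal_leI flip: ennreal_mult')
  qed
  have [measurable]: "H \<in> borel_measurable borel" unfolding H_def by measurable
  have "?I \<le> (\<integral>\<^sup>+z. ennreal (((norm (z :: real^'n))\<^sup>2) powr (- \<beta>)) * indicator {z. (norm z)\<^sup>2 < 1} z
      + ennreal (2 powr \<beta>) * ennreal (1 / (1 + (norm z)\<^sup>2) ^ (2 * k)) \<partial>lborel)"
    by (intro nn_integral_mono le)
  also have "\<dots> = (\<integral>\<^sup>+z. ennreal (((norm (z :: real^'n))\<^sup>2) powr (- \<beta>)) * indicator {z. (norm z)\<^sup>2 < 1} z \<partial>lborel)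
      + ennreal (2 powr \<beta>) * (\<integral>\<^sup>+z. ennreal (1 / (1 + (norm (z :: real^'n))\<^sup>2) ^ (2 * k)) \<partial>lborel)"
    by (subst nn_integral_add) (auto simp: nn_integral_cmult)
  also have "\<dots> < \<infinity>"
    using nn_integral_powr_near_0[OF \<beta>] unfolding nn_integral_bubble[OF N k]
    by (simp add: ennreal_mult_less_top)
  finally have fin: "?I < \<infinity>" .
  define C where "C = enn2real ?I + 1"
  have C: "0 < C" "?I \<le> ennreal C"
  proof -
    show "0 < C" by (simp add: C_def add_nonneg_pos)
    have "?I = ennreal (enn2real ?I)" using fin by simp
    also have "\<dots> \<le> ennreal C" by (intro ennreal_leI) (simp add: C_def)
    finally show "?I \<le> ennreal C" .
  qed
  show thesis
  proof (rule that[OF C(1)])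
    fix r :: real and x :: "real^'n"
    assume r: "0 < r"
    let ?f = "\<lambda>y. r ^ (2 * k) * ((norm (y - x))\<^sup>2) powr (- \<beta>) * (r\<^sup>2 + (norm (y - x))\<^sup>2) powr (\<beta> - 2 * real k)"
    have "(\<integral>\<^sup>+y. ennreal (?f y) \<partial>lborel) = (\<integral>\<^sup>+z. ennreal (r ^ CARD('n)) * ennreal (?f (x + r *\<^sub>R z)) \<partial>lborel)"
      by (rule nn_integral_affine[OF _ r]) measurable
    also have "\<dots> = ?I"
    proof (rule nn_integral_cong)
      fix z :: "real^'n"
      define w where "w = (norm z)\<^sup>2"
      have w: "0 \<le> w" by (simp add: w_def)
      have n: "(norm (x + r *\<^sub>R z - x))\<^sup>2 = r\<^sup>2 * w" using r by (simp add: w_def power_mult_distrib)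
      have "r ^ (2 * k) * ?f (x + r *\<^sub>R z) = r ^ (2 * k) * r ^ (2 * k) * ((r\<^sup>2 * w) powr (- \<beta>) * (r\<^sup>2 * (1 + w)) powr (\<beta> - 2 * real k))"
        unfolding n by (simp add: algebra_simps)
      also have "(r\<^sup>2 * w) powr (- \<beta>) * (r\<^sup>2 * (1 + w)) powr (\<beta> - 2 * real k)
          = ((r\<^sup>2) powr (- \<beta>) * (r\<^sup>2) powr (\<beta> - 2 * real k)) * (w powr (- \<beta>) * (1 + w) powr (\<beta> - 2 * real k))"
        using r w by (simp add: powr_mult)
      also have "(r\<^sup>2) powr (- \<beta>) * (r\<^sup>2) powr (\<beta> - 2 * real k) = inverse ((r\<^sup>2) ^ (2 * k))"
      proof -
        have "(r\<^sup>2) powr (- \<beta>) * (r\<^sup>2) powr (\<beta> - 2 * real k) = (r\<^sup>2) powr (- (2 * real k))"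
          by (simp add: powr_add[symmetric])
        then show ?thesis using r powr_realpow[of "r\<^sup>2" "2 * k"] by (simp add: powr_minus)
      qed
      also have "r ^ (2 * k) * r ^ (2 * k) * (inverse ((r\<^sup>2) ^ (2 * k)) * (w powr (- \<beta>) * (1 + w) powr (\<beta> - 2 * real k))) = H z"
      proof -
        have "r ^ (2 * k) * r ^ (2 * k) = (r\<^sup>2) ^ (2 * k)" by (simp add: power2_eq_square power_mult_distrib)
        then show ?thesis using r by (simp add: H_def w_def)
      qed
      finally show "ennreal (r ^ CARD('n)) * ennreal (?f (x + r *\<^sub>R z)) = ennreal (H z)"
        using r by (simp add: N flip: ennreal_mult')
    qed
    finally show "(\<integral>\<^sup>+y. ennreal (?f y) \<partial>lborel) \<le> ennreal C" using C(2) by simp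
  qed
qed

lemma nn_integral_kern_powr_le:
  fixes \<alpha> :: real
  assumes \<alpha>: "0 < \<alpha>" "\<alpha> < real k"
  obtains C where "0 < C" "\<And>x s. x \<in> ball 0 1 \<Longrightarrow> 0 < s \<Longrightarrow>
    (\<integral>\<^sup>+y. ennreal (kern (x :: real^'n) y powr (2 * real k + s)) \<partial>hyp_vol) \<le> ennreal (C * (s / (exp 1 * \<alpha>)) powr s)"
proof -
  \<comment> \<open>This choice places \<beta> at the midpoint of \<alpha> and k: above \<alpha> to
    leave room for \<eta>, below k for integrability.\<close>
  define \<eta> where "\<eta> = (real k - \<alpha>) / (4 * real k)"
  define \<beta> where "\<beta> = \<alpha> + 2 * real k * \<eta>"
  have \<beta>: "\<beta> = (real k + \<alpha>) / 2" using k by (simp add: \<beta>_def \<eta>_def field_simps)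
  have p: "0 < \<eta>" "\<eta> \<le> 1" "0 < \<beta>" "\<beta> < real k" "\<beta> < 2 * real k"
    using \<alpha> k by (auto simp: \<eta>_def \<beta> field_simps)
  obtain C where C: "0 < C" "\<And>r x. 0 < r \<Longrightarrow>
    (\<integral>\<^sup>+y. ennreal (r ^ (2 * k) * ((norm (y - x :: real^'n))\<^sup>2) powr (- \<beta>) * (r\<^sup>2 + (norm (y - x))\<^sup>2) powr (\<beta> - 2 * real k)) \<partial>lborel)
     \<le> ennreal C"
    using nn_integral_scaled_kernel[OF p(3,4)] by blast
  define A where "A = (8 / \<eta>) ^ (2 * k) * 5 powr (2 * real k - \<beta>)"
  have A: "0 < A" using p by (simp add: A_def)
  show thesis
  proof (rule that)
    show "0 < A * C" using A C(1) by simp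
    fix x :: "real^'n" and s :: real
    assume x: "x \<in> ball 0 1" and s: "0 < s"
    let ?E = "(s / (exp 1 * \<alpha>)) powr s"
    let ?f = "\<lambda>y. rho x ^ (2 * k) * ((norm (y - x))\<^sup>2) powr (- \<beta>) * ((rho x)\<^sup>2 + (norm (y - x))\<^sup>2) powr (\<beta> - 2 * real k)"
    have "(\<integral>\<^sup>+y. ennreal (kern x y powr (2 * real k + s)) \<partial>hyp_vol)
        = (\<integral>\<^sup>+y. ennreal (hyp_density y) * ennreal (kern x y powr (2 * real k + s)) \<partial>lborel)"
      unfolding hyp_vol_eq by (rule nn_integral_density) measurable
    also have "\<dots> \<le> (\<integral>\<^sup>+y. ennreal (?E * A) * ennreal (?f y) \<partial>lborel)"
    proof (rule nn_integral_mono)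
      fix y
      have "kern x y powr (2 * real k + s) * hyp_density y \<le> ?E * (A * ?f y)"
      proof (cases "y \<in> ball 0 1 \<and> x \<noteq> y")
        case True
        then show ?thesis using kern_powr_density_le[OF x _ _ \<alpha>(1) p(1,2) s \<beta>_def p(5), of y] unfolding A_def by blast
      next
        case False
        \<comment> \<open>Off the ball the density is 0; on the diagonal \<open>kern\<close> is 0 by
          division by zero, and the exponent is positive.\<close>
        then have "kern x y powr (2 * real k + s) * hyp_density y = 0" by (auto simp: kern_def hyp_density_def)
        then show ?thesis using A rho_pos[OF x] by (simp only:) (intro mult_nonneg_nonneg; simp)
      qed
      then have "ennreal (hyp_density y * kern x y powr (2 * real k + s)) \<le> ennreal (?E * A * ?f y)"
        by (intro ennreal_leI) (simp add: mult_ac)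
      then show "ennreal (hyp_density y) * ennreal (kern x y powr (2 * real k + s)) \<le> ennreal (?E * A) * ennreal (?f y)"
        using A rho_pos[OF x] hyp_density_nonneg[of y] by (simp add: ennreal_mult'[symmetric] flip: ennreal_mult)
    qed
    also have "\<dots> = ennreal (?E * A) * (\<integral>\<^sup>+y. ennreal (?f y) \<partial>lborel)"
      by (rule nn_integral_cmult) measurable
    also have "\<dots> \<le> ennreal (?E * A) * ennreal C"
      by (intro mult_left_mono C(2) rho_pos x) simp
    also have "\<dots> = ennreal (A * C * ?E)"
      using A C(1) by (simp add: mult_ac flip: ennreal_mult')
    finally show "(\<integral>\<^sup>+y. ennreal (kern x y powr (2 * real k + s)) \<partial>hyp_vol) \<le> ennreal (A * C * ?E)" .
  qed
qed

end

subsection \<open>The representation formula\<close>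

text \<open>The integral of (1 + |z|^2)^(-2k) over R^(2k).\<close>

definition bubble_mass :: "nat \<Rightarrow> real" where
  "bubble_mass k = pi ^ k * fact (k - 1) / fact (2 * k - 1)"

text \<open>The total mass of (-Laplacian)^k applied to -ln (|x|^2 + e), the same for every e >
  0.\<close>

definition kern_const :: "nat \<Rightarrow> real" where
  "kern_const k = 4 ^ k * fact (2 * k - 1) * bubble_mass k"

lemma kern_const_eq: "kern_const k = (4 * pi) ^ k * fact (k - 1)"
  by (simp add: kern_const_def bubble_mass_def power_mult_distrib)

lemma kern_const_pos: "0 < kern_const k"
  by (simp add: kern_const_eq)

text \<open>A majorant uniform in the regularisation \<open>d\<close>. From above the regularised
  kernel is at most \<open>kern\<close>; from below, \<open>kern_den\<close> is at least (1 - |x|)^2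
  while |y - x|^2 + d^2 is at most 4 + 1 = 5, so the loss is a constant depending on x only.\<close>

lemma abs_regularized_kern_le:
  fixes x y :: "real^'n::finite"
  assumes x: "x \<in> ball 0 1" and y: "y \<in> ball 0 1" "x \<noteq> y" and d: "0 \<le> d" "d \<le> 1"
  shows "\<bar>ln (kern_den x y) - ln ((norm (y - x))\<^sup>2 + d\<^sup>2)\<bar> \<le> kern x y + ln (5 / (1 - norm x)\<^sup>2 + 5)"
proof -
  define K where "K = ln (kern_den x y) - ln ((norm (y - x))\<^sup>2 + d\<^sup>2)"
  define D where "D = (norm (y - x))\<^sup>2"
  define Q where "Q = kern_den x y"
  have D: "0 < D" using y(2) by (simp add: D_def)
  have nx: "norm x < 1" "norm y < 1" using x y by auto
  have "norm (y - x) \<le> 2" using nx norm_triangle_ineq4[of y x] by linarith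
  then have "(norm (y - x))\<^sup>2 \<le> 2\<^sup>2" by (intro power_mono) auto
  moreover have "d\<^sup>2 \<le> 1" using d by (simp add: power_le_one)
  ultimately have D5: "D + d\<^sup>2 \<le> 5" by (simp add: D_def)
  have Q1: "(1 - norm x)\<^sup>2 \<le> Q"
  proof -
    have "(1 - norm x)\<^sup>2 \<le> (1 - norm x * norm y)\<^sup>2"
      using nx by (intro power_mono) (auto simp: mult_left_le)
    also have "\<dots> = (norm x)\<^sup>2 - 2 * (norm x * norm y) + (norm y)\<^sup>2 + 4 * rho x * rho y"
    proof -
      have "4 * rho x * rho y = (1 - (norm x)\<^sup>2) * (1 - (norm y)\<^sup>2)" by (simp add: rho_def field_simps)
      then show ?thesis by (simp add: power2_eq_square algebra_simps)
    qed
    also have "\<dots> \<le> Q"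
      using norm_cauchy_schwarz[of x y] unfolding Q_def kern_den_def power2_norm_eq_inner[of "y - x"]
      by (simp add: inner_diff_left inner_diff_right inner_commute power2_norm_eq_inner)
    finally show ?thesis .
  qed
  have x1: "0 < (1 - norm x)\<^sup>2" using nx by simp
  then have Q: "0 < Q" using Q1 by linarith
  have P: "0 < 5 / (1 - norm x)\<^sup>2 + 5" using x1 by (intro add_pos_pos) auto
  have "K \<le> kern x y"
  proof -
    have "ln D \<le> ln (D + d\<^sup>2)"
      by (subst ln_le_cancel_iff) (use D in \<open>auto intro: add_pos_nonneg\<close>)
    then show ?thesis
      unfolding K_def kern_eq[OF x y] by (simp add: D_def)
  qed
  moreover have "- ln (5 / (1 - norm x)\<^sup>2 + 5) \<le> K"
  proof -
    have "D + d\<^sup>2 \<le> Q * (5 / (1 - norm x)\<^sup>2 + 5)"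
    proof -
      have "5 = (1 - norm x)\<^sup>2 * (5 / (1 - norm x)\<^sup>2)" using x1 by simp
      also have "\<dots> \<le> Q * (5 / (1 - norm x)\<^sup>2 + 5)" using Q1 x1 Q by (intro mult_mono) auto
      finally show ?thesis using D5 by simp
    qed
    then have "ln (D + d\<^sup>2) \<le> ln (Q * (5 / (1 - norm x)\<^sup>2 + 5))"
      using D mult_pos_pos[OF Q P] by (subst ln_le_cancel_iff) (auto intro: add_pos_nonneg)
    also have "\<dots> = ln Q + ln (5 / (1 - norm x)\<^sup>2 + 5)"
      using Q P by (simp add: ln_mult)
    finally show ?thesis by (simp add: K_def D_def Q_def)
  qed
  moreover have "0 \<le> ln (5 / (1 - norm x)\<^sup>2 + 5)" using x1 by (intro ln_ge_zero) (simp add: add_increasing)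
  ultimately have "\<bar>K\<bar> \<le> kern x y + ln (5 / (1 - norm x)\<^sup>2 + 5)" using kern_nonneg[OF x y(1)] by linarith
  then show ?thesis by (simp add: K_def)
qed

context
  fixes k :: nat
  assumes N: "CARD('n::finite) = 2 * k" and k: "0 < k"
begin

text \<open>The moment bound is reused with s = 1: \<open>kern\<close> is at most 1 plus its power
  2k + 1, and the hyperbolic density is at least 1 on the ball.\<close>

lemma nn_integral_kern_finite:
  fixes x :: "real^'n"
  obtains C where "0 < C" "\<And>x. x \<in> ball 0 1 \<Longrightarrow>
    (\<integral>\<^sup>+y. ennreal (kern (x :: real^'n) y) * indicator (ball 0 1) y \<partial>lborel) \<le> ennreal C"
proof -
  have "0 < real k / 2" "real k / 2 < real k" using k by auto
  from nn_integral_kern_powr_le[OF N k this] obtain C0 where C0: "0 < C0" "\<And>x s. x \<in> ball 0 1 \<Longrightarrow> 0 < s \<Longrightarrow>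
    (\<integral>\<^sup>+y. ennreal (kern (x :: real^'n) y powr (2 * real k + s)) \<partial>hyp_vol) \<le> ennreal (C0 * (s / (exp 1 * (real k / 2))) powr s)"
    by blast
  define C1 where "C1 = C0 * (1 / (exp 1 * (real k / 2)))"
  have C1: "(\<integral>\<^sup>+y. ennreal (kern (x :: real^'n) y powr (2 * real k + 1)) \<partial>hyp_vol) \<le> ennreal C1" if "x \<in> ball 0 1" for x
    using C0(2)[OF that, of 1] k by (simp add: C1_def)
  have "0 \<le> C1" using C0 by (simp add: C1_def)
  show thesis
  proof (rule that)
    show "0 < unit_ball_vol (2 * real k) + C1" using \<open>0 \<le> C1\<close> by (intro add_pos_nonneg) auto
    fix x :: "real^'n" assume x: "x \<in> ball 0 1"
    have "(\<integral>\<^sup>+y. ennreal (kern x y) * indicator (ball 0 1) y \<partial>lborel)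
        \<le> (\<integral>\<^sup>+y. indicator (ball 0 1) y + ennreal (hyp_density y) * ennreal (kern x y powr (2 * real k + 1)) \<partial>lborel)"
    proof (rule nn_integral_mono)
      fix y :: "real^'n"
      show "ennreal (kern x y) * indicator (ball 0 1) y
        \<le> indicator (ball 0 1) y + ennreal (hyp_density y) * ennreal (kern x y powr (2 * real k + 1))"
      proof (cases "y \<in> ball 0 1")
        case True
        let ?K = "kern x y"
        have K: "0 \<le> ?K" by (rule kern_nonneg[OF x True])
        have "?K \<le> 1 + ?K powr (2 * real k + 1)"
        proof (cases "?K \<le> 1")
          case False
          then have "?K powr 1 \<le> ?K powr (2 * real k + 1)" by (intro powr_mono) auto
          then show ?thesis using False by simp
        qed (simp add: add_increasing2)
        also have "?K powr (2 * real k + 1) \<le> hyp_density y * ?K powr (2 * real k + 1)"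
        proof -
          have "- 1 \<le> (norm y)\<^sup>2" by (rule order_trans[OF _ zero_le_power2]) simp
          then have "rho y \<le> 1" by (simp add: rho_def)
          then have "1 \<le> 1 / rho y" using rho_pos[OF True] by simp
          moreover have "hyp_density y = (1 / rho y) ^ CARD('n)" using True by (simp add: hyp_density_def)
          ultimately have "1 \<le> hyp_density y" using one_le_power by metis
          then show ?thesis using mult_right_mono[of 1 "hyp_density y"] by simp
        qed
        finally have "ennreal ?K \<le> ennreal (1 + hyp_density y * ?K powr (2 * real k + 1))"
          by (intro ennreal_leI) simp
        then show ?thesis using True hyp_density_nonneg[of y] by (simp add: ennreal_plus ennreal_mult)
      qed auto
    qed
    also have "\<dots> = (\<integral>\<^sup>+y. indicator (ball 0 1) y \<partial>(lborel :: (real^'n) measure))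
        + (\<integral>\<^sup>+y. ennreal (hyp_density y) * ennreal (kern x y powr (2 * real k + 1)) \<partial>lborel)"
      by (rule nn_integral_add) (auto intro!: borel_measurable_indicator)
    also have "(\<integral>\<^sup>+y. indicator (ball 0 1) y \<partial>(lborel :: (real^'n) measure)) = ennreal (unit_ball_vol (2 * real k))"
      by (simp add: emeasure_ball N)
    also have "(\<integral>\<^sup>+y. ennreal (hyp_density y) * ennreal (kern x y powr (2 * real k + 1)) \<partial>lborel)
        = (\<integral>\<^sup>+y. ennreal (kern x y powr (2 * real k + 1)) \<partial>hyp_vol)"
      unfolding hyp_vol_eq by (rule nn_integral_density[symmetric]) auto
    also have "ennreal (unit_ball_vol (2 * real k)) + \<dots> \<le> ennreal (unit_ball_vol (2 * real k)) + ennreal C1"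
      by (intro add_left_mono C1 x)
    also have "\<dots> = ennreal (unit_ball_vol (2 * real k) + C1)"
      using \<open>0 \<le> C1\<close> by (simp add: ennreal_plus)
    finally show "(\<integral>\<^sup>+y. ennreal (kern x y) * indicator (ball 0 1) y \<partial>lborel) \<le> ennreal (unit_ball_vol (2 * real k) + C1)" .
  qed
qed

lemma integrable_kern_mult:
  fixes x :: "real^'n"
  assumes x: "x \<in> ball 0 1" and f: "f \<in> borel_measurable borel" "\<And>y. \<bar>f y\<bar> \<le> M" "\<And>y. y \<notin> ball 0 1 \<Longrightarrow> f y = 0"
  shows "integrable lborel (\<lambda>y. kern x y * f y)"
proof (rule integrableI_bounded)
  note [measurable] = f(1)
  show "(\<lambda>y. kern x y * f y) \<in> borel_measurable lborel" by simp
  obtain C where C: "0 < C" "(\<integral>\<^sup>+y. ennreal (kern x y) * indicator (ball 0 1) y \<partial>lborel) \<le> ennreal C"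
    using nn_integral_kern_finite x by metis
  have "0 \<le> M" using f(2)[of 0] by linarith
  have "(\<integral>\<^sup>+y. ennreal (norm (kern x y * f y)) \<partial>lborel) \<le> (\<integral>\<^sup>+y. ennreal M * (ennreal (kern x y) * indicator (ball 0 1) y) \<partial>lborel)"
  proof (rule nn_integral_mono)
    fix y
    show "ennreal (norm (kern x y * f y)) \<le> ennreal M * (ennreal (kern x y) * indicator (ball 0 1) y)"
    proof (cases "y \<in> ball 0 1")
      case True
      then show ?thesis using f(2)[of y] kern_nonneg[OF x True] \<open>0 \<le> M\<close>
        by (simp add: abs_mult ennreal_mult[symmetric] mult.commute[of M] ennreal_leI mult_left_mono)
    qed (simp add: f(3))
  qed
  also have "\<dots> = ennreal M * (\<integral>\<^sup>+y. ennreal (kern x y) * indicator (ball 0 1) y \<partial>lborel)"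
    by (rule nn_integral_cmult) (intro borel_measurable_times_ennreal borel_measurable_indicator; simp)
  also have "\<dots> \<le> ennreal M * ennreal C" by (intro mult_left_mono C(2)) simp
  also have "\<dots> < \<infinity>" by (simp add: ennreal_mult_less_top)
  finally show "(\<integral>\<^sup>+y. ennreal (norm (kern x y * f y)) \<partial>lborel) < \<infinity>" .
qed

lemma integrable_bubble: "integrable lborel (\<lambda>z :: real^'n. 1 / (1 + (norm z)\<^sup>2) ^ (2 * k))"
  using nn_integral_bubble[OF N k] by (intro integrableI_nonneg) auto

lemma integral_bubble: "(\<integral>z. 1 / (1 + (norm (z :: real^'n))\<^sup>2) ^ (2 * k) \<partial>lborel) = bubble_mass k"
  using nn_integral_bubble[OF N k] by (subst integral_eq_nn_integral) (auto simp: bubble_mass_def)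

lemma integral_affine:
  fixes f :: "real^'n \<Rightarrow> real"
  assumes "f \<in> borel_measurable borel" and c: "0 < c"
  shows "(\<integral>y. f y \<partial>lborel) = (\<integral>z. c ^ (2 * k) * f (x + c *\<^sub>R z) \<partial>lborel)"
proof -
  have "(\<integral>y. f y \<partial>lborel) = (\<integral>y. f y \<partial>density (distr lborel borel (\<lambda>z. x + c *\<^sub>R z)) (\<lambda>_. ennreal (\<bar>c\<bar> ^ DIM(real^'n))))"
    using lborel_affine[of c x] c by simp
  also have "\<dots> = (\<integral>z. c ^ (2 * k) * f (x + c *\<^sub>R z) \<partial>lborel)"
    using c assms by (simp add: integral_density integral_distr N)
  finally show ?thesis .
qed

text \<open>The rescaled bubbles form an approximate identity: after the substitution y = x + d z
  the bubble is fixed and only u(x + d z) moves.\<close>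

lemma bubble_tendsto:
  fixes u :: "real^'n \<Rightarrow> real"
  assumes u: "continuous_on UNIV u" "\<And>y. \<bar>u y\<bar> \<le> M"
  shows "(\<lambda>n. \<integral>y. inverse (real (Suc n)) ^ (2 * k) * u y / ((norm (y - x))\<^sup>2 + (inverse (real (Suc n)))\<^sup>2) ^ (2 * k) \<partial>lborel)
    \<longlonglongrightarrow> bubble_mass k * u x"
proof -
  define d where "d n = inverse (real (Suc n))" for n
  have d: "0 < d n" for n by (simp add: d_def)
  have [measurable]: "u \<in> borel_measurable borel" by (rule borel_measurable_continuous_onI[OF u(1)])
  have eq: "(\<integral>y. d n ^ (2 * k) * u y / ((norm (y - x))\<^sup>2 + (d n)\<^sup>2) ^ (2 * k) \<partial>lborel)
      = (\<integral>z. u (x + d n *\<^sub>R z) * (1 / (1 + (norm z)\<^sup>2) ^ (2 * k)) \<partial>lborel)" for n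
  proof -
    have "d n ^ (2 * k) * (d n ^ (2 * k) * u (x + d n *\<^sub>R z) / ((norm (x + d n *\<^sub>R z - x))\<^sup>2 + (d n)\<^sup>2) ^ (2 * k))
        = u (x + d n *\<^sub>R z) * (1 / (1 + (norm z)\<^sup>2) ^ (2 * k))" for z
    proof -
      have "(norm (x + d n *\<^sub>R z - x))\<^sup>2 + (d n)\<^sup>2 = (d n)\<^sup>2 * (1 + (norm z)\<^sup>2)"
        by (simp add: power_mult_distrib algebra_simps)
      moreover have "((d n)\<^sup>2) ^ (2 * k) = d n ^ (2 * k) * d n ^ (2 * k)"
        by (simp add: power2_eq_square power_mult_distrib)
      ultimately show ?thesis using d[of n] by (simp add: power_mult_distrib)
    qed
    then show ?thesis by (subst integral_affine[OF _ d[of n], of _ x]) simp_all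
  qed
  have "(\<lambda>n. \<integral>z. u (x + d n *\<^sub>R z) * (1 / (1 + (norm z)\<^sup>2) ^ (2 * k)) \<partial>lborel)
      \<longlonglongrightarrow> (\<integral>z. u x * (1 / (1 + (norm (z :: real^'n))\<^sup>2) ^ (2 * k)) \<partial>lborel)"
  proof (rule integral_dominated_convergence[where w = "\<lambda>z :: real^'n. M * (1 / (1 + (norm z)\<^sup>2) ^ (2 * k))"])
    show "integrable lborel (\<lambda>z :: real^'n. M * (1 / (1 + (norm z)\<^sup>2) ^ (2 * k)))"
      by (intro integrable_mult_right integrable_bubble)
    have "(\<lambda>n. u (x + d n *\<^sub>R z)) \<longlonglongrightarrow> u x" for z
    proof -
      have "d \<longlonglongrightarrow> 0" unfolding d_def[abs_def] by (rule LIMSEQ_inverse_real_of_nat)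
      then have "(\<lambda>n. x + d n *\<^sub>R z) \<longlonglongrightarrow> x + 0 *\<^sub>R z" by (intro tendsto_intros)
      moreover have "isCont u (x + 0 *\<^sub>R z)" using u(1) by (simp add: continuous_on_eq_continuous_at)
      ultimately have "(\<lambda>n. u (x + d n *\<^sub>R z)) \<longlonglongrightarrow> u (x + 0 *\<^sub>R z)" by (rule isCont_tendsto_compose[rotated])
      then show ?thesis by simp
    qed
    then show "AE z in lborel. (\<lambda>n. u (x + d n *\<^sub>R z) * (1 / (1 + (norm z)\<^sup>2) ^ (2 * k))) \<longlonglongrightarrow> u x * (1 / (1 + (norm z)\<^sup>2) ^ (2 * k))"
      by (intro AE_I2 tendsto_mult_right)
    have *: "0 < (1 + (norm z)\<^sup>2) ^ (2 * k)" for z :: "real^'n" by (intro zero_less_power add_pos_nonneg) auto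
    show "AE z in lborel. norm (u (x + d n *\<^sub>R z) * (1 / (1 + (norm z)\<^sup>2) ^ (2 * k))) \<le> M * (1 / (1 + (norm z)\<^sup>2) ^ (2 * k))" for n
    proof (rule AE_I2)
      fix z :: "real^'n"
      have "norm (u (x + d n *\<^sub>R z) * (1 / (1 + (norm z)\<^sup>2) ^ (2 * k))) = \<bar>u (x + d n *\<^sub>R z)\<bar> * (1 / (1 + (norm z)\<^sup>2) ^ (2 * k))"
        using *[of z] by (simp only: real_norm_def abs_mult abs_of_pos zero_less_divide_1_iff)
      also have "\<dots> \<le> M * (1 / (1 + (norm z)\<^sup>2) ^ (2 * k))"
        using *[of z] u(2) by (intro mult_right_mono) (auto intro: less_imp_le)
      finally show "norm (u (x + d n *\<^sub>R z) * (1 / (1 + (norm z)\<^sup>2) ^ (2 * k))) \<le> M * (1 / (1 + (norm z)\<^sup>2) ^ (2 * k))" .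
    qed
    show "(\<lambda>z. u (x + d n *\<^sub>R z) * (1 / (1 + (norm z)\<^sup>2) ^ (2 * k))) \<in> borel_measurable lborel" for n
    proof -
      have "(\<lambda>z. u (x + d n *\<^sub>R z)) \<in> borel_measurable borel"
        by (intro borel_measurable_continuous_onI continuous_on_compose2[OF u(1)] continuous_intros) auto
      then show ?thesis
        using borel_measurable_integrable[OF integrable_bubble] by (intro borel_measurable_times) auto
    qed
    show "(\<lambda>z. u x * (1 / (1 + (norm (z :: real^'n))\<^sup>2) ^ (2 * k))) \<in> borel_measurable lborel"
      by (intro borel_measurable_integrable integrable_mult_right integrable_bubble)
  qed
  also have "(\<integral>z. u x * (1 / (1 + (norm (z :: real^'n))\<^sup>2) ^ (2 * k)) \<partial>lborel) = bubble_mass k * u x"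
    by (simp only: integral_mult_right_zero integral_bubble) (simp only: mult.commute)
  finally have "(\<lambda>n. \<integral>y. d n ^ (2 * k) * u y / ((norm (y - x))\<^sup>2 + (d n)\<^sup>2) ^ (2 * k) \<partial>lborel) \<longlonglongrightarrow> bubble_mass k * u x"
    unfolding eq .
  then show ?thesis unfolding d_def .
qed

text \<open>Representation formula: \<open>kern\<close> differs from a multiple of the fundamental solution of
  \<open>(- \<Delta>)\<^sup>k\<close> by a polyharmonic function. It is not the Green function of the ball, but unlike the
  Green function it is a power series with nonnegative coefficients in a manifestly positive definite kernel.\<close>

theorem kern_representation:
  fixes u :: "real^'n \<Rightarrow> real"
  assumes u: "u \<in> test_functions" and x: "x \<in> ball 0 1"
  shows "(\<integral>y. kern x y * ((- 1) ^ k * (lap ^^ k) u y) \<partial>lborel) = kern_const k * u x"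
proof -
  let ?B = "ball 0 1 :: (real^'n) set"
  define d where "d n = inverse (real (Suc n))" for n
  have d: "0 < d n" "d n \<le> 1" for n by (auto simp: d_def field_simps)
  define f where "f y = (- 1) ^ k * (lap ^^ k) u y" for y
  have ft: "f \<in> test_functions"
    using test_functions_mult[OF test_functions_lap_pow[OF u, of k] smooth_on_const[of ?B "(- 1) ^ k"]]
    by (simp add: f_def[abs_def] mult.commute)
  obtain M where M: "0 < M" "\<And>y. \<bar>f y\<bar> \<le> M" using test_functions_bounded[OF ft] by blast
  obtain M' where M': "0 < M'" "\<And>y. \<bar>u y\<bar> \<le> M'" using test_functions_bounded[OF u] by blast
  note [measurable] = test_functions_measurable[OF ft] test_functions_measurable[OF u]
  \<comment> \<open>The kernel with its pole smoothed at scale \<open>d n\<close>, so that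
    integration by parts applies on the whole ball. The \<open>kern_den\<close> part is polyharmonic
    and contributes 0; the other part becomes a bubble that concentrates at x.\<close>
  define K where "K n y = ln (kern_den x y) - ln ((norm (y - x))\<^sup>2 + (d n)\<^sup>2)" for n y
  have smQ: "smooth_on ?B (\<lambda>y. ln (kern_den x y))"
  proof -
    have "kern_den x ` ?B \<subseteq> {0<..}" using kern_den_pos[OF x] by auto
    from smooth_on_compose[OF open_ball smooth_on_kern_den[OF open_ball] deriv_seq_ln this, of 0]
    show ?thesis by simp
  qed
  have smS: "smooth_on ?B (\<lambda>y. ln ((norm (y - x))\<^sup>2 + (d n)\<^sup>2))" for n
    using smooth_on_ln_deriv_norm_sq[of "(d n)\<^sup>2" ?B 0 x] d[of n] by simp
  have K: "(\<integral>y. K n y * f y \<partial>lborel) = 4 ^ k * fact (2 * k - 1) *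
      (\<integral>y. d n ^ (2 * k) * u y / ((norm (y - x))\<^sup>2 + (d n)\<^sup>2) ^ (2 * k) \<partial>lborel)" for n
  proof -
    have 1: "(\<integral>y. f y * ln (kern_den x y) \<partial>lborel) = 0"
    proof -
      have "(\<integral>y. f y * ln (kern_den x y) \<partial>lborel) = (- 1) ^ k * (\<integral>y. (lap ^^ k) u y * ln (kern_den x y) \<partial>lborel)"
        by (simp add: f_def mult.assoc)
      also have "(\<integral>y. (lap ^^ k) u y * ln (kern_den x y) \<partial>lborel) = (\<integral>y. u y * (lap ^^ k) (\<lambda>y. ln (kern_den x y)) y \<partial>lborel)"
        by (rule integral_lap_pow_mult[OF u smQ])
      also have "(\<lambda>y. u y * (lap ^^ k) (\<lambda>y. ln (kern_den x y)) y) = (\<lambda>_. 0)"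
      proof
        fix y show "u y * (lap ^^ k) (\<lambda>y. ln (kern_den x y)) y = 0"
          using lap_pow_ln_kern_den[OF N k x, of y] test_functions_eq_0[OF u, of y] by (cases "y \<in> ?B") auto
      qed
      finally show ?thesis by simp
    qed
    have e: "0 < (d n)\<^sup>2" using d[of n] by simp
    have 2: "(\<integral>y. f y * ln ((norm (y - x))\<^sup>2 + (d n)\<^sup>2) \<partial>lborel)
      = - (4 ^ k * fact (2 * k - 1) * (\<integral>y. d n ^ (2 * k) * u y / ((norm (y - x))\<^sup>2 + (d n)\<^sup>2) ^ (2 * k) \<partial>lborel))"
    proof -
      let ?s = "\<lambda>y. (norm (y - x))\<^sup>2 + (d n)\<^sup>2"
      have "(\<integral>y. f y * ln (?s y) \<partial>lborel) = (- 1) ^ k * (\<integral>y. (lap ^^ k) u y * ln (?s y) \<partial>lborel)"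
        by (simp add: f_def mult.assoc)
      also have "(\<integral>y. (lap ^^ k) u y * ln (?s y) \<partial>lborel) = (\<integral>y. u y * (lap ^^ k) (\<lambda>y. ln (?s y)) y \<partial>lborel)"
        by (rule integral_lap_pow_mult[OF u smS])
      also have "(- 1) ^ k * \<dots> = (\<integral>y. u y * ((- 1) ^ k * (lap ^^ k) (\<lambda>y. ln (?s y)) y) \<partial>lborel)"
        by (simp add: mult.left_commute[of _ "(- 1) ^ k"])
      also have "\<dots> = (\<integral>y. - (4 ^ k * fact (2 * k - 1)) * (d n ^ (2 * k) * u y / ?s y ^ (2 * k)) \<partial>lborel)"
        unfolding lap_pow_ln_norm_sq[OF N e k] by (simp add: power_mult_distrib power_mult[symmetric] mult_ac)
      finally show ?thesis by (simp only: integral_mult_right_zero) simp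
    qed
    have "integrable lborel (\<lambda>y. f y * ln (kern_den x y))" "integrable lborel (\<lambda>y. f y * ln ((norm (y - x))\<^sup>2 + (d n)\<^sup>2))"
      by (intro test_functions_integrable test_functions_mult ft smQ smS)+
    moreover have "(\<lambda>y. K n y * f y) = (\<lambda>y. f y * ln (kern_den x y) - f y * ln ((norm (y - x))\<^sup>2 + (d n)\<^sup>2))"
      by (simp add: K_def fun_eq_iff algebra_simps)
    ultimately show ?thesis using 1 2 by simp
  qed
  have "(\<lambda>n. \<integral>y. K n y * f y \<partial>lborel) \<longlonglongrightarrow> 4 ^ k * fact (2 * k - 1) * (bubble_mass k * u x)"
    unfolding K d_def by (intro tendsto_mult_left bubble_tendsto[OF test_functions_continuous[OF u] M'(2)])
  moreover have "(\<lambda>n. \<integral>y. K n y * f y \<partial>lborel) \<longlonglongrightarrow> (\<integral>y. kern x y * f y \<partial>lborel)"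
  proof (rule integral_dominated_convergence[where w = "\<lambda>y. kern x y * \<bar>f y\<bar> + ln (5 / (1 - norm x)\<^sup>2 + 5) * \<bar>f y\<bar>"])
    show "integrable lborel (\<lambda>y. kern x y * \<bar>f y\<bar> + ln (5 / (1 - norm x)\<^sup>2 + 5) * \<bar>f y\<bar>)"
      using M(2) test_functions_eq_0[OF ft] test_functions_integrable[OF ft]
      by (intro Bochner_Integration.integrable_add integrable_kern_mult[OF x, where M = M] integrable_mult_right integrable_abs) auto
    have "(\<lambda>n. K n y * f y) \<longlonglongrightarrow> kern x y * f y" if "y \<noteq> x" for y
    proof (cases "y \<in> ?B")
      case True
      have "d \<longlonglongrightarrow> 0" unfolding d_def[abs_def] by (rule LIMSEQ_inverse_real_of_nat)
      then have "(\<lambda>n. ln ((norm (y - x))\<^sup>2 + (d n)\<^sup>2)) \<longlonglongrightarrow> ln ((norm (y - x))\<^sup>2 + 0\<^sup>2)"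
        by (intro tendsto_ln tendsto_add tendsto_const tendsto_power) (use that in auto)
      then show ?thesis unfolding K_def kern_eq[OF x True that[symmetric]] by (intro tendsto_mult tendsto_diff tendsto_const) simp
    qed (simp add: test_functions_eq_0[OF ft])
    then show "AE y in lborel. (\<lambda>n. K n y * f y) \<longlonglongrightarrow> kern x y * f y"
      using AE_lborel_singleton[of x] by (auto elim: eventually_mono)
    have "\<bar>K n y * f y\<bar> \<le> kern x y * \<bar>f y\<bar> + ln (5 / (1 - norm x)\<^sup>2 + 5) * \<bar>f y\<bar>" if "y \<noteq> x" for n y
    proof (cases "y \<in> ?B")
      case True
      have "\<bar>K n y\<bar> \<le> kern x y + ln (5 / (1 - norm x)\<^sup>2 + 5)"
        unfolding K_def using d[of n] by (intro abs_regularized_kern_le x True that[symmetric]) auto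
      then show ?thesis by (simp add: abs_mult mult_right_mono flip: distrib_right)
    qed (simp add: test_functions_eq_0[OF ft])
    then show "AE y in lborel. norm (K n y * f y) \<le> kern x y * \<bar>f y\<bar> + ln (5 / (1 - norm x)\<^sup>2 + 5) * \<bar>f y\<bar>" for n
      using AE_lborel_singleton[of x] by (auto elim: eventually_mono)
    show "(\<lambda>y. K n y * f y) \<in> borel_measurable lborel" for n
    proof -
      have "(\<lambda>y. K n y) \<in> borel_measurable borel" unfolding K_def kern_den_def by measurable
      then show ?thesis by simp
    qed
  qed simp
  ultimately have "(\<integral>y. kern x y * f y \<partial>lborel) = 4 ^ k * fact (2 * k - 1) * (bubble_mass k * u x)"
    using LIMSEQ_unique by blast
  then show ?thesis by (simp add: f_def kern_const_def)
qed

end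

subsection \<open>Positive semidefinite kernels\<close>

text \<open>The functions on which the quadratic forms are tested. For R < 1 the support stays away
  from the unit sphere, where the hyperbolic density blows up and the Klein vectors reach norm
  1.\<close>

definition bounded_supp :: "real \<Rightarrow> (real^'n::finite \<Rightarrow> real) \<Rightarrow> bool" where
  "bounded_supp R \<phi> \<longleftrightarrow> \<phi> \<in> borel_measurable borel \<and> (\<exists>M. \<forall>x. \<bar>\<phi> x\<bar> \<le> M) \<and> (\<forall>x. x \<notin> cball 0 R \<longrightarrow> \<phi> x = 0)"

lemma bounded_supp_bound: "bounded_supp R \<phi> \<Longrightarrow> \<exists>M. \<forall>x. \<bar>\<phi> x\<bar> \<le> M"
  by (simp add: bounded_supp_def)

lemma bounded_supp_zero: "bounded_supp R \<phi> \<Longrightarrow> x \<notin> cball 0 R \<Longrightarrow> \<phi> x = 0"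
  by (simp add: bounded_supp_def)

lemma bounded_supp_measurable: "bounded_supp R \<phi> \<Longrightarrow> \<phi> \<in> borel_measurable borel"
  by (simp add: bounded_supp_def)

definition kernel_form :: "(real^'n::finite \<Rightarrow> real^'n \<Rightarrow> real) \<Rightarrow> (real^'n \<Rightarrow> real) \<Rightarrow> (real^'n \<Rightarrow> real) \<Rightarrow> real" where
  "kernel_form L \<phi> \<psi> = (\<integral>p. L (fst p) (snd p) * (\<phi> (fst p) * \<psi> (snd p)) \<partial>(lborel \<Otimes>\<^sub>M lborel))"

definition bounded_kernel :: "real \<Rightarrow> (real^'n::finite \<Rightarrow> real^'n \<Rightarrow> real) \<Rightarrow> bool" where
  "bounded_kernel R L \<longleftrightarrow> (\<lambda>p. L (fst p) (snd p)) \<in> borel_measurable (borel \<Otimes>\<^sub>M borel)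
     \<and> (\<exists>M. \<forall>x\<in>cball 0 R. \<forall>y\<in>cball 0 R. \<bar>L x y\<bar> \<le> M)"

text \<open>Positivity is expressed by integral forms rather than by finite matrices: changing a
  kernel on the diagonal then has no effect, and limits are taken by dominated convergence.\<close>

definition psd_kernel :: "real \<Rightarrow> (real^'n::finite \<Rightarrow> real^'n \<Rightarrow> real) \<Rightarrow> bool" where
  "psd_kernel R L \<longleftrightarrow> bounded_kernel R L \<and> (\<forall>\<phi>. bounded_supp R \<phi> \<longrightarrow> 0 \<le> kernel_form L \<phi> \<phi>)"

lemma bounded_kernel_bound: "bounded_kernel R L \<Longrightarrow> \<exists>M. \<forall>x\<in>cball 0 R. \<forall>y\<in>cball 0 R. \<bar>L x y\<bar> \<le> M"
  by (simp add: bounded_kernel_def)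

lemma bounded_kernel_measurable:
  "bounded_kernel R L \<Longrightarrow> (\<lambda>p. L (fst p) (snd p)) \<in> borel_measurable (borel \<Otimes>\<^sub>M borel)"
  by (simp add: bounded_kernel_def)

lemma psd_kernel_bounded: "psd_kernel R L \<Longrightarrow> bounded_kernel R L"
  by (simp add: psd_kernel_def)

lemma kernel_form_measurable:
  assumes "bounded_supp R \<phi>" "bounded_supp R \<psi>" "(\<lambda>p. L (fst p) (snd p)) \<in> borel_measurable (borel \<Otimes>\<^sub>M borel)"
  shows "(\<lambda>p. L (fst p) (snd p) * (\<phi> (fst p) * \<psi> (snd p))) \<in> borel_measurable (lborel \<Otimes>\<^sub>M lborel)"
proof -
  have [measurable]: "\<phi> \<in> borel_measurable borel" "\<psi> \<in> borel_measurable borel"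
    using assms by (auto simp: bounded_supp_def)
  note [measurable] = assms(3)
  have "sets (lborel \<Otimes>\<^sub>M lborel) = sets (borel \<Otimes>\<^sub>M (borel :: (real^'n) measure) :: ((real^'n) \<times> (real^'n)) measure)"
    by (intro sets_pair_measure_cong) auto
  then have "borel_measurable (lborel \<Otimes>\<^sub>M lborel) = (borel_measurable (borel \<Otimes>\<^sub>M borel) :: ((real^'n) \<times> (real^'n) \<Rightarrow> real) set)"
    by (intro measurable_cong_sets) auto
  then show ?thesis by simp
qed

lemma integrable_indicator_cball_prod:
  "integrable (lborel \<Otimes>\<^sub>M lborel) (\<lambda>p. indicator (cball (0 :: real^'n::finite) R \<times> cball (0 :: real^'n) R) p * (M :: real))"
proof -
  have "emeasure (lborel \<Otimes>\<^sub>M lborel) (cball (0 :: real^'n) R \<times> cball (0 :: real^'n) R) = emeasure lborel (cball (0 :: real^'n) R) * emeasure lborel (cball (0 :: real^'n) R)"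
    by (rule lborel.emeasure_pair_measure_Times) auto
  also have "\<dots> < \<infinity>"
    using emeasure_lborel_cball_finite[of "0 :: real^'n" R] by (simp add: ennreal_mult_less_top)
  finally show ?thesis by (intro integrable_mult_left integrable_real_indicator) auto
qed

lemma bounded_kernel_form_integrable:
  fixes \<phi> :: "real^'n::finite \<Rightarrow> real"
  assumes "bounded_supp R \<phi>" "bounded_supp R \<psi>" "bounded_kernel R L"
  shows "integrable (lborel \<Otimes>\<^sub>M lborel) (\<lambda>p. L (fst p) (snd p) * (\<phi> (fst p) * \<psi> (snd p)))"
proof -
  obtain M1 where 1: "\<And>x. \<bar>\<phi> x\<bar> \<le> M1" using bounded_supp_bound[OF assms(1)] by blast
  obtain M2 where 2: "\<And>x. \<bar>\<psi> x\<bar> \<le> M2" using bounded_supp_bound[OF assms(2)] by blast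
  obtain M3 where 3: "\<And>x y. x \<in> cball 0 R \<Longrightarrow> y \<in> cball 0 R \<Longrightarrow> \<bar>L x y\<bar> \<le> M3"
    using assms(3) unfolding bounded_kernel_def by blast
  note M = 1 2 3 and z = bounded_supp_zero[OF assms(1)] bounded_supp_zero[OF assms(2)]
  have b: "\<bar>L x y * (\<phi> x * \<psi> y)\<bar> \<le> indicator (cball 0 R \<times> cball 0 R) (x, y) * (M3 * (M1 * M2))" for x y
  proof (cases "x \<in> cball 0 R \<and> y \<in> cball 0 R")
    case True
    have "\<bar>L x y\<bar> * (\<bar>\<phi> x\<bar> * \<bar>\<psi> y\<bar>) \<le> M3 * (M1 * M2)"
      using True M(1)[of x] M(2)[of y] M(3)[of x y] by (intro mult_mono) auto
    then show ?thesis using True by (simp add: abs_mult)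
  qed (use z in auto)
  show ?thesis
  proof (rule Bochner_Integration.integrable_bound[OF integrable_indicator_cball_prod[of R "M3 * (M1 * M2)"]])
    show "(\<lambda>p. L (fst p) (snd p) * (\<phi> (fst p) * \<psi> (snd p))) \<in> borel_measurable (lborel \<Otimes>\<^sub>M lborel)"
      using assms by (intro kernel_form_measurable) (auto simp: bounded_kernel_def)
    show "AE p in lborel \<Otimes>\<^sub>M lborel. norm (L (fst p) (snd p) * (\<phi> (fst p) * \<psi> (snd p)))
        \<le> norm (indicator (cball 0 R \<times> cball 0 R) p * (M3 * (M1 * M2)))"
    proof (rule AE_I2)
      fix p :: "(real^'n) \<times> (real^'n)"
      show "norm (L (fst p) (snd p) * (\<phi> (fst p) * \<psi> (snd p))) \<le> norm (indicator (cball 0 R \<times> cball 0 R) p * (M3 * (M1 * M2)))"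
        using order_trans[OF b[of "fst p" "snd p"] abs_ge_self] by (simp only: prod.collapse real_norm_def)
    qed
  qed
qed

lemma psd_kernel_one: "psd_kernel R (\<lambda>x y. 1)"
  unfolding psd_kernel_def
proof (intro conjI allI impI)
  show bk: "bounded_kernel R (\<lambda>x y :: real^'n. 1)" by (auto simp: bounded_kernel_def intro!: exI[of _ 1])
  fix \<phi> :: "real^'n \<Rightarrow> real" assume p: "bounded_supp R \<phi>"
  have "integrable (lborel \<Otimes>\<^sub>M lborel) (\<lambda>(x, y). \<phi> x * \<phi> y)"
    using bounded_kernel_form_integrable[OF p p bk] by (simp add: case_prod_beta')
  from lborel_pair.integral_fst'[OF this]
  have "kernel_form (\<lambda>x y. 1) \<phi> \<phi> = (\<integral>x. \<integral>y. \<phi> x * \<phi> y \<partial>lborel \<partial>lborel)"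
    by (simp add: kernel_form_def case_prod_beta')
  also have "\<dots> = (\<integral>x. \<phi> x \<partial>lborel) * (\<integral>x. \<phi> x \<partial>lborel)" by simp
  finally show "0 \<le> kernel_form (\<lambda>x y. 1) \<phi> \<phi>" by simp
qed

text \<open>The weight is absorbed into the test function, \<phi> becoming g \<phi>. Multiplication
  by nonnegative constants and by inner products is built from this case.\<close>

lemma psd_kernel_weight:
  fixes L :: "real^'n::finite \<Rightarrow> real^'n \<Rightarrow> real"
  assumes L: "psd_kernel R L" and g: "g \<in> borel_measurable borel" "\<And>x. x \<in> cball 0 R \<Longrightarrow> \<bar>g x\<bar> \<le> M"
  shows "psd_kernel R (\<lambda>x y. L x y * (g x * g y))"
  unfolding psd_kernel_def
proof (intro conjI allI impI)
  note [measurable] = g(1)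
  obtain M' where M': "\<And>x y. x \<in> cball 0 R \<Longrightarrow> y \<in> cball 0 R \<Longrightarrow> \<bar>L x y\<bar> \<le> M'"
    using bounded_kernel_bound[OF psd_kernel_bounded[OF L]] by blast
  note [measurable] = bounded_kernel_measurable[OF psd_kernel_bounded[OF L]]
  have "\<bar>L x y * (g x * g y)\<bar> \<le> M' * (M * M)" if "x \<in> cball 0 R" "y \<in> cball 0 R" for x y
  proof -
    have "\<bar>L x y\<bar> * (\<bar>g x\<bar> * \<bar>g y\<bar>) \<le> M' * (M * M)"
      using M'[OF that] g(2)[OF that(1)] g(2)[OF that(2)] by (intro mult_mono) auto
    then show ?thesis by (simp add: abs_mult)
  qed
  then show "bounded_kernel R (\<lambda>x y. L x y * (g x * g y))"
    unfolding bounded_kernel_def by (intro conjI exI[of _ "M' * (M * M)"]) auto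
  fix \<phi> :: "real^'n \<Rightarrow> real" assume p: "bounded_supp R \<phi>"
  obtain M2 where M2: "\<And>x. \<bar>\<phi> x\<bar> \<le> M2" using bounded_supp_bound[OF p] by blast
  note z = bounded_supp_zero[OF p] and [measurable] = bounded_supp_measurable[OF p]
  have "\<bar>g x * \<phi> x\<bar> \<le> \<bar>M\<bar> * M2" for x
  proof (cases "x \<in> cball 0 R")
    case True
    then have "\<bar>g x\<bar> * \<bar>\<phi> x\<bar> \<le> \<bar>M\<bar> * M2"
      using g(2)[of x] M2[of x] by (intro mult_mono) auto
    then show ?thesis by (simp add: abs_mult)
  next
    case False
    have "0 \<le> M2" using M2[of 0] by linarith
    then show ?thesis using z[OF False] by simp
  qed
  then have "bounded_supp R (\<lambda>x. g x * \<phi> x)"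
    using z unfolding bounded_supp_def by (auto intro!: exI[of _ "\<bar>M\<bar> * M2"])
  then have "0 \<le> kernel_form L (\<lambda>x. g x * \<phi> x) (\<lambda>x. g x * \<phi> x)" using L by (simp add: psd_kernel_def)
  then show "0 \<le> kernel_form (\<lambda>x y. L x y * (g x * g y)) \<phi> \<phi>"
    by (simp add: kernel_form_def mult_ac)
qed

lemma psd_kernel_add:
  fixes L :: "real^'n::finite \<Rightarrow> real^'n \<Rightarrow> real"
  assumes L: "psd_kernel R L" "psd_kernel R L'"
  shows "psd_kernel R (\<lambda>x y. L x y + L' x y)"
  unfolding psd_kernel_def
proof (intro conjI allI impI)
  obtain M where M1: "\<And>x y. x \<in> cball 0 R \<Longrightarrow> y \<in> cball 0 R \<Longrightarrow> \<bar>L x y\<bar> \<le> M"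
    using bounded_kernel_bound[OF psd_kernel_bounded[OF L(1)]] by blast
  obtain M' where M2: "\<And>x y. x \<in> cball 0 R \<Longrightarrow> y \<in> cball 0 R \<Longrightarrow> \<bar>L' x y\<bar> \<le> M'"
    using bounded_kernel_bound[OF psd_kernel_bounded[OF L(2)]] by blast
  note M = M1 M2 and [measurable] = L[THEN psd_kernel_bounded, THEN bounded_kernel_measurable]
  have "\<bar>L x y + L' x y\<bar> \<le> M + M'" if "x \<in> cball 0 R" "y \<in> cball 0 R" for x y
    using M(1)[OF that] M(2)[OF that] by linarith
  then show "bounded_kernel R (\<lambda>x y. L x y + L' x y)"
    unfolding bounded_kernel_def by (intro conjI exI[of _ "M + M'"]) auto
  fix \<phi> :: "real^'n \<Rightarrow> real" assume p: "bounded_supp R \<phi>"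
  have "kernel_form (\<lambda>x y. L x y + L' x y) \<phi> \<phi> = kernel_form L \<phi> \<phi> + kernel_form L' \<phi> \<phi>"
    unfolding kernel_form_def distrib_right
    using L by (intro Bochner_Integration.integral_add bounded_kernel_form_integrable[OF p p]) (auto simp: psd_kernel_def)
  then show "0 \<le> kernel_form (\<lambda>x y. L x y + L' x y) \<phi> \<phi>" using L p by (simp add: psd_kernel_def)
qed

lemma psd_kernel_zero: "psd_kernel R (\<lambda>x y. 0)"
  using psd_kernel_weight[OF psd_kernel_one, of "\<lambda>_. 0" R 0] by simp

lemma psd_kernel_cmult:
  assumes "psd_kernel R L" "0 \<le> c"
  shows "psd_kernel R (\<lambda>x y. c * L x y)"
proof -
  have "psd_kernel R (\<lambda>x y. L x y * (sqrt c * sqrt c))"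
    by (rule psd_kernel_weight[OF assms(1), where M = "sqrt c"]) (use assms(2) in auto)
  then show ?thesis using assms(2) by (simp add: mult.commute)
qed

lemma psd_kernel_sum:
  assumes "\<And>i. i \<in> A \<Longrightarrow> psd_kernel R (L i)"
  shows "psd_kernel R (\<lambda>x y. \<Sum>i\<in>A. L i x y)"
  using assms by (induction A rule: infinite_finite_induct) (auto intro: psd_kernel_zero psd_kernel_add)

text \<open>The majorant \<open>W\<close> may be unbounded; only its form against |\<phi>| has to be
  integrable. This is what lets \<open>kern\<close>, with its logarithmic diagonal, be a limit of
  bounded kernels.\<close>

lemma kernel_form_limit:
  fixes \<phi> :: "real^'n::finite \<Rightarrow> real"
  assumes p: "bounded_supp R \<phi>"
    and L: "\<And>n. 0 \<le> kernel_form (L n) \<phi> \<phi>" "\<And>n. (\<lambda>p. L n (fst p) (snd p)) \<in> borel_measurable (borel \<Otimes>\<^sub>M borel)"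
      "(\<lambda>p. L' (fst p) (snd p)) \<in> borel_measurable (borel \<Otimes>\<^sub>M borel)"
    and lim: "\<And>x y. x \<in> cball 0 R \<Longrightarrow> y \<in> cball 0 R \<Longrightarrow> (\<lambda>n. L n x y) \<longlonglongrightarrow> L' x y"
    and b: "\<And>n x y. x \<in> cball 0 R \<Longrightarrow> y \<in> cball 0 R \<Longrightarrow> \<bar>L n x y\<bar> \<le> W x y"
    and W: "integrable (lborel \<Otimes>\<^sub>M lborel) (\<lambda>p. W (fst p) (snd p) * (\<bar>\<phi> (fst p)\<bar> * \<bar>\<phi> (snd p)\<bar>))"
  shows "0 \<le> kernel_form L' \<phi> \<phi>"
proof -
  have z: "\<phi> x = 0" if "x \<notin> cball 0 R" for x using p that by (simp add: bounded_supp_def)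
  have "(\<lambda>n. kernel_form (L n) \<phi> \<phi>) \<longlonglongrightarrow> kernel_form L' \<phi> \<phi>"
    unfolding kernel_form_def
  proof (rule integral_dominated_convergence[OF _ _ W])
    show "AE p in lborel \<Otimes>\<^sub>M lborel. (\<lambda>n. L n (fst p) (snd p) * (\<phi> (fst p) * \<phi> (snd p))) \<longlonglongrightarrow> L' (fst p) (snd p) * (\<phi> (fst p) * \<phi> (snd p))"
    proof (rule AE_I2)
      fix p :: "(real^'n) \<times> (real^'n)"
      show "(\<lambda>n. L n (fst p) (snd p) * (\<phi> (fst p) * \<phi> (snd p))) \<longlonglongrightarrow> L' (fst p) (snd p) * (\<phi> (fst p) * \<phi> (snd p))"
      proof (cases "fst p \<in> cball 0 R \<and> snd p \<in> cball 0 R")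
        case True
        then show ?thesis by (intro tendsto_mult_right lim) auto
      next
        case False
        then have "\<phi> (fst p) * \<phi> (snd p) = 0" using z by auto
        then show ?thesis by (simp only: mult_zero_right tendsto_const)
      qed
    qed
    show "AE p in lborel \<Otimes>\<^sub>M lborel. norm (L n (fst p) (snd p) * (\<phi> (fst p) * \<phi> (snd p))) \<le> W (fst p) (snd p) * (\<bar>\<phi> (fst p)\<bar> * \<bar>\<phi> (snd p)\<bar>)" for n
    proof (rule AE_I2)
      fix p :: "(real^'n) \<times> (real^'n)"
      show "norm (L n (fst p) (snd p) * (\<phi> (fst p) * \<phi> (snd p))) \<le> W (fst p) (snd p) * (\<bar>\<phi> (fst p)\<bar> * \<bar>\<phi> (snd p)\<bar>)"
      proof (cases "fst p \<in> cball 0 R \<and> snd p \<in> cball 0 R")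
        case True
        then have "\<bar>L n (fst p) (snd p)\<bar> * (\<bar>\<phi> (fst p)\<bar> * \<bar>\<phi> (snd p)\<bar>) \<le> W (fst p) (snd p) * (\<bar>\<phi> (fst p)\<bar> * \<bar>\<phi> (snd p)\<bar>)"
          by (intro mult_right_mono b) auto
        then show ?thesis by (simp only: real_norm_def abs_mult)
      next
        case False
        then have *: "\<phi> (fst p) * \<phi> (snd p) = 0" "\<bar>\<phi> (fst p)\<bar> * \<bar>\<phi> (snd p)\<bar> = 0" using z by auto
        show ?thesis by (simp only: * mult_zero_right norm_zero order_refl)
      qed
    qed
  qed (intro kernel_form_measurable[OF p p] L)+
  then show ?thesis using L(1) by (intro LIMSEQ_le_const) auto
qed

lemma psd_kernel_limit:
  fixes L' :: "real^'n::finite \<Rightarrow> real^'n \<Rightarrow> real"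
  assumes L: "\<And>n. psd_kernel R (L n)" "(\<lambda>p. L' (fst p) (snd p)) \<in> borel_measurable (borel \<Otimes>\<^sub>M borel)"
    and lim: "\<And>x y. x \<in> cball 0 R \<Longrightarrow> y \<in> cball 0 R \<Longrightarrow> (\<lambda>n. L n x y) \<longlonglongrightarrow> L' x y"
    and b: "\<And>n x y. x \<in> cball 0 R \<Longrightarrow> y \<in> cball 0 R \<Longrightarrow> \<bar>L n x y\<bar> \<le> M"
  shows "psd_kernel R L'"
  unfolding psd_kernel_def
proof (intro conjI allI impI)
  have "\<bar>L' x y\<bar> \<le> M" if "x \<in> cball 0 R" "y \<in> cball 0 R" for x y
    using LIMSEQ_le_const2[OF tendsto_rabs[OF lim[OF that]], of M] b[OF that] by auto
  then show "bounded_kernel R L'" using L(2) unfolding bounded_kernel_def by blast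
  fix \<phi> :: "real^'n \<Rightarrow> real" assume p: "bounded_supp R \<phi>"
  have pa: "bounded_supp R (\<lambda>x. \<bar>\<phi> x\<bar>)" using p unfolding bounded_supp_def by auto
  have bM: "bounded_kernel R (\<lambda>x y :: real^'n. M)" unfolding bounded_kernel_def by auto
  show "0 \<le> kernel_form L' \<phi> \<phi>"
  proof (rule kernel_form_limit[OF p])
    show "0 \<le> kernel_form (L n) \<phi> \<phi>" for n using L(1) p by (simp add: psd_kernel_def)
    show "(\<lambda>p. L n (fst p) (snd p)) \<in> borel_measurable (borel \<Otimes>\<^sub>M borel)" for n
      using L(1) by (simp add: psd_kernel_def bounded_kernel_def)
    show "integrable (lborel \<Otimes>\<^sub>M lborel) (\<lambda>p. M * (\<bar>\<phi> (fst p)\<bar> * \<bar>\<phi> (snd p)\<bar>))"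
      by (rule bounded_kernel_form_integrable[OF pa pa bM])
  qed (use L lim b in auto)
qed

text \<open>The reciprocal of the hyperbolic cosine of the distance from \<open>x\<close> to \<open>y\<close>; in the Klein model, with
  \<open>X = klein x\<close> and \<open>Y = klein y\<close>, it is a weight times the geometric series in \<open>X \<bullet> Y\<close>.\<close>

definition sech_dist :: "real^'n::finite \<Rightarrow> real^'n \<Rightarrow> real" where
  "sech_dist x y = 4 * rho x * rho y / (4 * rho x * rho y + 2 * (norm (y - x))\<^sup>2)"

definition klein :: "real^'n::finite \<Rightarrow> real^'n" where
  "klein x = (2 / (1 + (norm x)\<^sup>2)) *\<^sub>R x"

definition klein_weight :: "real^'n::finite \<Rightarrow> real" where
  "klein_weight x = 2 * rho x / (1 + (norm x)\<^sup>2)"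

text \<open>The norm 2 r / (1 + r^2) of the Klein image increases with r in [0, 1], so the bound is
  its value at R, which is below 1 since (1 - R)^2 > 0. The uniform \<open>m\<close> is the ratio
  control for the geometric series.\<close>

lemma norm_klein_less_1:
  assumes "0 \<le> R" "R < 1"
  obtains m where "0 \<le> m" "m < 1" "\<And>x :: real^'n::finite. x \<in> cball 0 R \<Longrightarrow> norm (klein x) \<le> m"
proof (rule that)
  have pos: "0 < 1 + t\<^sup>2" for t :: real by (simp add: add_pos_nonneg)
  show "0 \<le> 2 * R / (1 + R\<^sup>2)" using assms by simp
  have "0 < (1 - R)\<^sup>2" using assms by simp
  then show "2 * R / (1 + R\<^sup>2) < 1" using pos[of R] by (simp add: power2_eq_square algebra_simps)
  fix x :: "real^'n" assume "x \<in> cball 0 R"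
  then have x: "norm x \<le> R" by simp
  have "0 \<le> (R - norm x) * (1 - R * norm x)"
    using x assms by (intro mult_nonneg_nonneg) (auto intro: mult_le_one)
  then have "2 * norm x / (1 + (norm x)\<^sup>2) \<le> 2 * R / (1 + R\<^sup>2)"
    using pos[of R] pos[of "norm x"] by (simp add: divide_le_eq le_divide_eq power2_eq_square) (simp add: field_simps)
  then show "norm (klein x) \<le> 2 * R / (1 + R\<^sup>2)"
    using pos[of "norm x"] by (simp add: klein_def)
qed

text \<open>The denominator equals (1 + |x|^2) (1 + |y|^2) - 4 x . y; pulling out the product leaves
  1 minus the inner product of the Klein vectors.\<close>

lemma sech_dist_eq:
  assumes "x \<in> ball 0 1" "y \<in> ball 0 1"
  shows "sech_dist x y = klein_weight x * klein_weight y / (1 - klein x \<bullet> klein y)"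
proof -
  have pos: "0 < 1 + (norm z)\<^sup>2" for z :: "real^'n" by (simp add: add_pos_nonneg)
  define a where "a = 1 + (norm x)\<^sup>2"
  define b where "b = 1 + (norm y)\<^sup>2"
  have ab: "0 < a" "0 < b" using pos by (auto simp: a_def b_def)
  have "4 * rho x * rho y + 2 * (norm (y - x))\<^sup>2 = a * b - 4 * (x \<bullet> y)"
    unfolding a_def b_def rho_def power2_norm_eq_inner[of "y - x"]
    by (simp add: inner_diff_left inner_diff_right inner_commute power2_norm_eq_inner field_simps)
  also have "\<dots> = a * b * (1 - klein x \<bullet> klein y)"
    using ab by (simp add: klein_def a_def[symmetric] b_def[symmetric] field_simps)
  finally have 1: "4 * rho x * rho y + 2 * (norm (y - x))\<^sup>2 = a * b * (1 - klein x \<bullet> klein y)" .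
  have 2: "klein_weight x * klein_weight y = 4 * rho x * rho y / (a * b)"
    by (simp add: klein_weight_def a_def b_def)
  show ?thesis unfolding sech_dist_def 1 2 by simp
qed

lemma klein_measurable [measurable]: "(klein :: real^'n::finite \<Rightarrow> real^'n) \<in> borel_measurable borel"
proof -
  have "1 + (norm x)\<^sup>2 \<noteq> 0" for x :: "real^'n" by (metis add_pos_nonneg less_irrefl zero_le_power2 zero_less_one)
  then show ?thesis unfolding klein_def[abs_def] by (intro borel_measurable_continuous_onI continuous_intros) auto
qed

text \<open>The inner product is a sum over coordinates of rank-one weights, each covered by
  \<open>psd_kernel_weight\<close>.\<close>

lemma psd_kernel_klein:
  fixes L :: "real^'n::finite \<Rightarrow> real^'n \<Rightarrow> real"
  assumes L: "psd_kernel R L" and R: "0 \<le> R" "R < 1"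
  shows "psd_kernel R (\<lambda>x y. L x y * (klein x \<bullet> klein y))"
proof -
  obtain m where m: "0 \<le> m" "m < 1" "\<And>x :: real^'n. x \<in> cball 0 R \<Longrightarrow> norm (klein x) \<le> m"
    using norm_klein_less_1[OF R] by blast
  have "psd_kernel R (\<lambda>x y. \<Sum>i\<in>UNIV. L x y * (klein x $ i * klein y $ i))"
  proof (intro psd_kernel_sum psd_kernel_weight[OF L, where M = m])
    show "(\<lambda>x :: real^'n. klein x $ i) \<in> borel_measurable borel" for i
    proof -
      have "(\<lambda>x :: real^'n. x $ i) \<in> borel_measurable borel"
        by (intro borel_measurable_continuous_onI continuous_intros)
      from measurable_compose[OF klein_measurable this] show ?thesis .
    qed
    show "\<bar>klein x $ i\<bar> \<le> m" if "x \<in> cball 0 R" for x :: "real^'n" and i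
      using m(3)[OF that] component_le_norm_cart[of "klein x" i] by linarith
  qed
  then show ?thesis by (simp add: inner_vec_def sum_distrib_left)
qed

lemma sech_dist_measurable [measurable]:
  "(\<lambda>p. sech_dist (fst p) (snd p :: real^'n::finite)) \<in> borel_measurable (borel \<Otimes>\<^sub>M borel)"
  unfolding sech_dist_def by measurable

text \<open>The partial sums of the geometric series in the Klein inner product are psd and converge
  boundedly. Carrying an arbitrary psd factor \<open>L\<close> makes the statement iterate to all
  powers of \<open>sech_dist\<close> without a general product theorem for kernels.\<close>

lemma psd_kernel_sech_dist:
  fixes L :: "real^'n::finite \<Rightarrow> real^'n \<Rightarrow> real"
  assumes L: "psd_kernel R L" and R: "0 \<le> R" "R < 1"
  shows "psd_kernel R (\<lambda>x y. L x y * sech_dist x y)"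
proof -
  obtain m where m: "0 \<le> m" "m < 1" "\<And>x :: real^'n. x \<in> cball 0 R \<Longrightarrow> norm (klein x) \<le> m"
    using norm_klein_less_1[OF R] by blast
  have inball: "x \<in> ball 0 1" if "x \<in> cball 0 R" for x :: "real^'n" using that R by auto
  have w: "\<bar>klein_weight x\<bar> \<le> 1" if "x \<in> cball 0 R" for x :: "real^'n"
  proof -
    have "0 < rho x" using rho_pos inball that by blast
    then show ?thesis by (simp add: klein_weight_def rho_def add_pos_nonneg divide_le_eq)
  qed
  have wm: "(klein_weight :: real^'n \<Rightarrow> real) \<in> borel_measurable borel"
    unfolding klein_weight_def[abs_def] by measurable
  obtain M where M: "\<And>x y. x \<in> cball 0 R \<Longrightarrow> y \<in> cball 0 R \<Longrightarrow> \<bar>L x y\<bar> \<le> M"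
    using bounded_kernel_bound[OF psd_kernel_bounded[OF L]] by blast
  note [measurable] = bounded_kernel_measurable[OF psd_kernel_bounded[OF L]]
  let ?L0 = "\<lambda>x y. L x y * (klein_weight x * klein_weight y)"
  have p0: "psd_kernel R (\<lambda>x y. ?L0 x y * (klein x \<bullet> klein y) ^ j)" for j
  proof (induction j)
    case 0
    then show ?case using psd_kernel_weight[OF L wm w] by simp
  next
    case (Suc j)
    then show ?case using psd_kernel_klein[OF Suc R] by (simp add: mult_ac)
  qed
  have Z: "\<bar>klein x \<bullet> klein y\<bar> \<le> m * m" if "x \<in> cball 0 R" "y \<in> cball 0 R" for x y :: "real^'n"
    using Cauchy_Schwarz_ineq2[of "klein x" "klein y"] mult_mono[OF m(3)[OF that(1)] m(3)[OF that(2)]] m(1) by simp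
  have mm: "m * m < 1" using m(1,2) mult_left_le[of m m] by linarith
  show ?thesis
  proof (rule psd_kernel_limit[where L = "\<lambda>n x y. \<Sum>j<n. ?L0 x y * (klein x \<bullet> klein y) ^ j" and M = "M * (1 / (1 - m * m))"])
    show "psd_kernel R (\<lambda>x y. \<Sum>j<n. ?L0 x y * (klein x \<bullet> klein y) ^ j)" for n
      by (intro psd_kernel_sum p0)
    show "(\<lambda>p. L (fst p) (snd p) * sech_dist (fst p) (snd p)) \<in> borel_measurable (borel \<Otimes>\<^sub>M borel)" by measurable
    fix x y :: "real^'n" assume xy: "x \<in> cball 0 R" "y \<in> cball 0 R"
    let ?Z = "klein x \<bullet> klein y"
    have Z1: "\<bar>?Z\<bar> < 1" using Z[OF xy] mm by linarith
    have "(\<lambda>j. ?L0 x y * ?Z ^ j) sums (?L0 x y * (1 / (1 - ?Z)))"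
      by (intro sums_mult geometric_sums) (use Z1 in simp)
    moreover have "?L0 x y * (1 / (1 - ?Z)) = L x y * sech_dist x y"
      using sech_dist_eq[OF inball[OF xy(1)] inball[OF xy(2)]] by simp
    ultimately show "(\<lambda>n. \<Sum>j<n. ?L0 x y * ?Z ^ j) \<longlonglongrightarrow> L x y * sech_dist x y"
      by (simp add: sums_def)
    fix n
    have "\<bar>\<Sum>j<n. ?L0 x y * ?Z ^ j\<bar> \<le> (\<Sum>j<n. \<bar>?L0 x y * ?Z ^ j\<bar>)" by (rule sum_abs)
    also have "\<dots> \<le> (\<Sum>j<n. M * (m * m) ^ j)"
    proof (rule sum_mono)
      fix j
      have "\<bar>L x y\<bar> * (\<bar>klein_weight x\<bar> * \<bar>klein_weight y\<bar>) * \<bar>?Z\<bar> ^ j \<le> M * (1 * 1) * (m * m) ^ j"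
        using M[OF xy] w[OF xy(1)] w[OF xy(2)] Z[OF xy] by (intro mult_mono power_mono) auto
      then show "\<bar>?L0 x y * ?Z ^ j\<bar> \<le> M * (m * m) ^ j" by (simp add: abs_mult power_abs)
    qed
    also have "\<dots> = M * (\<Sum>j<n. (m * m) ^ j)" by (simp add: sum_distrib_left)
    also have "\<dots> \<le> M * (1 / (1 - m * m))"
    proof (rule mult_left_mono)
      have "(\<Sum>j<n. (m * m) ^ j) \<le> (\<Sum>j. (m * m) ^ j)"
        using m mm by (intro sum_le_suminf summable_geometric) auto
      also have "\<dots> = 1 / (1 - m * m)" using m mm by (intro suminf_geometric) auto
      finally show "(\<Sum>j<n. (m * m) ^ j) \<le> 1 / (1 - m * m)" .
      show "0 \<le> M" using M[OF xy] by linarith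
    qed
    finally show "\<bar>\<Sum>j<n. ?L0 x y * ?Z ^ j\<bar> \<le> M * (1 / (1 - m * m))" .
  qed
qed

lemma psd_kernel_sech_dist_power:
  assumes "0 \<le> R" "R < 1"
  shows "psd_kernel R (\<lambda>x y. sech_dist x y ^ n)"
proof (induction n)
  case (Suc n)
  from psd_kernel_sech_dist[OF this assms] show ?case by (simp add: mult.commute)
qed (simp add: psd_kernel_one)

text \<open>With q = 1 + a the kernel is ln q, and (q - 1) / (q + 1) = a / (a + 2) is
  \<open>sech_dist\<close>; the series is that of ln q in this variable. The nonnegative terms make
  the partial sums increase to \<open>kern\<close>.\<close>

lemma kern_series:
  assumes "x \<in> ball 0 1" "y \<in> ball 0 1" "x \<noteq> y"
  shows "(\<lambda>n. 2 / real (2 * n + 1) * sech_dist x y ^ (2 * n + 1)) sums kern x y" "0 \<le> sech_dist x y"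
proof -
  define a where "a = 4 * rho x * rho y / (norm (y - x))\<^sup>2"
  have D: "0 < (norm (y - x))\<^sup>2" using assms(3) by simp
  have r: "0 < 4 * rho x * rho y" using rho_pos[OF assms(1)] rho_pos[OF assms(2)] by simp
  have a: "0 < a" using D r by (simp add: a_def)
  have "((1 + a) - 1) / ((1 + a) + 1) = sech_dist x y"
    using D r by (simp add: a_def sech_dist_def field_simps)
  then show "(\<lambda>n. 2 / real (2 * n + 1) * sech_dist x y ^ (2 * n + 1)) sums kern x y"
    using ln_series_quadratic[of "1 + a"] a by (simp add: kern_def a_def[symmetric] add_ac)
  show "0 \<le> sech_dist x y" using D r by (simp add: sech_dist_def)
qed

section \<open>Positivity and duality for the logarithmic kernel\<close>

context
  fixes k :: nat
  assumes N: "CARD('n::finite) = 2 * k" and k: "0 < k"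
begin

lemma integrable_kern_form:
  fixes \<phi> \<psi> :: "real^'n \<Rightarrow> real"
  assumes R: "R < 1" and p: "bounded_supp R \<phi>" "bounded_supp R \<psi>"
  shows "integrable (lborel \<Otimes>\<^sub>M lborel) (\<lambda>p. kern (fst p) (snd p) * (\<phi> (fst p) * \<psi> (snd p)))"
proof (rule integrableI_bounded)
  obtain M1 where 1: "\<And>x. \<bar>\<phi> x\<bar> \<le> M1" using bounded_supp_bound[OF p(1)] by blast
  obtain M2 where 2: "\<And>x. \<bar>\<psi> x\<bar> \<le> M2" using bounded_supp_bound[OF p(2)] by blast
  note M = 1 2 and z = bounded_supp_zero[OF p(1)] bounded_supp_zero[OF p(2)]
  have M0: "0 \<le> M1" "0 \<le> M2" using M(1)[of 0] M(2)[of 0] by linarith+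
  have inball: "x \<in> ball 0 1" if "x \<in> cball 0 R" for x :: "real^'n" using that R by auto
  show m: "(\<lambda>p. kern (fst p) (snd p) * (\<phi> (fst p) * \<psi> (snd p))) \<in> borel_measurable (lborel \<Otimes>\<^sub>M lborel)"
    by (intro kernel_form_measurable[OF p] kern_measurable)
  obtain C where C: "0 < C" "\<And>x. x \<in> ball 0 1 \<Longrightarrow> (\<integral>\<^sup>+y. ennreal (kern (x :: real^'n) y) * indicator (ball 0 1) y \<partial>lborel) \<le> ennreal C"
    using nn_integral_kern_finite[OF N k] by blast
  have ind: "(indicator (ball 0 1) :: real^'n \<Rightarrow> ennreal) \<in> borel_measurable borel" by (intro borel_measurable_indicator) simp
  have "(\<integral>\<^sup>+p. ennreal (norm (kern (fst p) (snd p) * (\<phi> (fst p) * \<psi> (snd p)))) \<partial>(lborel \<Otimes>\<^sub>M lborel))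
      = (\<integral>\<^sup>+x. \<integral>\<^sup>+y. ennreal (norm (kern x y * (\<phi> x * \<psi> y))) \<partial>lborel \<partial>lborel)"
    using lborel.nn_integral_fst[of "\<lambda>p. ennreal (norm (kern (fst p) (snd p) * (\<phi> (fst p) * \<psi> (snd p))))" lborel, symmetric] m by simp
  also have "\<dots> \<le> (\<integral>\<^sup>+x. ennreal (M1 * M2 * C) * indicator (cball 0 R) x \<partial>(lborel :: (real^'n) measure))"
  proof (rule nn_integral_mono)
    fix x :: "real^'n"
    show "(\<integral>\<^sup>+y. ennreal (norm (kern x y * (\<phi> x * \<psi> y))) \<partial>lborel) \<le> ennreal (M1 * M2 * C) * indicator (cball 0 R) x"
    proof (cases "x \<in> cball 0 R")
      case True
      have "(\<integral>\<^sup>+y. ennreal (norm (kern x y * (\<phi> x * \<psi> y))) \<partial>lborel)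
          \<le> (\<integral>\<^sup>+y. ennreal (M1 * M2) * (ennreal (kern x y) * indicator (ball 0 1) y) \<partial>lborel)"
      proof (rule nn_integral_mono)
        fix y
        show "ennreal (norm (kern x y * (\<phi> x * \<psi> y))) \<le> ennreal (M1 * M2) * (ennreal (kern x y) * indicator (ball 0 1) y)"
        proof (cases "y \<in> cball 0 R")
          case y: True
          have K: "0 \<le> kern x y" by (intro kern_nonneg inball True y)
          have "\<bar>\<phi> x\<bar> * \<bar>\<psi> y\<bar> * kern x y \<le> M1 * M2 * kern x y"
            using M(1)[of x] M(2)[of y] K M0 by (intro mult_right_mono mult_mono) auto
          then have "norm (kern x y * (\<phi> x * \<psi> y)) \<le> M1 * M2 * kern x y" using K by (simp add: abs_mult mult_ac)
          then have "ennreal (norm (kern x y * (\<phi> x * \<psi> y))) \<le> ennreal (M1 * M2 * kern x y)" by (rule ennreal_leI)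
          then show ?thesis using inball[OF y] K M0 by (simp add: ennreal_mult)
        qed (simp add: z)
      qed
      also have "\<dots> = ennreal (M1 * M2) * (\<integral>\<^sup>+y. ennreal (kern x y) * indicator (ball 0 1) y \<partial>lborel)"
        by (rule nn_integral_cmult) (use ind in \<open>intro borel_measurable_times_ennreal; simp\<close>)
      also have "\<dots> \<le> ennreal (M1 * M2) * ennreal C" by (intro mult_left_mono C(2) inball True) simp
      finally show ?thesis using True M0 C(1) by (simp add: ennreal_mult)
    qed (simp add: z)
  qed
  also have "\<dots> = ennreal (M1 * M2 * C) * emeasure lborel (cball (0 :: real^'n) R)"
    by (rule nn_integral_cmult_indicator) simp
  also have "\<dots> < \<infinity>" using emeasure_lborel_cball_finite[of "0 :: real^'n" R] by (simp add: ennreal_mult_less_top)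
  finally show "(\<integral>\<^sup>+p. ennreal (norm (kern (fst p) (snd p) * (\<phi> (fst p) * \<psi> (snd p)))) \<partial>(lborel \<Otimes>\<^sub>M lborel)) < \<infinity>" .
qed

lemma kern_form_nonneg:
  fixes \<phi> :: "real^'n \<Rightarrow> real"
  assumes R: "0 \<le> R" "R < 1" and p: "bounded_supp R \<phi>"
  shows "0 \<le> kernel_form kern \<phi> \<phi>"
proof -
  \<comment> \<open>The partial sums are set to 0 on the diagonal, because there \<open>kern\<close>
    has the default value 0 while \<open>sech_dist\<close> is 1 inside the ball. The diagonal is a
    null set, so the forms do not change, and now \<open>L n x y\<close> is at most
    \<open>kern x y\<close> everywhere on the support.\<close>
  define L where "L n x y = (\<Sum>j<n. 2 / real (2 * j + 1) * sech_dist x (y :: real^'n) ^ (2 * j + 1)) * (if x = y then 0 else 1)" for n x y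
  have pa: "bounded_supp R (\<lambda>x. \<bar>\<phi> x\<bar>)" using p unfolding bounded_supp_def by auto
  have inball: "x \<in> ball 0 1" if "x \<in> cball 0 R" for x :: "real^'n" using that R by auto
  have psd: "psd_kernel R (\<lambda>x y :: real^'n. \<Sum>j<n. 2 / real (2 * j + 1) * sech_dist x y ^ (2 * j + 1))" for n
    by (intro psd_kernel_sum psd_kernel_cmult psd_kernel_sech_dist_power R) auto
  have "closed {p :: (real^'n) \<times> (real^'n). fst p = snd p}"
    by (intro closed_Collect_eq continuous_intros)
  then have "{p :: (real^'n) \<times> (real^'n). fst p = snd p} \<in> sets (borel \<Otimes>\<^sub>M borel)"
    unfolding borel_prod by (rule borel_closed)
  then have "- {p :: (real^'n) \<times> (real^'n). fst p = snd p} \<in> sets (borel \<Otimes>\<^sub>M borel)"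
    unfolding borel_prod by (rule borel_comp)
  then have diag': "{p :: (real^'n) \<times> (real^'n). fst p \<noteq> snd p} \<in> sets (borel \<Otimes>\<^sub>M borel)"
    by (simp only: Collect_neg_eq)
  have Lm: "(\<lambda>p. if fst p = snd p then 0 else 1 :: real) \<in> borel_measurable (borel \<Otimes>\<^sub>M (borel :: (real^'n) measure))"
    using borel_measurable_indicator[OF diag'] by (simp add: indicator_def if_distrib cong: if_cong)
  show ?thesis
  proof (rule kernel_form_limit[OF p, where L = L])
    show meas: "(\<lambda>p. L n (fst p) (snd p)) \<in> borel_measurable (borel \<Otimes>\<^sub>M borel)" for n
      unfolding L_def using bounded_kernel_measurable[OF psd_kernel_bounded[OF psd[of n]]]
      by (intro borel_measurable_times Lm)
    show "0 \<le> kernel_form (L n) \<phi> \<phi>" for n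
    proof -
      let ?L = "\<lambda>x y :: real^'n. \<Sum>j<n. 2 / real (2 * j + 1) * sech_dist x y ^ (2 * j + 1)"
      have "kernel_form (L n) \<phi> \<phi> = kernel_form ?L \<phi> \<phi>"
        unfolding kernel_form_def
      proof (rule integral_cong_AE)
        have bk: "bounded_kernel R ?L" using psd by (simp add: psd_kernel_def)
        show "(\<lambda>pa. L n (fst pa) (snd pa) * (\<phi> (fst pa) * \<phi> (snd pa))) \<in> borel_measurable (lborel \<Otimes>\<^sub>M lborel)"
          by (intro kernel_form_measurable[OF p p] meas)
        show "(\<lambda>pa. ?L (fst pa) (snd pa) * (\<phi> (fst pa) * \<phi> (snd pa))) \<in> borel_measurable (lborel \<Otimes>\<^sub>M lborel)"
          using bk by (intro kernel_form_measurable[OF p p, of ?L]) (simp add: bounded_kernel_def)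
        have "AE x in lborel. AE y in lborel. (x :: real^'n) \<noteq> y"
          using AE_lborel_singleton by (auto simp: eq_commute)
        then have "AE p in lborel \<Otimes>\<^sub>M lborel. fst p \<noteq> (snd p :: real^'n)"
          by (subst lborel_pair.AE_pair_iff[symmetric]) (use diag' in \<open>auto simp: space_pair_measure\<close>)
        then show "AE pa in lborel \<Otimes>\<^sub>M lborel. L n (fst pa) (snd pa) * (\<phi> (fst pa) * \<phi> (snd pa)) = ?L (fst pa) (snd pa) * (\<phi> (fst pa) * \<phi> (snd pa))"
          by eventually_elim (simp add: L_def)
      qed
      then show ?thesis using psd[of n] p by (simp add: psd_kernel_def)
    qed
    fix x y :: "real^'n" assume xy: "x \<in> cball 0 R" "y \<in> cball 0 R"
    note xy' = inball[OF xy(1)] inball[OF xy(2)]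
    show "(\<lambda>n. L n x y) \<longlonglongrightarrow> kern x y"
      using kern_series(1)[OF xy'] by (cases "x = y") (auto simp: L_def sums_def kern_def)
    show "\<bar>L n x y\<bar> \<le> kern x y" for n
    proof (cases "x = y")
      case False
      note s = kern_series[OF xy' False]
      have nn: "0 \<le> 2 / real (2 * j + 1) * sech_dist x y ^ (2 * j + 1)" for j using s(2) by simp
      have "L n x y \<le> kern x y"
      proof -
        have "(\<Sum>j<n. 2 / real (2 * j + 1) * sech_dist x y ^ (2 * j + 1)) \<le> (\<Sum>j. 2 / real (2 * j + 1) * sech_dist x y ^ (2 * j + 1))"
          by (rule sum_le_suminf[OF sums_summable[OF s(1)]]) (use nn in auto)
        then show ?thesis unfolding sums_unique[OF s(1), symmetric] using False by (simp add: L_def)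
      qed
      moreover have "0 \<le> L n x y" using nn False unfolding L_def by (intro mult_nonneg_nonneg sum_nonneg nn) auto
      ultimately show ?thesis by simp
    qed (simp add: L_def kern_def)
  qed (intro kern_measurable integrable_kern_form[OF R(2) pa pa])+
qed

lemma kern_form_representation:
  fixes u h :: "real^'n \<Rightarrow> real"
  assumes R: "R < 1" and u: "u \<in> test_functions" and h: "bounded_supp R h"
    and f: "bounded_supp R (\<lambda>y. (- 1) ^ k * (lap ^^ k) u y)"
  shows "kernel_form kern h (\<lambda>y. (- 1) ^ k * (lap ^^ k) u y) = kern_const k * (\<integral>x. h x * u x \<partial>lborel)"
    "kernel_form kern (\<lambda>y. (- 1) ^ k * (lap ^^ k) u y) h = kern_const k * (\<integral>x. h x * u x \<partial>lborel)"
proof -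
  let ?f = "\<lambda>y. (- 1) ^ k * (lap ^^ k) u y"
  have rep: "h x * (\<integral>y. kern x y * ?f y \<partial>lborel) = kern_const k * (h x * u x)" for x
  proof (cases "x \<in> cball 0 R")
    case True
    then have "x \<in> ball 0 1" using R by auto
    from kern_representation[OF N k u this] show ?thesis by simp
  qed (use h in \<open>simp add: bounded_supp_def\<close>)
  have "integrable (lborel \<Otimes>\<^sub>M lborel) (\<lambda>(x, y). kern x y * (h x * ?f y))"
    using integrable_kern_form[OF R h f] by (simp add: case_prod_beta')
  from lborel_pair.integral_fst'[OF this]
  have "kernel_form kern h ?f = (\<integral>x. \<integral>y. kern x y * (h x * ?f y) \<partial>lborel \<partial>lborel)"
    by (simp add: kernel_form_def case_prod_beta')
  also have "\<dots> = (\<integral>x. h x * (\<integral>y. kern x y * ?f y \<partial>lborel) \<partial>lborel)"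
    by (simp only: mult.left_commute[of "kern _ _"] integral_mult_right_zero)
  finally show "kernel_form kern h ?f = kern_const k * (\<integral>x. h x * u x \<partial>lborel)"
    unfolding rep by (simp only: integral_mult_right_zero)
  have "integrable (lborel \<Otimes>\<^sub>M lborel) (\<lambda>(x, y). kern x y * (?f x * h y))"
    using integrable_kern_form[OF R f h] by (simp add: case_prod_beta')
  from lborel_pair.integral_snd[OF this]
  have "kernel_form kern ?f h = (\<integral>y. \<integral>x. kern x y * (?f x * h y) \<partial>lborel \<partial>lborel)"
    by (simp add: kernel_form_def case_prod_beta')
  also have "\<dots> = (\<integral>y. h y * (\<integral>x. kern y x * ?f x \<partial>lborel) \<partial>lborel)"
  proof (rule Bochner_Integration.integral_cong[OF refl])
    fix y
    have "(\<lambda>x. kern x y * (?f x * h y)) = (\<lambda>x. h y * (kern y x * ?f x))"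
      by (simp add: fun_eq_iff kern_commute[of _ y] mult_ac)
    then show "(\<integral>x. kern x y * (?f x * h y) \<partial>lborel) = h y * (\<integral>x. kern y x * ?f x \<partial>lborel)"
      by (simp only: integral_mult_right_zero)
  qed
  finally show "kernel_form kern ?f h = kern_const k * (\<integral>x. h x * u x \<partial>lborel)"
    unfolding rep by (simp only: integral_mult_right_zero)
qed

text \<open>Cauchy--Schwarz for the positive semidefinite form with kernel \<open>kern\<close>, whose value at
  \<open>(- \<Delta>)\<^sup>k u\<close> is the energy of \<open>u\<close>.\<close>

lemma energy_duality:
  fixes u h :: "real^'n \<Rightarrow> real"
  assumes R: "0 \<le> R" "R < 1" and u: "u \<in> test_functions" and h: "bounded_supp R h"
    and f: "bounded_supp R (\<lambda>y. (- 1) ^ k * (lap ^^ k) u y)"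
  shows "kern_const k * (\<integral>x. h x * u x \<partial>lborel)\<^sup>2 \<le> kernel_form kern h h * gjms_norm_sq k u"
    and "0 \<le> gjms_norm_sq k u"
proof -
  let ?f = "\<lambda>y. (- 1) ^ k * (lap ^^ k) u y"
  let ?c = "kern_const k"
  let ?I = "\<integral>x. h x * u x \<partial>lborel"
  have E: "kernel_form kern ?f ?f = ?c * gjms_norm_sq k u"
    using kern_form_representation(1)[OF R(2) u f f] by (simp add: gjms_norm_sq_eq[OF N u])
  have "0 \<le> kernel_form kern ?f ?f" by (rule kern_form_nonneg[OF R f])
  then show E0: "0 \<le> gjms_norm_sq k u" unfolding E using kern_const_pos[of k] by (simp add: zero_le_mult_iff)
  \<comment> \<open>The form at h - t f, with f the k-th power of the negative Laplacian applied to
    u, as a quadratic polynomial in t.\<close>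
  have q: "0 \<le> kernel_form kern h h - 2 * t * (?c * ?I) + t\<^sup>2 * (?c * gjms_norm_sq k u)" for t
  proof -
    let ?g = "\<lambda>x. h x - t * ?f x"
    obtain M1 where M1: "\<And>x. \<bar>h x\<bar> \<le> M1" using bounded_supp_bound[OF h] by blast
    obtain M2 where M2: "\<And>x. \<bar>?f x\<bar> \<le> M2" using bounded_supp_bound[OF f] by blast
    note M = M1 M2
    have "\<bar>?g x\<bar> \<le> M1 + \<bar>t\<bar> * M2" for x
    proof -
      have "\<bar>t * ?f x\<bar> \<le> \<bar>t\<bar> * M2" using M(2)[of x] by (simp only: abs_mult[of t]) (intro mult_left_mono; simp)
      then show ?thesis using M(1)[of x] abs_triangle_ineq4[of "h x" "t * ?f x"] by linarith
    qed
    moreover have "?g \<in> borel_measurable borel"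
      by (intro borel_measurable_diff borel_measurable_times[OF borel_measurable_const] bounded_supp_measurable[OF h] bounded_supp_measurable[OF f])
    moreover have "?g x = 0" if "x \<notin> cball 0 R" for x
      by (simp only: bounded_supp_zero[OF h that] bounded_supp_zero[OF f that] mult_zero_right diff_0_right)
    ultimately have g: "bounded_supp R ?g" unfolding bounded_supp_def by blast
    note int = integrable_kern_form[OF R(2)]
    have "kernel_form kern ?g ?g = kernel_form kern h h - t * kernel_form kern h ?f - t * kernel_form kern ?f h + t\<^sup>2 * kernel_form kern ?f ?f"
    proof -
      have "kernel_form kern ?g ?g = (\<integral>p. kern (fst p) (snd p) * (h (fst p) * h (snd p)) - t * (kern (fst p) (snd p) * (h (fst p) * ?f (snd p)))
         - t * (kern (fst p) (snd p) * (?f (fst p) * h (snd p))) + t\<^sup>2 * (kern (fst p) (snd p) * (?f (fst p) * ?f (snd p))) \<partial>(lborel \<Otimes>\<^sub>M lborel))"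
        unfolding kernel_form_def by (intro Bochner_Integration.integral_cong refl) (simp add: algebra_simps power2_eq_square)
      then show ?thesis
        unfolding kernel_form_def using int[OF h h] int[OF h f] int[OF f h] int[OF f f]
        by (simp only: Bochner_Integration.integral_add Bochner_Integration.integral_diff Bochner_Integration.integrable_add
            Bochner_Integration.integrable_diff integrable_mult_right integral_mult_right_zero)
    qed
    moreover have "0 \<le> kernel_form kern ?g ?g" by (rule kern_form_nonneg[OF R g])
    ultimately show ?thesis
      unfolding kern_form_representation[OF R(2) u h f] E by simp
  qed
  have c: "0 < ?c" by (rule kern_const_pos)
  show "?c * ?I\<^sup>2 \<le> kernel_form kern h h * gjms_norm_sq k u"
  proof (cases "gjms_norm_sq k u = 0")
    case True
    have "?I = 0"
    proof (rule ccontr)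
      assume "?I \<noteq> 0"
      then have "?c * ?I \<noteq> 0" using c by simp
      \<comment> \<open>With zero energy the polynomial is affine in t; this t gives it the value
        -1.\<close>
      then show False using q[of "(kernel_form kern h h + 1) / (2 * (?c * ?I))"] True by (simp add: field_simps)
    qed
    then show ?thesis using True by simp
  next
    case False
    then have E1: "0 < gjms_norm_sq k u" using E0 by simp
    define G where "G = gjms_norm_sq k u"
    \<comment> \<open>The minimiser t = I / G of the quadratic.\<close>
    have "0 \<le> kernel_form kern h h - 2 * (?I / G) * (?c * ?I) + (?I / G)\<^sup>2 * (?c * G)"
      unfolding G_def by (rule q)
    also have "\<dots> = kernel_form kern h h - ?c * ?I\<^sup>2 / G"
      using E1 by (simp add: G_def[symmetric] power2_eq_square field_simps)
    finally show ?thesis using E1 by (simp add: G_def[symmetric] divide_le_eq)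
  qed
qed

end

subsection \<open>The lower bound\<close>

text \<open>Young's inequality with exponents 2/p and 1 - 2/p separates K^(p/2) from the powers of a
  and b, and a^(p/2) b^(p/2) is split symmetrically for the Schur test. The free weight T / M is
  chosen so that after integration the three terms contribute T^2 / p, T^2 / p and (1 - 2/p) T^2,
  with total exactly T^2.\<close>

lemma weighted_product_le:
  fixes K a b p M T :: real
  assumes "0 \<le> K" "0 \<le> a" "0 \<le> b" "0 < M" "0 < T" "2 < p"
  shows "K * (a powr (p - 1) * b powr (p - 1)) \<le> (M / T) powr (2 / p)
    * (T / M / p * (K powr (p / 2) * a powr p) + T / M / p * (K powr (p / 2) * b powr p) + (1 - 2 / p) * (a powr p * b powr p))"
proof (cases "K = 0 \<or> a = 0 \<or> b = 0")
  case True
  then show ?thesis using assms by (auto intro!: mult_nonneg_nonneg add_nonneg_nonneg)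
next
  case False
  then have pos: "0 < K" "0 < a" "0 < b" using assms by auto
  define t where "t = T / M"
  define W where "W = t * (K powr (p / 2) * (a powr (p / 2) * b powr (p / 2)))"
  define Z where "Z = a powr p * b powr p"
  have t: "0 < t" using assms by (simp add: t_def)
  have WZ: "0 < W" "0 < Z" using pos t by (auto simp: W_def Z_def)
  have "W powr (2 / p) * Z powr (1 - 2 / p) \<le> 2 / p * W + (1 - 2 / p) * Z"
    using assms WZ by (intro Youngs_inequality_0) auto
  moreover have "W powr (2 / p) = t powr (2 / p) * (K * (a * b))"
    using pos assms t by (simp add: W_def powr_mult powr_powr)
  moreover have "Z powr (1 - 2 / p) = a powr (p - 2) * b powr (p - 2)"
    using pos assms by (simp add: Z_def powr_mult powr_powr right_diff_distrib)
  moreover have "a powr (p - 1) = a * a powr (p - 2)" "b powr (p - 1) = b * b powr (p - 2)"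
    using pos powr_add[of a 1 "p - 2"] powr_add[of b 1 "p - 2"] by auto
  ultimately have 1: "t powr (2 / p) * (K * (a powr (p - 1) * b powr (p - 1))) \<le> 2 / p * W + (1 - 2 / p) * Z"
    by (simp add: mult_ac)
  have "2 * (a powr (p / 2) * b powr (p / 2)) \<le> (a powr (p / 2))\<^sup>2 + (b powr (p / 2))\<^sup>2"
    using sum_squares_bound[of "a powr (p / 2)" "b powr (p / 2)"] by simp
  also have "\<dots> = a powr p + b powr p"
    using pos by (simp add: power2_eq_square powr_add[symmetric])
  finally have "t / p * K powr (p / 2) * (2 * (a powr (p / 2) * b powr (p / 2))) \<le> t / p * K powr (p / 2) * (a powr p + b powr p)"
    using assms t by (intro mult_left_mono) auto
  then have "2 / p * W \<le> t / p * (K powr (p / 2) * a powr p) + t / p * (K powr (p / 2) * b powr p)"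
    by (simp add: W_def algebra_simps add_divide_distrib)
  with 1 have "t powr (2 / p) * (K * (a powr (p - 1) * b powr (p - 1)))
      \<le> t / p * (K powr (p / 2) * a powr p) + t / p * (K powr (p / 2) * b powr p) + (1 - 2 / p) * Z"
    by linarith
  then have "(M / T) powr (2 / p) * (t powr (2 / p) * (K * (a powr (p - 1) * b powr (p - 1))))
      \<le> (M / T) powr (2 / p) * (t / p * (K powr (p / 2) * a powr p) + t / p * (K powr (p / 2) * b powr p) + (1 - 2 / p) * Z)"
    by (intro mult_left_mono) auto
  moreover have "(M / T) powr (2 / p) * t powr (2 / p) = 1"
    using assms by (simp add: t_def powr_mult[symmetric])
  ultimately show ?thesis unfolding Z_def t_def[symmetric] by (simp only: mult.assoc[symmetric] mult_1)
qed

section \<open>Test functions and integrals of their powers\<close>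

lemma test_functions_cball:
  fixes u :: "real^'n::finite \<Rightarrow> real"
  assumes "u \<in> test_functions"
  obtains R where "0 \<le> R" "R < 1" "\<And>x. x \<notin> cball 0 R \<Longrightarrow> u x = 0"
proof -
  let ?K = "closure {x. u x \<noteq> 0}"
  have K: "compact ?K" "?K \<subseteq> ball 0 1" using assms unfolding test_functions_def by blast+
  have K0: "u x = 0" if "x \<notin> ?K" for x
  proof (rule ccontr)
    assume "u x \<noteq> 0"
    then have "x \<in> {x. u x \<noteq> 0}" by simp
    then have "x \<in> ?K" by (rule subsetD[OF closure_subset])
    with that show False by contradiction
  qed
  show thesis
  proof (cases "?K = {}")
    case True
    show thesis
    proof (rule that[of 0])
      show "u x = 0" for x by (rule K0) (simp only: True empty_iff not_False_eq_True)
    qed auto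
  next
    case False
    obtain z where z: "z \<in> ?K" "\<forall>y\<in>?K. norm y \<le> norm z"
      using continuous_attains_sup[OF K(1) False continuous_on_norm_id] by (elim bexE)
    show thesis
    proof (rule that[of "norm z"])
      have "z \<in> ball 0 1" by (rule subsetD[OF K(2) z(1)])
      then show "norm z < 1" by simp
      fix x :: "real^'n" assume x: "x \<notin> cball 0 (norm z)"
      show "u x = 0"
      proof (rule K0)
        show "x \<notin> ?K"
        proof
          assume "x \<in> ?K"
          with z(2) have "norm x \<le> norm z" by (rule bspec)
          with x show False by simp
        qed
      qed
    qed simp
  qed
qed

lemma lap_pow_zero: "(lap ^^ j) (\<lambda>_. 0) = (\<lambda>_. 0)"
proof (induction j)
  case (Suc j)
  have "lap (\<lambda>_ :: real^'a. 0) = (\<lambda>_. 0)" by (simp add: lap_def fun_eq_iff)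
  then show ?case using Suc by simp
qed simp

lemma lap_pow_eq_0:
  fixes u :: "real^'n::finite \<Rightarrow> real"
  assumes "\<And>x. x \<notin> cball 0 R \<Longrightarrow> u x = 0" "x \<notin> cball 0 R"
  shows "(lap ^^ j) u x = 0"
proof -
  have "open (- cball 0 R :: (real^'n) set)" by (simp add: open_Compl)
  from lap_pow_cong[OF this, of x u "\<lambda>_. 0" j] show ?thesis using assms by (simp add: lap_pow_zero)
qed

lemma bounded_supp_integrable:
  fixes \<phi> :: "real^'n::finite \<Rightarrow> real"
  assumes p: "bounded_supp R \<phi>"
  shows "integrable lborel \<phi>"
proof -
  obtain M where M: "\<And>x. \<bar>\<phi> x\<bar> \<le> M" using bounded_supp_bound[OF p] by blast
  have "integrable lborel (\<lambda>x :: real^'n. indicator (cball 0 R) x * M)"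
    using emeasure_lborel_cball_finite[of "0 :: real^'n" R]
    by (intro integrable_mult_left integrable_real_indicator) auto
  then show ?thesis
  proof (rule Bochner_Integration.integrable_bound)
    show "\<phi> \<in> borel_measurable lborel" using bounded_supp_measurable[OF p] by simp
    show "AE x in lborel. norm (\<phi> x) \<le> norm (indicator (cball 0 R) x * M)"
    proof (rule AE_I2)
      fix x show "norm (\<phi> x) \<le> norm (indicator (cball 0 R) x * M)"
        using order_trans[OF M[of x] abs_ge_self] bounded_supp_zero[OF p, of x] by (cases "x \<in> cball 0 R") auto
    qed
  qed
qed

lemma bounded_supp_hyp_density:
  fixes \<phi> :: "real^'n::finite \<Rightarrow> real"
  assumes R: "0 \<le> R" "R < 1" and "bounded_supp R \<phi>"
  shows "bounded_supp R (\<lambda>x. hyp_density x * \<phi> x)"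
proof -
  note [measurable] = bounded_supp_measurable[OF assms(3)]
  obtain B where B: "\<And>x. \<bar>\<phi> x\<bar> \<le> B" using bounded_supp_bound[OF assms(3)] by blast
  have R2: "R\<^sup>2 < 1" using R by (simp add: power_less_one_iff)
  have B0: "0 \<le> B" using B[of 0] by linarith
  have "\<bar>hyp_density x * \<phi> x\<bar> \<le> (2 / (1 - R\<^sup>2)) ^ CARD('n) * B" for x
  proof (cases "x \<in> cball 0 R")
    case True
    then have x: "x \<in> ball 0 1" using R by auto
    have "(norm x)\<^sup>2 \<le> R\<^sup>2" using True by (intro power_mono) auto
    then have "1 / rho x \<le> 2 / (1 - R\<^sup>2)" using R2 by (simp add: rho_def frac_le)
    then have "hyp_density x \<le> (2 / (1 - R\<^sup>2)) ^ CARD('n)"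
      using rho_pos[OF x] unfolding hyp_density_def by (simp only: x indicator_simps mult_1) (intro power_mono; simp)
    then show ?thesis unfolding abs_mult using B R2 hyp_density_nonneg[of x] by (intro mult_mono) auto
  qed (use R2 B0 bounded_supp_zero[OF assms(3)] in simp)
  moreover have "(\<lambda>x. hyp_density x * \<phi> x) \<in> borel_measurable borel" by measurable
  moreover have "hyp_density x * \<phi> x = 0" if "x \<notin> cball 0 R" for x
    by (simp only: bounded_supp_zero[OF assms(3) that] mult_zero_right)
  ultimately show ?thesis unfolding bounded_supp_def by blast
qed

lemma bounded_supp_powr:
  assumes "bounded_supp R \<phi>" "0 < a"
  shows "bounded_supp R (\<lambda>x. \<bar>\<phi> x\<bar> powr a)" "bounded_supp R (\<lambda>x. \<bar>\<phi> x\<bar> powr a * sgn (\<phi> x))"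
proof -
  note [measurable] = bounded_supp_measurable[OF assms(1)]
  obtain B where B: "\<And>x. \<bar>\<phi> x\<bar> \<le> B" using bounded_supp_bound[OF assms(1)] by blast
  have 1: "\<bar>\<phi> x\<bar> powr a \<le> B powr a" for x using B assms(2) by (intro powr_mono2) auto
  have 2: "\<bar>\<bar>\<phi> x\<bar> powr a * sgn (\<phi> x)\<bar> \<le> B powr a" for x using 1[of x] by (cases "\<phi> x = 0") (auto simp: abs_mult abs_sgn_eq)
  have 0: "\<phi> x = 0" if "x \<notin> cball 0 R" for x by (rule bounded_supp_zero[OF assms(1) that])
  have "(\<lambda>x. \<bar>\<phi> x\<bar> powr a) \<in> borel_measurable borel" "(\<lambda>x. \<bar>\<phi> x\<bar> powr a * sgn (\<phi> x)) \<in> borel_measurable borel"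
    by measurable
  then show "bounded_supp R (\<lambda>x. \<bar>\<phi> x\<bar> powr a)" "bounded_supp R (\<lambda>x. \<bar>\<phi> x\<bar> powr a * sgn (\<phi> x))"
    unfolding bounded_supp_def using 1 2 by (auto simp: 0 intro!: exI[of _ "B powr a"])
qed

lemma bounded_supp_test_function:
  assumes "u \<in> test_functions" "\<And>x. x \<notin> cball 0 R \<Longrightarrow> u x = 0"
  shows "bounded_supp R u"
proof -
  obtain B where "\<And>x. \<bar>u x\<bar> \<le> B" using test_functions_bounded[OF assms(1)] by blast
  then show ?thesis unfolding bounded_supp_def using test_functions_measurable[OF assms(1)] assms(2) by blast
qed

lemma integrable_powr_hyp_density:
  fixes u :: "real^'n::finite \<Rightarrow> real"
  assumes u: "u \<in> test_functions" and p: "0 < p"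
  shows "integrable lborel (\<lambda>x. hyp_density x * \<bar>u x\<bar> powr p)"
proof -
  obtain R where R: "0 \<le> R" "R < 1" "\<And>x. x \<notin> cball 0 R \<Longrightarrow> u x = 0"
    by (rule test_functions_cball[OF u], rule that)
  show ?thesis
    by (rule bounded_supp_integrable[OF bounded_supp_hyp_density[OF R(1,2)
        bounded_supp_powr(1)[OF bounded_supp_test_function[OF u R(3)] p]]])
qed

text \<open>A vanishing integral would make the open set where u is nonzero negligible, hence
  empty.\<close>

lemma integral_powr_hyp_vol_pos:
  fixes u :: "real^'n::finite \<Rightarrow> real"
  assumes u: "u \<in> test_functions" "u \<noteq> (\<lambda>_. 0)" and p: "0 < p"
    and int: "integrable lborel (\<lambda>x. hyp_density x * \<bar>u x\<bar> powr p)"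
  shows "0 < (\<integral>x. hyp_density x * \<bar>u x\<bar> powr p \<partial>lborel)"
proof -
  have nn: "0 \<le> hyp_density x * \<bar>u x\<bar> powr p" for x
    by (rule mult_nonneg_nonneg[OF hyp_density_nonneg powr_ge_zero])
  have "(\<integral>x. hyp_density x * \<bar>u x\<bar> powr p \<partial>lborel) \<noteq> 0"
  proof
    assume "(\<integral>x. hyp_density x * \<bar>u x\<bar> powr p \<partial>lborel) = 0"
    then have "AE x in lborel. hyp_density x * \<bar>u x\<bar> powr p = 0"
      using integral_nonneg_eq_0_iff_AE[OF int] nn by simp
    moreover have "u x = 0" if "hyp_density x * \<bar>u x\<bar> powr p = 0" for x
      using that rho_pos[of x] test_functions_eq_0[OF u(1), of x] by (cases "x \<in> ball 0 1") (auto simp: hyp_density_def)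
    ultimately have "AE x in lborel. u x = 0" by (auto elim: eventually_mono)
    moreover have op: "open {x. u x \<noteq> 0}"
      using test_functions_continuous[OF u(1)] by (intro open_Collect_neq continuous_on_const) auto
    ultimately have "{x. u x \<noteq> 0} \<in> null_sets lborel"
      by (subst (asm) AE_iff_null_sets[symmetric, where N = "{x. u x \<noteq> 0}"] AE_iff_null)
        (auto simp: null_sets_def)
    then have "negligible {x. u x \<noteq> 0}"
      by (simp add: negligible_iff_null_sets null_sets_completionI)
    then have "{x. u x \<noteq> 0} = {}" using op open_not_negligible by blast
    then show False using u(2) by auto
  qed
  moreover have "0 \<le> (\<integral>x. hyp_density x * \<bar>u x\<bar> powr p \<partial>lborel)" by (intro Bochner_Integration.integral_nonneg nn)
  ultimately show ?thesis by linarith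
qed

context
  fixes k :: nat
  assumes N: "CARD('n::finite) = 2 * k" and k: "0 < k"
begin

text \<open>Here T is the integral of |u|^p and M bounds the kernel moments uniformly in x. The
  pointwise inequality reduces the form to two Schur integrals, each at most M T, and a product
  integral equal to T^2.\<close>

lemma kern_form_powr_le:
  fixes u :: "real^'n \<Rightarrow> real"
  assumes u [measurable]: "u \<in> borel_measurable borel" and p: "2 < p" and M: "0 < M" and T: "0 < T" and R: "R < 1"
    and KM: "\<And>x :: real^'n. x \<in> ball 0 1 \<Longrightarrow> (\<integral>\<^sup>+y. ennreal (kern x y powr (p / 2)) \<partial>hyp_vol) \<le> ennreal M"
    and uT: "(\<integral>\<^sup>+x. ennreal (hyp_density x * \<bar>u x\<bar> powr p) \<partial>lborel) = ennreal T"
    and h: "bounded_supp R h" "\<And>x. \<bar>h x\<bar> = hyp_density x * \<bar>u x\<bar> powr (p - 1)"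
  shows "kernel_form kern h h \<le> (M / T) powr (2 / p) * T\<^sup>2"
proof -
  let ?P = "lborel \<Otimes>\<^sub>M (lborel :: (real^'n) measure)"
  let ?K = "\<lambda>q. kern (fst q) (snd q) * (h (fst q) * h (snd q))"
  define g where "g x = hyp_density x * \<bar>u x\<bar> powr p" for x
  define A where "A = (M / T) powr (2 / p)"
  define a b where "a = A * (T / M / p)" and "b = A * (1 - 2 / p)"
  define G where "G x y = hyp_density y * kern x y powr (p / 2) * g x" for x y :: "real^'n"
  note D0 = hyp_density_nonneg
  have g0: "0 \<le> g x" and G0: "0 \<le> G x y" for x y
    unfolding g_def G_def by (intro mult_nonneg_nonneg D0 powr_ge_zero)+
  have A0: "0 \<le> A" "0 \<le> a" "0 \<le> b" using p M T by (auto simp: A_def a_def b_def)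
  have [measurable]: "g \<in> borel_measurable borel" unfolding g_def by measurable
  have gT: "(\<integral>\<^sup>+x. ennreal (g x) \<partial>lborel) = ennreal T" using uT by (simp add: g_def)
  have sets_eq: "borel_measurable ?P = (borel_measurable (borel \<Otimes>\<^sub>M borel) :: ((real^'n) \<times> (real^'n) \<Rightarrow> ennreal) set)"
    by (intro measurable_cong_sets sets_pair_measure_cong) auto
  have G': "G y x = hyp_density x * kern x y powr (p / 2) * g y" for x y by (simp add: G_def kern_commute)
  have m: "(\<lambda>q. ennreal (G (fst q) (snd q))) \<in> borel_measurable ?P"
    "(\<lambda>q. ennreal (g (fst q) * g (snd q))) \<in> borel_measurable ?P"
    unfolding sets_eq G_def by measurable
  have m': "(\<lambda>q. ennreal (G (snd q) (fst q))) \<in> borel_measurable ?P"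
    unfolding sets_eq G' by measurable
  \<comment> \<open>Integrating over the variable that does not occur in \<open>g\<close> leaves the
    moment bound M; the mirrored term \<open>I2\<close> is the same iterated integral by Tonelli in
    the other order.\<close>
  have G1: "(\<integral>\<^sup>+x. \<integral>\<^sup>+y. ennreal (G x y) \<partial>lborel \<partial>lborel) \<le> ennreal (M * T)"
  proof -
    have "(\<integral>\<^sup>+y. ennreal (G x y) \<partial>lborel) \<le> ennreal M * ennreal (g x)" for x
    proof (cases "x \<in> ball 0 1")
      case True
      have "(\<integral>\<^sup>+y. ennreal (G x y) \<partial>lborel) = (\<integral>\<^sup>+y. ennreal (hyp_density y) * ennreal (kern x y powr (p / 2)) * ennreal (g x) \<partial>lborel)"
        unfolding G_def by (simp add: ennreal_mult D0 g0)
      also have "\<dots> = (\<integral>\<^sup>+y. ennreal (kern x y powr (p / 2)) \<partial>hyp_vol) * ennreal (g x)"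
        unfolding hyp_vol_eq by (subst nn_integral_density) (measurable, rule nn_integral_multc, measurable)
      also have "\<dots> \<le> ennreal M * ennreal (g x)" by (intro mult_right_mono KM True) simp
      finally show ?thesis .
    qed (simp add: G_def g_def hyp_density_def)
    then have "(\<integral>\<^sup>+x. \<integral>\<^sup>+y. ennreal (G x y) \<partial>lborel \<partial>lborel) \<le> (\<integral>\<^sup>+x. ennreal M * ennreal (g x) \<partial>lborel)"
      by (rule nn_integral_mono)
    then show ?thesis using M T by (simp add: nn_integral_cmult gT ennreal_mult)
  qed
  have I1: "(\<integral>\<^sup>+q. ennreal (G (fst q) (snd q)) \<partial>?P) \<le> ennreal (M * T)"
    using G1 lborel.nn_integral_fst[OF m(1)] by simp
  have I2: "(\<integral>\<^sup>+q. ennreal (G (snd q) (fst q)) \<partial>?P) \<le> ennreal (M * T)"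
    using G1 lborel_pair.nn_integral_snd[of "\<lambda>q. ennreal (G (snd q) (fst q))"] m' by simp
  have I3: "(\<integral>\<^sup>+q. ennreal (g (fst q) * g (snd q)) \<partial>?P) = ennreal (T * T)"
    using lborel.nn_integral_fst[OF m(2), symmetric] g0 T
    by (simp add: ennreal_mult nn_integral_cmult nn_integral_multc gT)
  have hk: "integrable ?P ?K" by (rule integrable_kern_form[OF N k R h(1) h(1)])
  have le: "\<bar>kern x y * (h x * h y)\<bar> \<le> a * G x y + (a * G y x + b * (g x * g y))" for x y
  proof (cases "x \<in> ball 0 1 \<and> y \<in> ball 0 1")
    case True
    let ?a = "\<bar>u x\<bar>" and ?b = "\<bar>u y\<bar>" and ?D = "hyp_density x * hyp_density y" and ?k = "kern x y"
    have K: "0 \<le> ?k" using True by (intro kern_nonneg) auto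
    have "\<bar>?k * (h x * h y)\<bar> = ?D * (?k * (?a powr (p - 1) * ?b powr (p - 1)))"
      using K by (simp add: abs_mult h(2))
    also have "\<dots> \<le> ?D * (A * (T / M / p * (?k powr (p / 2) * ?a powr p) + T / M / p * (?k powr (p / 2) * ?b powr p)
        + (1 - 2 / p) * (?a powr p * ?b powr p)))"
      unfolding A_def using K M T p by (intro mult_left_mono weighted_product_le mult_nonneg_nonneg D0) auto
    also have "\<dots> = a * G x y + (a * G y x + b * (g x * g y))"
      unfolding G_def g_def a_def b_def kern_commute[of y x] by (simp only: distrib_left mult_ac add_ac)
    finally show ?thesis .
  next
    case False
    then have "\<bar>h x\<bar> * \<bar>h y\<bar> = 0" unfolding h(2) by (auto simp: hyp_density_def)
    then have "\<bar>kern x y * (h x * h y)\<bar> = 0" by simp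
    then show ?thesis by (simp only:) (intro add_nonneg_nonneg mult_nonneg_nonneg A0 G0 g0)
  qed
  have "ennreal (\<integral>q. \<bar>?K q\<bar> \<partial>?P) = (\<integral>\<^sup>+q. ennreal \<bar>?K q\<bar> \<partial>?P)"
    using integrable_abs[OF hk] by (intro nn_integral_eq_integral[symmetric]) auto
  also have "\<dots> \<le> (\<integral>\<^sup>+q. ennreal a * ennreal (G (fst q) (snd q))
      + (ennreal a * ennreal (G (snd q) (fst q)) + ennreal b * ennreal (g (fst q) * g (snd q))) \<partial>?P)"
    by (intro nn_integral_mono order_trans[OF ennreal_leI[OF le]])
      (simp only: ennreal_mult ennreal_plus mult_nonneg_nonneg add_nonneg_nonneg A0 G0 g0 order_refl)
  also have "\<dots> = ennreal a * (\<integral>\<^sup>+q. ennreal (G (fst q) (snd q)) \<partial>?P)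
      + (ennreal a * (\<integral>\<^sup>+q. ennreal (G (snd q) (fst q)) \<partial>?P) + ennreal b * (\<integral>\<^sup>+q. ennreal (g (fst q) * g (snd q)) \<partial>?P))"
    using m m' by (simp only: nn_integral_add nn_integral_cmult borel_measurable_add borel_measurable_times_ennreal borel_measurable_const)
  also have "\<dots> \<le> ennreal a * ennreal (M * T) + (ennreal a * ennreal (M * T) + ennreal b * ennreal (T * T))"
    unfolding I3 by (intro add_mono mult_left_mono I1 I2) auto
  also have "\<dots> = ennreal (a * (M * T) + (a * (M * T) + b * (T * T)))"
    using A0 less_imp_le[OF M] less_imp_le[OF T]
    by (simp only: ennreal_mult ennreal_plus mult_nonneg_nonneg add_nonneg_nonneg)
  \<comment> \<open>The weights add up: 1/p + 1/p + (1 - 2/p) = 1.\<close>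
  also have "a * (M * T) + (a * (M * T) + b * (T * T)) = A * T\<^sup>2"
    using M p by (simp add: a_def b_def field_simps power2_eq_square)
  finally have "(\<integral>q. \<bar>?K q\<bar> \<partial>?P) \<le> A * T\<^sup>2"
    by (subst (asm) ennreal_le_iff) (auto simp: A_def)
  moreover have "kernel_form kern h h \<le> (\<integral>q. \<bar>?K q\<bar> \<partial>?P)"
    unfolding kernel_form_def using hk by (intro integral_mono integrable_abs) auto
  ultimately show ?thesis by (simp add: A_def)
qed

text \<open>Against the chosen h the pairing with u is T itself, so duality reads c T^2 <=
  (M/T)^(2/p) T^2 times the energy. The factor T^2 cancels and T^(-2/p) moves to the left as the
  squared norm.\<close>

lemma sobolev_inequality:
  fixes u :: "real^'n \<Rightarrow> real"
  assumes u: "u \<in> test_functions" "u \<noteq> (\<lambda>_. 0)" and p: "2 < p" and M: "0 < M"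
    and KM: "\<And>x :: real^'n. x \<in> ball 0 1 \<Longrightarrow> (\<integral>\<^sup>+y. ennreal (kern x y powr (p / 2)) \<partial>hyp_vol) \<le> ennreal M"
  shows "0 < (\<integral>x. \<bar>u x\<bar> powr p \<partial>hyp_vol)"
    and "kern_const k * (\<integral>x. \<bar>u x\<bar> powr p \<partial>hyp_vol) powr (2 / p) \<le> M powr (2 / p) * gjms_norm_sq k u"
proof -
  define T where "T = (\<integral>x. hyp_density x * \<bar>u x\<bar> powr p \<partial>lborel)"
  note um [measurable] = test_functions_measurable[OF u(1)]
  have TT: "(\<integral>x. \<bar>u x\<bar> powr p \<partial>hyp_vol) = T"
    unfolding T_def by (rule integral_hyp_vol) measurable
  have int: "integrable lborel (\<lambda>x. hyp_density x * \<bar>u x\<bar> powr p)"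
    using integrable_powr_hyp_density[OF u(1)] p by simp
  have T: "0 < T" unfolding T_def using u p int by (intro integral_powr_hyp_vol_pos) auto
  then show "0 < (\<integral>x. \<bar>u x\<bar> powr p \<partial>hyp_vol)" by (simp add: TT)
  have uT: "(\<integral>\<^sup>+x. ennreal (hyp_density x * \<bar>u x\<bar> powr p) \<partial>lborel) = ennreal T"
    unfolding T_def by (intro nn_integral_eq_integral int AE_I2 mult_nonneg_nonneg hyp_density_nonneg powr_ge_zero)
  obtain R where R: "0 \<le> R" "R < 1" "\<And>x. x \<notin> cball 0 R \<Longrightarrow> u x = 0"
    by (rule test_functions_cball[OF u(1)], rule that)
  have ft: "(\<lambda>y. (lap ^^ k) u y * (- 1) ^ k) \<in> test_functions"
    by (intro test_functions_mult test_functions_lap_pow u smooth_on_const open_ball)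
  have f: "bounded_supp R (\<lambda>y. (- 1) ^ k * (lap ^^ k) u y)"
  proof -
    have "(lap ^^ k) u x * (- 1) ^ k = 0" if "x \<notin> cball 0 R" for x using lap_pow_eq_0[OF R(3) that] by simp
    from bounded_supp_test_function[OF ft this] show ?thesis by (simp add: mult.commute)
  qed
  define h where "h x = hyp_density x * (\<bar>u x\<bar> powr (p - 1) * sgn (u x))" for x
  have habs: "\<bar>h x\<bar> = hyp_density x * \<bar>u x\<bar> powr (p - 1)" for x
    using hyp_density_nonneg[of x] by (cases "u x = 0") (auto simp: h_def abs_mult abs_sgn_eq)
  have hu: "h x * u x = hyp_density x * \<bar>u x\<bar> powr p" for x
  proof -
    have "\<bar>u x\<bar> powr p = \<bar>u x\<bar> powr (p - 1) * \<bar>u x\<bar>"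
      using powr_add[of "\<bar>u x\<bar>" "p - 1" 1] by simp
    then show ?thesis by (simp add: h_def mult.assoc sgn_mult_self_eq[symmetric] abs_sgn mult_ac)
  qed
  have h: "bounded_supp R h"
    unfolding h_def[abs_def] using bounded_supp_test_function[OF u(1) R(3)] p
    by (intro bounded_supp_hyp_density R bounded_supp_powr(2)) auto
  define A where "A = (M / T) powr (2 / p)"
  have dual: "kern_const k * T\<^sup>2 \<le> kernel_form kern h h * gjms_norm_sq k u" and E0: "0 \<le> gjms_norm_sq k u"
    using energy_duality[OF N k R(1,2) u(1) h f] by (simp_all add: hu T_def)
  have "kernel_form kern h h \<le> A * T\<^sup>2"
    unfolding A_def by (rule kern_form_powr_le[OF um p M T R(2) KM uT h habs])
  then have "kern_const k * T\<^sup>2 \<le> A * T\<^sup>2 * gjms_norm_sq k u"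
    using dual mult_right_mono[OF _ E0] by (meson order_trans)
  then have "T\<^sup>2 * kern_const k \<le> T\<^sup>2 * (A * gjms_norm_sq k u)" by (simp add: mult_ac)
  then have "kern_const k \<le> A * gjms_norm_sq k u" using T by (simp only: mult_le_cancel_left_pos zero_less_power)
  then have "kern_const k * T powr (2 / p) \<le> A * gjms_norm_sq k u * T powr (2 / p)" by (intro mult_right_mono) auto
  also have "\<dots> = M powr (2 / p) * gjms_norm_sq k u" using M T by (simp add: A_def powr_divide)
  finally show "kern_const k * (\<integral>x. \<bar>u x\<bar> powr p \<partial>hyp_vol) powr (2 / p) \<le> M powr (2 / p) * gjms_norm_sq k u"
    by (simp add: TT)
qed

text \<open>The moment order p/2 is written as 2k + s; the condition p > 4k says s > 0. The constant
  C depends on \<alpha> but neither on p nor on u.\<close>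

lemma sobolev_quotient_lower:
  fixes \<alpha> :: real
  assumes \<alpha>: "0 < \<alpha>" "\<alpha> < real k"
  obtains C where "0 < C" "\<And>p u. 4 * real k < p \<Longrightarrow> u \<in> (test_functions :: (real^'n \<Rightarrow> real) set) - {\<lambda>_. 0} \<Longrightarrow>
    kern_const k * (C * ((p / 2 - 2 * real k) / (exp 1 * \<alpha>)) powr (p / 2 - 2 * real k)) powr (- (2 / p))
      \<le> gjms_norm_sq k u / (\<integral>x. \<bar>u x\<bar> powr p \<partial>hyp_vol) powr (2 / p)"
proof -
  obtain C where C: "0 < C" "\<And>x s. x \<in> ball 0 1 \<Longrightarrow> 0 < s \<Longrightarrow>
    (\<integral>\<^sup>+y. ennreal (kern (x :: real^'n) y powr (2 * real k + s)) \<partial>hyp_vol) \<le> ennreal (C * (s / (exp 1 * \<alpha>)) powr s)"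
    using nn_integral_kern_powr_le[OF N k \<alpha>] by blast
  show thesis
  proof (rule that[OF C(1)])
    fix p :: real and u :: "real^'n \<Rightarrow> real"
    assume p: "4 * real k < p" and u: "u \<in> test_functions - {\<lambda>_. 0}"
    define s where "s = p / 2 - 2 * real k"
    define M where "M = C * (s / (exp 1 * \<alpha>)) powr s"
    have s: "0 < s" using p by (simp add: s_def)
    have M: "0 < M" using C(1) s \<alpha> by (simp add: M_def)
    have "1 \<le> real k" using k by simp
    then have p2: "2 < p" using p by linarith
    have KM: "(\<integral>\<^sup>+y. ennreal (kern x y powr (p / 2)) \<partial>hyp_vol) \<le> ennreal M" if "x \<in> ball 0 1" for x :: "real^'n"
      using C(2)[OF that s] by (simp add: M_def s_def)
    have u': "u \<in> test_functions" "u \<noteq> (\<lambda>_. 0)" using u by auto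
    note * = sobolev_inequality[OF u' p2 M KM]
    let ?T = "\<integral>x. \<bar>u x\<bar> powr p \<partial>hyp_vol"
    have Tp: "0 < ?T powr (2 / p)" using *(1) by simp
    have "kern_const k * ?T powr (2 / p) / M powr (2 / p) \<le> gjms_norm_sq k u"
      using *(2) M by (simp add: divide_le_eq mult.commute)
    then have "kern_const k * M powr (- (2 / p)) * ?T powr (2 / p) \<le> gjms_norm_sq k u"
      by (simp add: powr_minus divide_inverse mult_ac)
    then show "kern_const k * (C * ((p / 2 - 2 * real k) / (exp 1 * \<alpha>)) powr (p / 2 - 2 * real k)) powr (- (2 / p))
      \<le> gjms_norm_sq k u / ?T powr (2 / p)"
      using Tp unfolding M_def s_def by (subst le_divide_eq) simp
  qed
qed

text \<open>With s = p/2 - 2k the exponent 2 s / p tends to 1 and s^(4k/p) tends to 1, so the powers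
  of s behave like 2/p, while C^(-2/p) tends to 1.\<close>

lemma lower_bound_tendsto:
  fixes C \<alpha> :: real
  assumes "0 < C" "0 < \<alpha>"
  shows "((\<lambda>p. p * (kern_const k * (C * ((p / 2 - 2 * real k) / (exp 1 * \<alpha>)) powr (p / 2 - 2 * real k)) powr (- (2 / p))))
    \<longlongrightarrow> kern_const k * (2 * \<alpha> * exp 1)) at_top"
proof -
  define c where "c = kern_const k"
  define K where "K = real k"
  define b where "b = exp 1 * \<alpha>"
  have c: "0 < c" "0 < K" "0 < b" using kern_const_pos k assms by (auto simp: c_def K_def b_def)
  have "((\<lambda>p. p * (c * (C * ((p / 2 - 2 * K) / b) powr (p / 2 - 2 * K)) powr (- (2 / p)))) \<longlongrightarrow> c * (2 * b)) at_top"
    using c assms(1) by real_asymp (simp add: exp_minus inverse_eq_divide)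
  moreover have "c * (2 * b) = kern_const k * (2 * \<alpha> * exp 1)"
    by (simp add: c_def b_def)
  ultimately show ?thesis unfolding c_def K_def b_def by (simp only:)
qed

end

subsection \<open>Smooth functions of one variable\<close>

text \<open>Existence of m derivatives without formulas for them, which is easily seen to pass to
  products and reciprocals. \<open>deriv_seq_exists\<close> turns it back into an explicit
  derivative sequence.\<close>

primrec times_diff :: "nat \<Rightarrow> real set \<Rightarrow> (real \<Rightarrow> real) \<Rightarrow> bool" where
  "times_diff 0 S f \<longleftrightarrow> True"
| "times_diff (Suc m) S f \<longleftrightarrow> (\<exists>f'. (\<forall>x\<in>S. (f has_real_derivative f' x) (at x)) \<and> times_diff m S f')"

lemma times_diff_cong:
  assumes "open S" "\<And>x. x \<in> S \<Longrightarrow> f x = g x" "times_diff m S f"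
  shows "times_diff m S g"
proof (cases m)
  case (Suc m')
  then obtain f' where f': "\<And>x. x \<in> S \<Longrightarrow> (f has_real_derivative f' x) (at x)" "times_diff m' S f'"
    using assms(3) by auto
  have "(g has_real_derivative f' x) (at x)" if "x \<in> S" for x
    by (rule has_field_derivative_transform_within_open[OF f'(1)[OF that] assms(1) that]) (rule assms(2))
  then show ?thesis using f'(2) Suc by auto
qed auto

lemma times_diff_SucD: "times_diff (Suc m) S f \<Longrightarrow> times_diff m S f"
proof (induction m arbitrary: f)
  case (Suc m)
  then obtain f' where f': "\<forall>x\<in>S. (f has_real_derivative f' x) (at x)" "times_diff (Suc m) S f'"
    by (auto simp del: times_diff.simps simp: times_diff.simps(2)[of "Suc m"])
  then show ?case using Suc.IH by auto
qed simp

lemma times_diff_add: "times_diff m S f \<Longrightarrow> times_diff m S g \<Longrightarrow> times_diff m S (\<lambda>x. f x + g x)"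
proof (induction m arbitrary: f g)
  case (Suc m)
  then obtain f' g' where "\<forall>x\<in>S. (f has_real_derivative f' x) (at x)" "times_diff m S f'"
    "\<forall>x\<in>S. (g has_real_derivative g' x) (at x)" "times_diff m S g'" by auto
  then show ?case using Suc.IH[of f' g'] by (auto intro!: exI[of _ "\<lambda>x. f' x + g' x"] DERIV_add)
qed simp

lemma times_diff_mult: "times_diff m S f \<Longrightarrow> times_diff m S g \<Longrightarrow> times_diff m S (\<lambda>x. f x * g x)"
proof (induction m arbitrary: f g)
  case (Suc m)
  then obtain f' g' where *: "\<forall>x\<in>S. (f has_real_derivative f' x) (at x)" "times_diff m S f'"
    "\<forall>x\<in>S. (g has_real_derivative g' x) (at x)" "times_diff m S g'" by auto
  have "times_diff m S (\<lambda>x. f' x * g x + g' x * f x)"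
    using * Suc.prems[THEN times_diff_SucD] by (intro times_diff_add Suc.IH) auto
  then show ?case using * by (auto intro!: exI[of _ "\<lambda>x. f' x * g x + g' x * f x"] DERIV_mult)
qed simp

lemma times_diff_const: "times_diff m S (\<lambda>_. c)"
  by (induction m arbitrary: c) (auto intro!: exI[of _ "\<lambda>_. 0"])

lemma times_diff_inverse:
  assumes "\<And>x. x \<in> S \<Longrightarrow> f x \<noteq> 0"
  shows "times_diff m S f \<Longrightarrow> times_diff m S (\<lambda>x. inverse (f x))"
proof (induction m)
  case (Suc m)
  then obtain f' where *: "\<forall>x\<in>S. (f has_real_derivative f' x) (at x)" "times_diff m S f'" by auto
  have "times_diff m S (\<lambda>x. - 1 * (inverse (f x) * f' x * inverse (f x)))"
    using * Suc.IH[OF times_diff_SucD[OF Suc.prems]] by (intro times_diff_mult times_diff_const) auto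
  moreover have "((\<lambda>x. inverse (f x)) has_real_derivative - 1 * (inverse (f x) * f' x * inverse (f x))) (at x)" if "x \<in> S" for x
    using DERIV_inverse'[of f "f' x" x UNIV] * assms that by simp
  ultimately show ?case
    unfolding times_diff.simps(2) by (intro exI[of _ "\<lambda>x. - 1 * (inverse (f x) * f' x * inverse (f x))"] conjI ballI)
qed simp

lemma times_diff_reflect: "times_diff m UNIV f \<Longrightarrow> times_diff m UNIV (\<lambda>x. f (a + c * x))"
proof (induction m arbitrary: f)
  case (Suc m)
  then obtain f' where *: "\<And>x. (f has_real_derivative f' x) (at x)" "times_diff m UNIV f'" by auto
  have "((\<lambda>x. f (a + c * x)) has_real_derivative f' (a + c * x) * c) (at x)" for x
    by (rule DERIV_chain2[OF *(1)]) (auto intro!: derivative_eq_intros)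
  moreover have "times_diff m UNIV (\<lambda>x. f' (a + c * x) * c)"
    using *(2) by (intro times_diff_mult times_diff_const Suc.IH)
  ultimately show ?case
    unfolding times_diff.simps(2) by (intro exI[of _ "\<lambda>x. f' (a + c * x) * c"] conjI ballI)
qed simp

lemma times_diff_subset: "times_diff m S f \<Longrightarrow> T \<subseteq> S \<Longrightarrow> times_diff m T f"
  by (induction m arbitrary: f) auto

lemma deriv_seq_times_diff: "deriv_seq S D \<Longrightarrow> times_diff m S (D n)"
  by (induction m arbitrary: n) (auto simp: deriv_seq_def)

lemma deriv_seq_exists:
  assumes S: "open S" and f: "\<And>m. times_diff m S f"
  shows "deriv_seq S (\<lambda>n. (deriv ^^ n) f)"
proof -
  have "times_diff m S ((deriv ^^ n) f)" for m n
  proof (induction n arbitrary: m)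
    case (Suc n)
    obtain g where g: "\<forall>x\<in>S. ((deriv ^^ n) f has_real_derivative g x) (at x)" "times_diff m S g"
      using Suc[of "Suc m"] by auto
    have "times_diff m S (deriv ((deriv ^^ n) f))"
      using g by (intro times_diff_cong[OF S _ g(2)]) (auto simp: DERIV_imp_deriv)
    then show ?case by simp
  qed (simp add: f)
  note td = this
  show ?thesis unfolding deriv_seq_def
  proof (intro allI ballI)
    fix n x assume x: "x \<in> S"
    obtain g where "\<forall>x\<in>S. ((deriv ^^ n) f has_real_derivative g x) (at x)" using td[of "Suc 0" n] by auto
    then have g: "((deriv ^^ n) f has_real_derivative g x) (at x)" using x by blast
    then have "deriv ((deriv ^^ n) f) x = g x" by (rule DERIV_imp_deriv)
    with g show "((deriv ^^ n) f has_real_derivative (deriv ^^ Suc n) f x) (at x)" by simp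
  qed
qed

section \<open>Flat functions and the truncated logarithm\<close>

definition flat_exp :: "real poly \<Rightarrow> real \<Rightarrow> real" where
  "flat_exp P x = (if x \<le> 0 then 0 else poly P (inverse x) * exp (- inverse x))"

text \<open>Functions P(1/x) exp (-1/x), extended by 0, are closed under differentiation: P becomes
  X^2 (P - P'). At the origin the exponential beats every polynomial in 1/x, so all derivatives
  vanish there.\<close>

lemma flat_exp_has_derivative:
  "(flat_exp P has_real_derivative flat_exp (monom 1 2 * (P - pderiv P)) x) (at x)"
proof -
  consider "x < 0" | "x = 0" | "0 < x" by linarith
  then show ?thesis
  proof cases
    case 1
    have "((\<lambda>_. 0) has_real_derivative 0) (at x)" by simp
    then have "(flat_exp P has_real_derivative 0) (at x)"
      by (rule has_field_derivative_transform_within_open[where S = "{..<0}"]) (use 1 in \<open>auto simp: flat_exp_def\<close>)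
    then show ?thesis using 1 by (simp add: flat_exp_def)
  next
    case 3
    have "((\<lambda>x. poly P (inverse x) * exp (- inverse x)) has_real_derivative
        poly (monom 1 2 * (P - pderiv P)) (inverse x) * exp (- inverse x)) (at x)"
    proof -
      have 1: "((\<lambda>x. poly P (inverse x)) has_real_derivative poly (pderiv P) (inverse x) * (- (inverse x ^ 2))) (at x)"
        by (rule DERIV_chain2[OF poly_DERIV]) (use 3 in \<open>auto intro!: derivative_eq_intros simp: power2_eq_square\<close>)
      have 2: "((\<lambda>x. exp (- inverse x)) has_real_derivative exp (- inverse x) * (inverse x ^ 2)) (at x)"
        by (rule DERIV_chain2[OF DERIV_exp]) (use 3 in \<open>auto intro!: derivative_eq_intros simp: power2_eq_square\<close>)
      show ?thesis using DERIV_mult[OF 1 2] by (simp add: poly_monom algebra_simps)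
    qed
    then have "(flat_exp P has_real_derivative poly (monom 1 2 * (P - pderiv P)) (inverse x) * exp (- inverse x)) (at x)"
      by (rule has_field_derivative_transform_within_open[where S = "{0<..}"]) (use 3 in \<open>auto simp: flat_exp_def\<close>)
    then show ?thesis using 3 by (simp add: flat_exp_def)
  next
    case 2
    \<comment> \<open>The extra factor \<open>monom 1 1\<close> is the 1/h of the difference
      quotient at 0.\<close>
    have "((\<lambda>t. poly (monom 1 1 * P) t * exp (- t)) \<longlongrightarrow> 0) at_top"
    proof -
      have "((\<lambda>t. \<Sum>i\<le>degree (monom 1 1 * P). coeff (monom 1 1 * P) i * (t ^ i / exp t)) \<longlongrightarrow> (\<Sum>i\<le>degree (monom 1 1 * P). coeff (monom 1 1 * P) i * 0)) at_top"
        by (intro tendsto_intros tendsto_power_div_exp_0)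
      then show ?thesis by (simp add: poly_altdef sum_distrib_right exp_minus divide_inverse mult.assoc)
    qed
    then have r: "((\<lambda>h. poly (monom 1 1 * P) (inverse h) * exp (- inverse h)) \<longlongrightarrow> 0) (at_right 0)"
      by (rule filterlim_compose[OF _ filterlim_inverse_at_top_right])
    have "((\<lambda>h. flat_exp P h / h) \<longlongrightarrow> 0) (at_right 0)"
      by (rule Lim_transform_eventually[OF r])
        (auto simp: eventually_at_filter flat_exp_def poly_monom divide_inverse mult_ac intro!: always_eventually)
    moreover have "((\<lambda>h. flat_exp P h / h) \<longlongrightarrow> 0) (at_left 0)"
      by (rule Lim_transform_eventually[OF tendsto_const])
        (auto simp: eventually_at_filter flat_exp_def intro!: always_eventually)
    ultimately have "((\<lambda>h. flat_exp P h / h) \<longlongrightarrow> 0) (at 0)" by (rule filterlim_split_at[rotated])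
    then have "(flat_exp P has_real_derivative 0) (at 0)" by (simp add: DERIV_def flat_exp_def)
    then show ?thesis using 2 by (simp add: flat_exp_def)
  qed
qed

lemma times_diff_flat_exp: "times_diff m UNIV (flat_exp P)"
  by (induction m arbitrary: P) (use flat_exp_has_derivative in auto)

text \<open>The cutoff is f / (f + g) with f flat beyond 1/2 and g flat below 1/8; at every point
  one of them is positive, so the quotient is smooth, equal to 1 near 0 and to 0 from 1/2
  on.\<close>

lemma truncated_log_exists:
  obtains \<Psi> where "deriv_seq {0<..} \<Psi>" "\<And>s. 0 < s \<Longrightarrow> s < 1 / 8 \<Longrightarrow> \<Psi> 0 s = - ln s" "\<And>s. 1 / 2 \<le> s \<Longrightarrow> \<Psi> 0 s = 0"
proof -
  let ?f = "\<lambda>s. flat_exp 1 (1 / 2 + - 1 * s)" and ?g = "\<lambda>s. flat_exp 1 (- 1 / 8 + 1 * s)"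
  define \<psi> where "\<psi> s = - 1 * ln s * (?f s * inverse (?f s + ?g s))" for s
  have pos: "0 < ?f s + ?g s" for s by (auto simp: flat_exp_def intro: add_pos_pos add_nonneg_pos add_pos_nonneg)
  have d: "times_diff m {0<..} \<psi>" for m
    unfolding \<psi>_def
  proof (intro times_diff_mult times_diff_const times_diff_inverse times_diff_add)
    show "times_diff m {0<..} ln" using deriv_seq_times_diff[OF deriv_seq_ln, of m 0] by (simp add: ln_deriv_def[abs_def])
    show "times_diff m {0<..} ?f" by (rule times_diff_subset[OF times_diff_reflect[OF times_diff_flat_exp]]) simp
    then show "times_diff m {0<..} ?f" .
    show "times_diff m {0<..} ?g" by (rule times_diff_subset[OF times_diff_reflect[OF times_diff_flat_exp]]) simp
    show "?f s + ?g s \<noteq> 0" for s using pos[of s] by linarith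
  qed
  show thesis
  proof (rule that[of "\<lambda>n. (deriv ^^ n) \<psi>"])
    show "deriv_seq {0<..} (\<lambda>n. (deriv ^^ n) \<psi>)" by (rule deriv_seq_exists[OF open_greaterThan d])
    show "(deriv ^^ 0) \<psi> s = - ln s" if "0 < s" "s < 1 / 8" for s
    proof -
      have "?g s = 0" "?f s \<noteq> 0" using that by (auto simp: flat_exp_def)
      then show ?thesis by (simp add: \<psi>_def)
    qed
    show "(deriv ^^ 0) \<psi> s = 0" if "1 / 2 \<le> s" for s using that by (simp add: \<psi>_def flat_exp_def)
  qed
qed

subsection \<open>The upper bound\<close>

text \<open>The action of \<open>- \<Delta>\<close> in dimension \<open>2k\<close> on functions of \<open>s = |x|\<^sup>2 + e\<close>, on the level of derivative sequences.\<close>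

definition radial_step :: "nat \<Rightarrow> real \<Rightarrow> (nat \<Rightarrow> real \<Rightarrow> real) \<Rightarrow> nat \<Rightarrow> real \<Rightarrow> real" where
  "radial_step k e D n s = - (4 * (s - e) * D (Suc (Suc n)) s + 4 * (real n + real k) * D (Suc n) s)"

text \<open>The summand \<open>real n\<close> in the coefficient is Leibniz's: each differentiation
  of 4 (s - e) D'' releases one more 4 D'', which raises the coefficient n + k to n + 1 + k.\<close>

lemma deriv_seq_radial_step:
  assumes "deriv_seq S D" shows "deriv_seq S (radial_step k e D)"
  unfolding deriv_seq_def
proof (intro allI ballI)
  fix n x assume x: "x \<in> S"
  note D = deriv_seqD[OF assms x]
  have "((\<lambda>s. - (4 * (s - e) * D (Suc (Suc n)) s + 4 * (real n + real k) * D (Suc n) s)) has_real_derivative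
      - ((4 * 1) * D (Suc (Suc n)) x + D (Suc (Suc (Suc n))) x * (4 * (x - e)) + 4 * (real n + real k) * D (Suc (Suc n)) x)) (at x)"
    by (intro DERIV_minus DERIV_add DERIV_mult DERIV_cmult D) (auto intro!: derivative_eq_intros)
  then show "(radial_step k e D n has_real_derivative radial_step k e D (Suc n) x) (at x)"
    by (simp add: radial_step_def[abs_def] algebra_simps)
qed

lemma deriv_seq_radial_pow: "deriv_seq S D \<Longrightarrow> deriv_seq S ((radial_step k e ^^ j) D)"
  by (induction j) (auto intro: deriv_seq_radial_step)

lemma lap_pow_radial:
  fixes x :: "real^'n::finite"
  assumes N: "CARD('n) = 2 * k" and D: "deriv_seq {0<..} D" and e: "0 < e"
  shows "(- 1) ^ j * (lap ^^ j) (\<lambda>y. D 0 ((norm y)\<^sup>2 + e)) x = (radial_step k e ^^ j) D 0 ((norm x)\<^sup>2 + e)"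
proof (induction j arbitrary: x)
  case (Suc j)
  let ?G = "(radial_step k e ^^ j) D"
  have G: "deriv_seq {0<..} ?G" by (rule deriv_seq_radial_pow[OF D])
  have im: "(\<lambda>y :: real^'n. (norm (y - 0))\<^sup>2 + e) ` UNIV \<subseteq> {0<..}" using e by (auto simp: add_nonneg_pos)
  have smG: "smooth_on UNIV (\<lambda>y :: real^'n. ?G 0 ((norm y)\<^sup>2 + e))"
    using smooth_on_compose[OF open_UNIV smooth_on_add[OF open_UNIV smooth_on_norm_sq[OF open_UNIV, of 0] smooth_on_const[of UNIV e]] G, of 0] im by simp
  have s1: "(- 1) ^ j * (- 1) ^ j = (1::real)" by (simp flip: power_mult_distrib)
  have "(lap ^^ j) (\<lambda>y :: real^'n. D 0 ((norm y)\<^sup>2 + e)) = (\<lambda>y. (- 1) ^ j * ?G 0 ((norm y)\<^sup>2 + e))"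
  proof
    fix y :: "real^'n" show "(lap ^^ j) (\<lambda>y. D 0 ((norm y)\<^sup>2 + e)) y = (- 1) ^ j * ?G 0 ((norm y)\<^sup>2 + e)"
      unfolding Suc.IH[of y, symmetric] mult.assoc[symmetric] s1 by simp
  qed
  then have "(lap ^^ Suc j) (\<lambda>y. D 0 ((norm y)\<^sup>2 + e)) x = (- 1) ^ j * lap (\<lambda>y. ?G 0 ((norm y)\<^sup>2 + e)) x"
    by (simp add: lap_cmult[OF open_UNIV smG UNIV_I])
  also have "lap (\<lambda>y. ?G 0 ((norm y)\<^sup>2 + e)) x = - radial_step k e ?G 0 ((norm x)\<^sup>2 + e)"
    using lap_radial[OF open_UNIV G im UNIV_I, of 0 x] by (simp add: radial_step_def N)
  finally have "(- 1) ^ Suc j * (lap ^^ Suc j) (\<lambda>y. D 0 ((norm y)\<^sup>2 + e)) x = ((- 1) ^ j * (- 1) ^ j) * radial_step k e ?G 0 ((norm x)\<^sup>2 + e)"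
    by simp
  then show ?case unfolding s1 by simp
qed simp

text \<open>The bound is uniform in e, although the operator depends on e: on an interval away from
  0 the coefficients and the derivatives of the profile are bounded. This makes the energy of the
  transition zone O(1).\<close>

lemma radial_pow_bounded:
  assumes D: "deriv_seq {0<..} D" and ab: "0 < a" "b \<le> 1"
  shows "\<exists>C. \<forall>e\<in>{0..1}. \<forall>s\<in>{a..b}. \<bar>(radial_step k e ^^ j) D n s\<bar> \<le> C"
proof (induction j arbitrary: n)
  case 0
  have "continuous_on {a..b} (D n)"
    using ab by (intro continuous_at_imp_continuous_on ballI DERIV_isCont[OF deriv_seqD[OF D]]) auto
  then have "compact (D n ` {a..b})" by (intro compact_continuous_image) auto
  then have "bounded (D n ` {a..b})" by (rule compact_imp_bounded)
  then obtain C where C: "\<And>s. s \<in> {a..b} \<Longrightarrow> norm (D n s) \<le> C" unfolding bounded_iff by blast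
  have "\<bar>(radial_step k e ^^ 0) D n s\<bar> \<le> C" if "s \<in> {a..b}" for e s using C[OF that] by simp
  then show ?case by blast
next
  case (Suc j)
  let ?G = "\<lambda>e. (radial_step k e ^^ j) D"
  obtain C1 where C1: "\<And>e s. e \<in> {0..1} \<Longrightarrow> s \<in> {a..b} \<Longrightarrow> \<bar>?G e (Suc n) s\<bar> \<le> C1" using Suc.IH[of "Suc n"] by blast
  obtain C2 where C2: "\<And>e s. e \<in> {0..1} \<Longrightarrow> s \<in> {a..b} \<Longrightarrow> \<bar>?G e (Suc (Suc n)) s\<bar> \<le> C2" using Suc.IH[of "Suc (Suc n)"] by blast
  have *: "\<bar>radial_step k e (?G e) n s\<bar> \<le> 4 * 1 * C2 + 4 * (real n + real k) * C1" if e: "e \<in> {0..1}" and s: "s \<in> {a..b}" for e s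
  proof -
    have "\<bar>4 * (s - e) * ?G e (Suc (Suc n)) s\<bar> \<le> 4 * 1 * C2"
      unfolding abs_mult using e s ab C2[OF e s] by (intro mult_mono) auto
    moreover have "\<bar>4 * (real n + real k) * ?G e (Suc n) s\<bar> \<le> 4 * (real n + real k) * C1"
      unfolding abs_mult using C1[OF e s] by (intro mult_mono) auto
    ultimately show ?thesis unfolding radial_step_def by linarith
  qed
  show ?case unfolding funpow.simps o_apply by (intro exI ballI) (rule *)
qed

context
  fixes k :: nat
  assumes N: "CARD('n::finite) = 2 * k" and k: "0 < k"
begin

text \<open>Under x = sqrt e z the Jacobian e^k and the prefactor e^k cancel the power e^(2k) of the
  denominator.\<close>

lemma integral_bubble_scaled:
  assumes e: "0 < e"
  shows "integrable lborel (\<lambda>x :: real^'n. (4 * e) ^ k * fact (2 * k - 1) / ((norm x)\<^sup>2 + e) ^ (2 * k))"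
    and "(\<integral>x. (4 * e) ^ k * fact (2 * k - 1) / ((norm (x :: real^'n))\<^sup>2 + e) ^ (2 * k) \<partial>lborel) = kern_const k"
proof -
  let ?c = "sqrt e"
  let ?f = "\<lambda>x :: real^'n. (4 * e) ^ k * fact (2 * k - 1) / ((norm x)\<^sup>2 + e) ^ (2 * k)"
  have c: "0 < ?c" using e by simp
  have ce: "?c ^ (2 * k) = e ^ k" using e by (simp add: power_mult)
  have pt: "?c ^ (2 * k) * ?f (0 + ?c *\<^sub>R z) = 4 ^ k * fact (2 * k - 1) * (1 / (1 + (norm z)\<^sup>2) ^ (2 * k))" for z
  proof -
    have "(norm (0 + ?c *\<^sub>R z))\<^sup>2 + e = e * (1 + (norm z)\<^sup>2)" using e by (simp add: power_mult_distrib algebra_simps)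
    moreover have "e ^ (2 * k) = e ^ k * e ^ k" by (simp add: mult_2 power_add)
    ultimately show ?thesis using e unfolding ce by (simp add: power_mult_distrib)
  qed
  have fm: "?f \<in> borel_measurable borel"
    using e by (intro borel_measurable_continuous_onI continuous_intros) (auto simp: add_nonneg_eq_0_iff)
  have f0: "0 \<le> ?f x" for x using e by simp
  have pos: "0 \<le> 1 / (1 + (norm z)\<^sup>2) ^ (2 * k)" for z :: "real^'n" by simp
  have "(\<integral>\<^sup>+x. ennreal (?f x) \<partial>lborel) = (\<integral>\<^sup>+z. ennreal (?c ^ CARD('n)) * ennreal (?f (0 + ?c *\<^sub>R z)) \<partial>lborel)"
    by (rule nn_integral_affine[OF _ c]) (use fm in measurable)
  also have "\<dots> = (\<integral>\<^sup>+z. ennreal (4 ^ k * fact (2 * k - 1)) * ennreal (1 / (1 + (norm (z :: real^'n))\<^sup>2) ^ (2 * k)) \<partial>lborel)"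
  proof (rule nn_integral_cong)
    fix z :: "real^'n"
    have "ennreal (?c ^ CARD('n)) * ennreal (?f (0 + ?c *\<^sub>R z)) = ennreal (?c ^ (2 * k) * ?f (0 + ?c *\<^sub>R z))"
      using c f0 by (subst ennreal_mult) (auto simp: N)
    also have "\<dots> = ennreal (4 ^ k * fact (2 * k - 1)) * ennreal (1 / (1 + (norm z)\<^sup>2) ^ (2 * k))"
      unfolding pt by (rule ennreal_mult) (use pos in auto)
    finally show "ennreal (?c ^ CARD('n)) * ennreal (?f (0 + ?c *\<^sub>R z)) = \<dots>" .
  qed
  also have "\<dots> = ennreal (4 ^ k * fact (2 * k - 1)) * ennreal (bubble_mass k)"
    by (subst nn_integral_cmult) (auto simp: nn_integral_bubble[OF N k] bubble_mass_def)
  also have "\<dots> = ennreal (kern_const k)"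
    unfolding kern_const_def by (rule ennreal_mult[symmetric]) (auto simp: bubble_mass_def)
  finally have nn: "(\<integral>\<^sup>+x. ennreal (?f x) \<partial>lborel) = ennreal (kern_const k)" .
  show "integrable lborel ?f" using nn f0 fm by (intro integrableI_nonneg) auto
  show "(\<integral>x. ?f x \<partial>lborel) = kern_const k"
    using nn f0 fm kern_const_pos[of k] by (subst integral_eq_nn_integral) auto
qed

text \<open>In the core the k-th power of the negative Laplacian of u is a bubble of mass
  \<open>kern_const k\<close> and u is at most ln (1/e), which gives the leading term. The
  transition zone has e-independent size, and further out u vanishes. The integral of |u|^p is
  estimated on the ball |x|^2 < e alone.\<close>

lemma sobolev_quotient_upper:
  obtains C where "\<And>e p. 0 < e \<Longrightarrow> e < 1 / 16 \<Longrightarrow> 0 < p \<Longrightarrow> \<exists>u\<in>(test_functions :: (real^'n \<Rightarrow> real) set) - {\<lambda>_. 0}.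
    gjms_norm_sq k u \<le> kern_const k * ln (1 / e) + C \<and>
    (ln (1 / e) - ln 2) powr p * (unit_ball_vol (2 * k) * e ^ k) \<le> (\<integral>x. \<bar>u x\<bar> powr p \<partial>hyp_vol)"
proof -
  obtain \<Psi> where \<Psi>: "deriv_seq {0<..} \<Psi>" "\<And>s. 0 < s \<Longrightarrow> s < 1 / 8 \<Longrightarrow> \<Psi> 0 s = - ln s" "\<And>s. 1 / 2 \<le> s \<Longrightarrow> \<Psi> 0 s = 0"
    using truncated_log_exists by blast
  obtain C1 where C1: "\<And>e s. e \<in> {0..1} \<Longrightarrow> s \<in> {1/8..1/2} \<Longrightarrow> \<bar>(radial_step k e ^^ k) \<Psi> 0 s\<bar> \<le> C1"
  proof -
    have "\<exists>C. \<forall>e\<in>{0..1}. \<forall>s\<in>{1/8..1/2}. \<bar>(radial_step k e ^^ k) \<Psi> 0 s\<bar> \<le> C"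
      by (rule radial_pow_bounded[OF \<Psi>(1)]) auto
    then show thesis using that by blast
  qed
  obtain C2 where C2: "\<And>s. s \<in> {1/8..1/2} \<Longrightarrow> \<bar>\<Psi> 0 s\<bar> \<le> C2"
  proof -
    have "\<exists>C. \<forall>e\<in>{0..1}. \<forall>s\<in>{1/8..1/2}. \<bar>(radial_step k e ^^ 0) \<Psi> 0 s\<bar> \<le> C"
      by (rule radial_pow_bounded[OF \<Psi>(1)]) auto
    then obtain C where "\<forall>e\<in>{0..1::real}. \<forall>s\<in>{1/8..1/2}. \<bar>\<Psi> 0 s\<bar> \<le> C" by auto
    then have "\<forall>s\<in>{1/8..1/2}. \<bar>\<Psi> 0 s\<bar> \<le> C" by (rule bspec[of _ _ 0]) simp
    then show thesis using that by blast
  qed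
  have C12: "0 \<le> C1" "0 \<le> C2" using C1[of 0 "1/8"] C2[of "1/8"] by auto
  show thesis
  proof (rule that[of "C1 * C2 * unit_ball_vol (2 * k)"])
    fix e p :: real assume e: "0 < e" "e < 1 / 16" and p: "0 < p"
    define s where "s x = (norm x)\<^sup>2 + e" for x :: "real^'n"
    define u where "u x = \<Psi> 0 (s x)" for x
    define L where "L = ln (1 / e)"
    have spos: "0 < s x" for x using e by (simp add: s_def add_nonneg_pos)
    have se: "e \<le> s x" for x by (simp add: s_def)
    have L1: "ln 2 < L" using e unfolding L_def by (subst ln_less_cancel_iff) (auto simp: field_simps)
    then have L0: "0 < L" using ln_gt_zero[of 2] by linarith
    have sms: "smooth_on UNIV s" unfolding s_def[abs_def] using smooth_on_add[OF open_UNIV smooth_on_norm_sq[OF open_UNIV, of 0] smooth_on_const[of UNIV e]] by simp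
    have smu: "smooth_on UNIV u"
      unfolding u_def[abs_def] by (rule smooth_on_compose[OF open_UNIV sms \<Psi>(1)]) (use spos in auto)
    \<comment> \<open>The radius 3/4 works because 9/16 >= 1/2, the point from which the profile
      vanishes.\<close>
    have u0: "u x = 0" if "x \<notin> cball 0 (3/4)" for x
    proof -
      have "(3/4)\<^sup>2 \<le> (norm x)\<^sup>2" using that by (intro power_mono) auto
      then show ?thesis unfolding u_def s_def using e by (intro \<Psi>(3)) (simp add: power2_eq_square)
    qed
    have ut: "u \<in> test_functions"
    proof -
      have sub: "closure {x. u x \<noteq> 0} \<subseteq> cball 0 (3/4)"
        by (rule closure_minimal) (use u0 in blast, simp)
      have "compact (closure {x. u x \<noteq> 0})"
        unfolding compact_eq_bounded_closed using bounded_subset[OF bounded_cball sub] by simp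
      moreover have "cball 0 (3/4) \<subseteq> ball (0 :: real^'n) 1" by auto
      ultimately show ?thesis using sub smooth_on_subset[OF smu subset_UNIV] unfolding test_functions_def by blast
    qed
    have ucen: "u x = - ln (s x)" if "s x < 1 / 8" for x unfolding u_def using spos that by (intro \<Psi>(2))
    define b where "b x = (4 * e) ^ k * fact (2 * k - 1) / s x ^ (2 * k)" for x
    have bub0: "0 \<le> b x" for x using e spos[of x] by (simp add: b_def)
    define F where "F x = (- 1) ^ k * (lap ^^ k) u x" for x
    have Fcen: "F x = b x" if "s x < 1 / 8" for x
    proof -
      have "open {x. s x < 1 / 8}"
        using smooth_on_continuous[OF sms] by (intro open_Collect_less continuous_on_const) auto
      then have "(lap ^^ k) u x = (lap ^^ k) (\<lambda>y. - 1 * ln ((norm (y - 0))\<^sup>2 + e) + 0 * ln ((norm (y - 0))\<^sup>2 + e)) x"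
        by (rule lap_pow_cong) (use that ucen in \<open>auto simp: s_def\<close>)
      also have "\<dots> = - 1 * (lap ^^ k) (\<lambda>y. ln ((norm (y - 0))\<^sup>2 + e)) x + 0 * (lap ^^ k) (\<lambda>y. ln ((norm (y - 0))\<^sup>2 + e)) x"
        using smooth_on_ln_deriv_norm_sq[OF e(1) open_UNIV, of 0 0] by (intro lap_pow_lin[OF open_UNIV _ _ UNIV_I]) auto
      finally show ?thesis
        unfolding F_def using lap_pow_ln_norm_sq[OF N e(1) k, of 0 x] by (simp add: s_def b_def)
    qed
    have Fall: "F x = (radial_step k e ^^ k) \<Psi> 0 (s x)" for x
      unfolding F_def u_def[abs_def] s_def[abs_def] by (rule lap_pow_radial[OF N \<Psi>(1) e(1)])
    \<comment> \<open>The nonnegative bubble may be kept on the whole space, so that its exact total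
      mass can be used.\<close>
    have Fu: "F x * u x \<le> L * b x + indicator (cball 0 1) x * (C1 * C2)" for x
    proof -
      consider "s x < 1 / 8" | "1 / 8 \<le> s x" "s x \<le> 1 / 2" | "1 / 2 < s x" by linarith
      then show ?thesis
      proof cases
        case 1
        have "- ln (s x) \<le> L" unfolding L_def using se[of x] e spos[of x] by (simp add: ln_div)
        then have "F x * u x \<le> b x * L"
          unfolding Fcen[OF 1] ucen[OF 1] using bub0[of x] by (rule mult_left_mono)
        moreover have "0 \<le> indicator (cball 0 1) x * (C1 * C2)" using C12 by simp
        ultimately show ?thesis by (simp add: mult.commute)
      next
        case 2
        have "\<bar>F x\<bar> * \<bar>u x\<bar> \<le> C1 * C2"
          unfolding Fall u_def using 2 e C12 by (intro mult_mono C1 C2) auto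
        then have "F x * u x \<le> C1 * C2" by (simp add: abs_mult[symmetric] abs_le_iff)
        moreover have "x \<in> cball 0 1"
        proof -
          have "(norm x)\<^sup>2 \<le> 1\<^sup>2" using 2(2) e by (simp add: s_def)
          then have "norm x \<le> 1" by (rule power2_le_imp_le) simp
          then show ?thesis by simp
        qed
        moreover have "0 \<le> L * b x" using bub0[of x] L0 by (intro mult_nonneg_nonneg) auto
        ultimately show ?thesis by simp
      next
        case 3
        then have "u x = 0" unfolding u_def by (intro \<Psi>(3)) simp
        then show ?thesis using bub0[of x] L0 C12 by (simp only: mult_zero_right) (intro add_nonneg_nonneg mult_nonneg_nonneg; simp)
      qed
    qed
    have vol: "integrable lborel (\<lambda>x :: real^'n. indicator (cball 0 1) x * (C1 * C2))"
      "(\<integral>x. indicator (cball 0 1) (x :: real^'n) * (C1 * C2) \<partial>lborel) = C1 * C2 * unit_ball_vol (2 * k)"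
    proof -
      show "integrable lborel (\<lambda>x :: real^'n. indicator (cball 0 1) x * (C1 * C2))"
        using emeasure_lborel_cball_finite[of "0 :: real^'n" 1] by (intro integrable_mult_left integrable_real_indicator) auto
      have "measure lborel (cball (0 :: real^'n) 1) = unit_ball_vol (2 * k)"
        by (simp add: measure_def emeasure_cball N)
      then show "(\<integral>x. indicator (cball 0 1) (x :: real^'n) * (C1 * C2) \<partial>lborel) = C1 * C2 * unit_ball_vol (2 * k)"
        by simp
    qed
    note bub = integral_bubble_scaled[OF e(1), folded s_def, folded b_def]
    have "gjms_norm_sq k u = (\<integral>x. F x * u x \<partial>lborel)"
      unfolding gjms_norm_sq_eq[OF N ut] F_def ..
    also have "\<dots> \<le> (\<integral>x. L * b x + indicator (cball 0 1) x * (C1 * C2) \<partial>lborel)"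
    proof (rule integral_mono[OF _ _ Fu])
      have "(\<lambda>x. (lap ^^ k) u x * ((- 1) ^ k * u x)) \<in> test_functions"
        by (intro test_functions_mult test_functions_lap_pow ut smooth_on_mult smooth_on_const test_functions_smooth_on_ball open_ball)
      then show "integrable lborel (\<lambda>x. F x * u x)"
        using test_functions_integrable by (simp add: F_def[abs_def] mult_ac)
      show "integrable lborel (\<lambda>x. L * b x + indicator (cball 0 1) x * (C1 * C2))"
        by (intro Bochner_Integration.integrable_add integrable_mult_right bub(1) vol(1))
    qed
    also have "\<dots> = L * kern_const k + C1 * C2 * unit_ball_vol (2 * k)"
      using bub vol by (simp only: Bochner_Integration.integral_add integrable_mult_right integral_mult_right_zero)
    finally have E: "gjms_norm_sq k u \<le> kern_const k * ln (1 / e) + C1 * C2 * unit_ball_vol (2 * k)"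
      by (simp add: L_def mult.commute)
    \<comment> \<open>On this ball s lies below 2 e, hence the loss ln 2; the bound e < 1/16 keeps 2
      e below 1/8, where u is exactly -ln s.\<close>
    have low: "(L - ln 2) powr p * indicator {x. (norm x)\<^sup>2 < e} x \<le> hyp_density x * \<bar>u x\<bar> powr p" for x
    proof (cases "(norm x)\<^sup>2 < e")
      case True
      then have s2: "s x < 2 * e" by (simp add: s_def)
      have "ln (s x) \<le> ln (2 * e)" using s2 spos[of x] by (subst ln_le_cancel_iff) auto
      then have "L - ln 2 \<le> u x" using e s2 unfolding L_def by (subst ucen) (auto simp: ln_mult ln_div)
      then have 1: "(L - ln 2) powr p \<le> \<bar>u x\<bar> powr p" using L1 p by (intro powr_mono2) auto
      have "(norm x)\<^sup>2 < 1\<^sup>2" using True e by simp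
      then have x: "x \<in> ball 0 1" by (simp add: power2_less_imp_less)
      have "- 1 \<le> (norm x)\<^sup>2" by (rule order_trans[OF _ zero_le_power2]) simp
      then have "rho x \<le> 1" by (simp add: rho_def)
      then have "1 \<le> 1 / rho x" using rho_pos[OF x] by simp
      then have "1 \<le> (1 / rho x) ^ CARD('n)" by (rule one_le_power)
      then have "1 \<le> hyp_density x" using x by (simp only: hyp_density_def indicator_simps mult_1)
      then have "1 * (L - ln 2) powr p \<le> hyp_density x * \<bar>u x\<bar> powr p" using 1 by (intro mult_mono) auto
      then show ?thesis using True by simp
    next
      case False
      then show ?thesis using mult_nonneg_nonneg[OF hyp_density_nonneg powr_ge_zero] by simp
    qed
    have em: "emeasure lborel {x :: real^'n. (norm x)\<^sup>2 < e} = ennreal (unit_ball_vol (2 * k) * e ^ k)"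
      using e by (intro emeasure_norm_sq_less[OF N]) simp
    have "(L - ln 2) powr p * (unit_ball_vol (2 * k) * e ^ k) = (\<integral>x. (L - ln 2) powr p * indicator {x :: real^'n. (norm x)\<^sup>2 < e} x \<partial>lborel)"
      using em e by (simp add: measure_def)
    also have "\<dots> \<le> (\<integral>x. hyp_density x * \<bar>u x\<bar> powr p \<partial>lborel)"
      by (intro integral_mono[OF _ _ low] integrable_mult_right integrable_real_indicator integrable_powr_hyp_density[OF ut p])
        (use em in auto)
    also have "\<dots> = (\<integral>x. \<bar>u x\<bar> powr p \<partial>hyp_vol)"
      by (rule integral_hyp_vol[symmetric]) (use test_functions_measurable[OF ut] in measurable)
    finally have T: "(ln (1 / e) - ln 2) powr p * (unit_ball_vol (2 * k) * e ^ k) \<le> (\<integral>x. \<bar>u x\<bar> powr p \<partial>hyp_vol)"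
      by (simp add: L_def)
    have "u 0 \<noteq> 0"
    proof -
      have "s 0 = e" by (simp add: s_def)
      then have "u 0 = - ln e" using ucen[of 0] e by simp
      moreover have "ln e < 0" using e by simp
      ultimately show ?thesis by simp
    qed
    then have "u \<noteq> (\<lambda>_. 0)" by auto
    then show "\<exists>u\<in>(test_functions :: (real^'n \<Rightarrow> real) set) - {\<lambda>_. 0}.
      gjms_norm_sq k u \<le> kern_const k * ln (1 / e) + C1 * C2 * unit_ball_vol (2 * k) \<and>
      (ln (1 / e) - ln 2) powr p * (unit_ball_vol (2 * k) * e ^ k) \<le> (\<integral>x. \<bar>u x\<bar> powr p \<partial>hyp_vol)"
      using ut E T by blast
  qed
qed

section \<open>Evaluation of the constant \<open>beta0\<close>\<close>

lemma sphere_measure_sphere: "sphere_measure (sphere (0 :: real^'n) 1) = 2 * real k * unit_ball_vol (2 * k)"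
proof -
  have "{r *\<^sub>R y |r y. 0 < r \<and> r \<le> 1 \<and> y \<in> sphere (0 :: real^'n) 1} = cball 0 1 - {0}" (is "?A = _")
  proof
    show "?A \<subseteq> cball 0 1 - {0}" by auto
    show "cball 0 1 - {0} \<subseteq> ?A"
    proof
      fix x :: "real^'n" assume "x \<in> cball 0 1 - {0}"
      then have "x = norm x *\<^sub>R (x /\<^sub>R norm x) \<and> 0 < norm x \<and> norm x \<le> 1 \<and> x /\<^sub>R norm x \<in> sphere 0 1" by auto
      then show "x \<in> ?A" by blast
    qed
  qed
  moreover have "measure lebesgue (cball 0 1 - {0 :: real^'n}) = unit_ball_vol (2 * k)"
  proof -
    have "measure lebesgue (cball 0 1 - {0 :: real^'n}) = measure lebesgue (cball (0 :: real^'n) 1)"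
      by (rule measure_Diff_null_set) (auto simp: null_sets_completionI)
    then show ?thesis by (simp add: content_cball N)
  qed
  ultimately show ?thesis by (simp add: sphere_measure_def N)
qed

text \<open>For N = 2k both exponents p0 and p0' are 2, and in either parity the two Gamma values
  have the same argument and cancel. So the odd and even cases agree, and only the ball volume pi^k
  / k! remains.\<close>

lemma beta0_eq: "beta0 TYPE('n) k = real k * kern_const k"
proof -
  have "beta0 TYPE('n) k = 2 * real k / (2 * real k * (pi ^ k / fact k)) * (pi ^ k * 2 ^ k) powr 2"
  proof -
    have p0: "2 * real k / real k = 2" using k by simp
    have G: "Gamma ((real k + 1) / 2) \<noteq> 0" "Gamma (real k / 2) \<noteq> 0" by (rule less_imp_neq[OF Gamma_real_pos, symmetric]; use k in simp)+
    have a: "(2 * real k - real k + 1) / 2 = (real k + 1) / 2" "(2 * real k - real k) / 2 = real k / 2"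
      "2 * real k / 2 = real k" by auto
    have V: "unit_ball_vol (real (2 * k)) = pi ^ k / fact k" using unit_ball_vol_even[of k] by simp
    have R: "x * Gamma z / Gamma z = x" if "Gamma z \<noteq> 0" for x z :: real using that by simp
    have P: "pi powr real k = pi ^ k" by (rule powr_realpow) simp
    have q: "2 / (2 - 1) = (2 :: real)" by simp
    have n: "real CARD('n) = 2 * real k" by (simp only: N of_nat_mult of_nat_numeral)
    show ?thesis
      unfolding beta0_def Let_def sphere_measure_sphere n V p0 a P q R[OF G(1)] R[OF G(2)] if_cancel ..
  qed
  also have "\<dots> = fact k * (4 * pi) ^ k"
  proof -
    have "(pi ^ k * 2 ^ k) powr 2 = ((pi ^ k * 2 ^ k)\<^sup>2 :: real)" by (rule powr_numeral) simp
    also have "\<dots> = pi ^ k * (pi ^ k * (2\<^sup>2) ^ k)"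
      by (simp only: power2_eq_square power_mult_distrib mult_ac)
    finally have S: "(pi ^ k * 2 ^ k) powr 2 = pi ^ k * (pi ^ k * 4 ^ k)" by simp
    have D: "K / (K * (P / F)) * (P * (P * Q)) = F * (Q * P)" if "K \<noteq> 0" "P \<noteq> 0" "F \<noteq> 0" for K P F Q :: real
      using that by (simp add: field_simps)
    show ?thesis unfolding S power_mult_distrib by (rule D) (use k in auto)
  qed
  also have "fact k = real k * fact (k - 1)" using k fact_reduce[of k, where 'a = real] by simp
  finally show ?thesis by (simp add: kern_const_eq)
qed

section \<open>Matching the lower and the upper bound\<close>

lemma sobolev_const_tendsto:
  "((\<lambda>p. p * sobolev_const TYPE('n) p k) \<longlongrightarrow> 2 * beta0 TYPE('n) k * exp 1) at_top"
proof (rule order_tendstoI)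
  let ?c = "kern_const k"
  let ?l = "2 * beta0 TYPE('n) k * exp 1"
  have c: "0 < ?c" by (rule kern_const_pos)
  have l: "?l = ?c * (2 * real k * exp 1)" by (simp add: beta0_eq)
  obtain C where C: "\<And>e p. 0 < e \<Longrightarrow> e < 1 / 16 \<Longrightarrow> 0 < p \<Longrightarrow> \<exists>u\<in>(test_functions :: (real^'n \<Rightarrow> real) set) - {\<lambda>_. 0}.
    gjms_norm_sq k u \<le> ?c * ln (1 / e) + C \<and>
    (ln (1 / e) - ln 2) powr p * (unit_ball_vol (2 * k) * e ^ k) \<le> (\<integral>x. \<bar>u x\<bar> powr p \<partial>hyp_vol)"
    using sobolev_quotient_upper by blast
  let ?X = "(test_functions :: (real^'n \<Rightarrow> real) set) - {\<lambda>_. 0}"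
  let ?q = "\<lambda>p u. gjms_norm_sq k u / (\<integral>x. \<bar>u x\<bar> powr p \<partial>hyp_vol) powr (2 / p)"
  have ne: "?X \<noteq> {}" using C[of "1/32" 1] by auto
  fix a :: real
  {
    assume a: "a < ?l"
    \<comment> \<open>The midpoint makes the limiting lower bound exceed a while staying below rate
      k; the maximum with k/2 keeps \<alpha> positive when a is negative.\<close>
    define \<alpha> where "\<alpha> = max (real k / 2) ((a / (2 * exp 1 * ?c) + real k) / 2)"
    have ak: "a / (2 * exp 1 * ?c) < real k" using a c unfolding l by (simp add: divide_less_eq mult_ac)
    have \<alpha>: "0 < \<alpha>" "\<alpha> < real k" using k ak by (auto simp: \<alpha>_def)
    have "a / (2 * exp 1 * ?c) < \<alpha>" using ak by (simp add: \<alpha>_def less_max_iff_disj)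
    then have a\<alpha>: "a < ?c * (2 * \<alpha> * exp 1)" using c by (simp add: divide_less_eq mult_ac)
    obtain C' where C': "0 < C'" "\<And>p u. 4 * real k < p \<Longrightarrow> u \<in> ?X \<Longrightarrow>
      ?c * (C' * ((p / 2 - 2 * real k) / (exp 1 * \<alpha>)) powr (p / 2 - 2 * real k)) powr (- (2 / p)) \<le> ?q p u"
      using sobolev_quotient_lower[OF N k \<alpha>] by blast
    have "eventually (\<lambda>p. a < p * (?c * (C' * ((p / 2 - 2 * real k) / (exp 1 * \<alpha>)) powr (p / 2 - 2 * real k)) powr (- (2 / p)))) at_top"
      using order_tendstoD(1)[OF lower_bound_tendsto[OF N k C'(1) \<alpha>(1)] a\<alpha>] .
    then show "eventually (\<lambda>p. a < p * sobolev_const TYPE('n) p k) at_top"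
      using eventually_gt_at_top[of "4 * real k"]
    proof eventually_elim
      case (elim p)
      let ?b = "?c * (C' * ((p / 2 - 2 * real k) / (exp 1 * \<alpha>)) powr (p / 2 - 2 * real k)) powr (- (2 / p))"
      have "?b \<le> sobolev_const TYPE('n) p k"
        unfolding sobolev_const_def by (rule cINF_greatest[OF ne]) (rule C'(2)[OF elim(2)])
      then have "p * ?b \<le> p * sobolev_const TYPE('n) p k" using elim(2) by (intro mult_left_mono) auto
      then show ?case using elim(1) by linarith
    qed
  next
    assume a: "?l < a"
    define V where "V = unit_ball_vol (2 * k)"
    have V: "0 < V" by (simp add: V_def)
    define K where "K = real k"
    have K: "0 < K" using k by (simp add: K_def)
    have "((\<lambda>p. p * ((?c * (p / (2 * K)) + C) / ((p / (2 * K) - ln 2)\<^sup>2 * (V powr (2 / p) * exp (- 1))))) \<longlongrightarrow> ?c * (2 * K * exp 1)) at_top"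
      using V c K by real_asymp (simp add: exp_minus field_simps power2_eq_square)
    then have ev1: "eventually (\<lambda>p. p * ((?c * (p / (2 * K)) + C) / ((p / (2 * K) - ln 2)\<^sup>2 * (V powr (2 / p) * exp (- 1)))) < a) at_top"
      using a unfolding l K_def by (rule order_tendstoD(2))
    have ev2: "eventually (\<lambda>p. exp (- (p / (2 * K))) < 1 / 16) at_top" using K by real_asymp
    \<comment> \<open>Any admissible rate would do here: the lower bound only serves to show that
      the quotients are bounded below, so that the infimum lies under each of them.\<close>
    define \<alpha> where "\<alpha> = real k / 2"
    have \<alpha>: "0 < \<alpha>" "\<alpha> < real k" using k by (auto simp: \<alpha>_def)
    obtain C' where C': "0 < C'" "\<And>p u. 4 * real k < p \<Longrightarrow> u \<in> ?X \<Longrightarrow>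
      ?c * (C' * ((p / 2 - 2 * real k) / (exp 1 * \<alpha>)) powr (p / 2 - 2 * real k)) powr (- (2 / p)) \<le> ?q p u"
      using sobolev_quotient_lower[OF N k \<alpha>] by blast
    from ev1 ev2 eventually_gt_at_top[of "4 * real k"]
    show "eventually (\<lambda>p. p * sobolev_const TYPE('n) p k < a) at_top"
    proof eventually_elim
      case (elim p)
      have p: "0 < p" using elim(3) by (rule le_less_trans[rotated]) simp
      \<comment> \<open>With this e the logarithm ln (1/e) is p / (2k), the minimiser of the
        limiting quotient.\<close>
      define e where "e = exp (- (p / (2 * K)))"
      have e: "0 < e" "e < 1 / 16" using elim(2) by (auto simp: e_def)
      have Le: "ln (1 / e) = p / (2 * K)" by (simp add: e_def ln_div)
      obtain u where u: "u \<in> ?X" "gjms_norm_sq k u \<le> ?c * ln (1 / e) + C"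
        "(ln (1 / e) - ln 2) powr p * (V * e ^ k) \<le> (\<integral>x. \<bar>u x\<bar> powr p \<partial>hyp_vol)"
        using C[OF e p] unfolding V_def by blast
      have L2: "0 < p / (2 * K) - ln 2"
      proof -
        have "ln 2 < ln (1 / e)" using e by (subst ln_less_cancel_iff) (auto simp: field_simps)
        then show ?thesis by (simp add: Le)
      qed
      let ?T = "\<integral>x. \<bar>u x\<bar> powr p \<partial>hyp_vol"
      have T: "(p / (2 * K) - ln 2)\<^sup>2 * (V powr (2 / p) * exp (- 1)) \<le> ?T powr (2 / p)"
      proof -
        have "((p / (2 * K) - ln 2) powr p * (V * e ^ k)) powr (2 / p) \<le> ?T powr (2 / p)"
          using u(3) V e L2 p unfolding Le by (intro powr_mono2) auto
        also have "((p / (2 * K) - ln 2) powr p * (V * e ^ k)) powr (2 / p)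
            = (p / (2 * K) - ln 2) powr 2 * (V powr (2 / p) * (e ^ k) powr (2 / p))"
          using V e L2 p by (simp add: powr_mult powr_powr)
        \<comment> \<open>The volume e^k of the small ball, raised to 2/p, is the source of Euler's
          number on this side.\<close>
        also have "(e ^ k) powr (2 / p) = exp (- 1)"
          using p K e by (simp add: e_def powr_def ln_realpow K_def)
        finally show ?thesis using L2 by simp
      qed
      have P: "0 < (p / (2 * K) - ln 2)\<^sup>2 * (V powr (2 / p) * exp (- 1))" using L2 V by simp
      have bdd: "bdd_below (?q p ` ?X)" using C'(2)[OF elim(3)] by (intro bdd_belowI2)
      have "sobolev_const TYPE('n) p k \<le> ?q p u"
        unfolding sobolev_const_def by (rule cINF_lower[OF bdd u(1)])
      also have "\<dots> \<le> (?c * (p / (2 * K)) + C) / ((p / (2 * K) - ln 2)\<^sup>2 * (V powr (2 / p) * exp (- 1)))"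
      proof -
        have "0 \<le> ?c * (C' * ((p / 2 - 2 * real k) / (exp 1 * \<alpha>)) powr (p / 2 - 2 * real k)) powr (- (2 / p))"
          using c by simp
        then have "0 \<le> ?q p u" using C'(2)[OF elim(3) u(1)] by linarith
        moreover have "0 < ?T powr (2 / p)" using P T by linarith
        ultimately have "0 \<le> gjms_norm_sq k u" by (simp add: zero_le_divide_iff)
        then show ?thesis using u(2) P T unfolding Le by (intro frac_le) auto
      qed
      finally have "p * sobolev_const TYPE('n) p k \<le> p * ((?c * (p / (2 * K)) + C) / ((p / (2 * K) - ln 2)\<^sup>2 * (V powr (2 / p) * exp (- 1))))"
        using p by (intro mult_left_mono) auto
      then show ?case using elim(1) by linarith
    qed
  }
qed

end

theorem theorem5p1:
  fixes k :: nat
  assumes "k > 0"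
    and "CARD('n::finite) = 2 * k"
  shows "\<exists>\<epsilon> :: real \<Rightarrow> real. \<epsilon> \<in> o[at_top](\<lambda>_. 1) \<and>
           (\<forall>p\<ge>2. sobolev_const TYPE('n) p k = (2 * beta0 TYPE('n) k * exp 1 + \<epsilon> p) / p)"
proof (intro exI conjI allI impI)
  \<comment> \<open>The error term is defined by solving the claimed equation for it, so the
    equation holds at every p >= 2 and only its decay carries content.\<close>
  let ?\<epsilon> = "\<lambda>p. p * sobolev_const TYPE('n) p k - 2 * beta0 TYPE('n) k * exp 1"
  have "(?\<epsilon> \<longlongrightarrow> 2 * beta0 TYPE('n) k * exp 1 - 2 * beta0 TYPE('n) k * exp 1) at_top"
    by (intro tendsto_diff sobolev_const_tendsto tendsto_const assms)
  then show "?\<epsilon> \<in> o[at_top](\<lambda>_. 1)" by (intro smalloI_tendsto) auto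
  show "sobolev_const TYPE('n) p k = (2 * beta0 TYPE('n) k * exp 1 + ?\<epsilon> p) / p" if "2 \<le> p" for p
    using that by simp
qed

end
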